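(* Let $\mathbb{K}$ be a field, let $\Gamma$ be a finite, connected, simple graph, and let $\mathsf{C}\neq\emptyset$ be a set of vertices of $\Gamma$. Let $Z^{\mathsf{C}}(\Gamma)$ be the zigzag algebra over $\mathbb{K}$ with vertex condition for $\mathsf{C}$. The following are equivalent: (1) $Z^{\mathsf{C}}(\Gamma)$ is a cellular algebra (i.e. admits some cell datum); (2) $Z^{\mathsf{C}}(\Gamma)$ is a relative cellular algebra (i.e. admits some relative cell datum); (3) $\Gamma$ is a type $\mathsf{A}_n$ graph for some $n\geq 1$ and the vertex condition is imposed on one leaf, i.e. $\mathsf{C}=\{1\}$ or $\mathsf{C}=\{n\}$.
   Context: Graphs. The type $\mathsf{A}_n$ graph ($n\geq 1$) is the path with vertices $1,\dots,n$ and edges between $i$ and $i+1$. Zigzag algebra. Let $\Gamma$ be a finite, connected, simple graph. Let $Q$ be the double quiver of $\Gamma$: same vertices, and for each edge between $i$ and $j$ two arrows $i\to j$ and $j\to i$. Paths are composed from left to right, so $(i\to j)\cdot(j\to k)=(i\to j\to k)$; $e_i$ denotes the length-zero path at $i$. If $\Gamma$ has at least three vertices, $Z(\Gamma)$ is the quotient of the path algebra $\mathbb{K}Q$ by the relations $i\to j\to k=0$ for $i\neq k$, and $i\to j\to i=i\to k\to i$ for all neighbors $j,k$ of $i$. If $\Gamma$ has two vertices, $Z(\Gamma)$ is $\mathbb{K}Q$ modulo all paths of length three. In these cases put $x_i=i\to j\to i$ for any neighbor $j$ of $i$. If $\Gamma$ has one vertex $i$, $Z(\Gamma)=\mathbb{K}[x_i]/(x_i^2)$.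 In all cases $Z(\Gamma)$ has $\mathbb{K}$-basis consisting of all $e_i$, all $x_i$ and all arrows $i\to j$. For a non-empty set $\mathsf{C}$ of vertices, $Z^{\mathsf{C}}(\Gamma)$ is the quotient of $Z(\Gamma)$ by the ideal generated by (equivalently, the span of) the elements $x_c$, $c\in\mathsf{C}$. Relative cellular algebra. A relative cellular algebra is an associative unital $\mathbb{K}$-algebra $R$ together with a relative cell datum $(X,M,C,{}^{\star},E,O,\epsilon)$ such that: (a) $X$ is a set, $M=\{M(\lambda)\mid\lambda\in X\}$ a collection of finite sets, and $C\colon\coprod_{\lambda\in X}M(\lambda)\times M(\lambda)\to R$, $(S,T)\mapsto C^{\lambda}_{S,T}$ for $S,T\in M(\lambda)$, is an injective map whose image is a basis of $R$. (b) ${}^{\star}$ is an anti-involution of $R$ with $(C^{\lambda}_{S,T})^{\star}=C^{\lambda}_{T,S}$. (c) $E$ is a set of pairwise orthogonal, non-zero idempotents of $R$ with $\varepsilon^{\star}=\varepsilon$ for all $\varepsilon\in E$; $O=\{<_{\varepsilon}\mid\varepsilon\in E\}$ is a set of partial orders on $X$; $\epsilon\colon\coprod_{\lambda\in X}M(\lambda)\to E$, $S\mapsto\varepsilon_S$, is a map such that for all $\lambda\in X$, $S,T\in M(\lambda)$, $\varepsilon\in E$: $\varepsilon R\varepsilon\, C^{\lambda}_{S,T}\subset R(\leq_{\varepsilon}\lambda)$, and $\varepsilon C^{\lambda}_{S,T}=C^{\lambda}_{S,T}$ if $\varepsilon_S=\varepsilon$ and $\varepsilon C^{\lambda}_{S,T}=0$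 if $\varepsilon_S\neq\varepsilon$. (d) For $\lambda\in X$, $S,T\in M(\lambda)$, $a\in R$: $a\,C^{\lambda}_{S,T}\in\sum_{S'\in M(\lambda)}r_a(S',S)\,C^{\lambda}_{S',T}+R(<_{\varepsilon_T}\lambda)\,\varepsilon_T$, with scalars $r_a(S',S)\in\mathbb{K}$ depending only on $a,S,S'$. Here $R(\leq_{\varepsilon}\lambda)$ (resp. $R(<_{\varepsilon}\lambda)$) is the span of all $C^{\mu}_{S,T}$ with $\mu\leq_{\varepsilon}\lambda$ (resp. $\mu<_{\varepsilon}\lambda$) and $S,T\in M(\mu)$. A cellular algebra is a relative cellular algebra with a datum for which $E=\{1\}$ (this is the usual Graham--Lehrer notion). *)

theory Defs
  imports
    "Graph_Theory.Graph_Theory"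
    "Jordan_Normal_Form.Missing_VectorSpace"
    "HOL-Algebra.QuotRing"
    "HOL-Library.Infinite_Typeclass"
begin

section \<open>Associative unital algebras over a field\<close>

text \<open>The locale \<open>algebra\<close> of HOL-Algebra only covers commutative algebras.\<close>

locale k_algebra = vectorspace K R + ring R
  for K :: "('k, 'm) ring_scheme" and R :: "('k, 'a, 'n) module_scheme" +
  assumes smult_mult_left:
    "\<lbrakk>r \<in> carrier K; a \<in> carrier R; b \<in> carrier R\<rbrakk>
      \<Longrightarrow> (r \<odot>\<^bsub>R\<^esub> a) \<otimes>\<^bsub>R\<^esub> b = r \<odot>\<^bsub>R\<^esub> (a \<otimes>\<^bsub>R\<^esub> b)"
    and smult_mult_right:
    "\<lbrakk>r \<in> carrier K; a \<in> carrier R; b \<in> carrier R\<rbrakk>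
      \<Longrightarrow> a \<otimes>\<^bsub>R\<^esub> (r \<odot>\<^bsub>R\<^esub> b) = r \<odot>\<^bsub>R\<^esub> (a \<otimes>\<^bsub>R\<^esub> b)"

text \<open>The quotient ring \<^term>\<open>A Quot I\<close>, equipped with the induced scalar multiplication
  \<open>r (I + a) = I + r a\<close>, written (like \<^const>\<open>rcoset_mult\<close>) without choosing representatives.\<close>

definition quot_alg :: "('k, 'a, 'n) module_scheme \<Rightarrow> 'a set \<Rightarrow> ('k, 'a set) module" where
  "quot_alg A I =
    \<lparr>carrier = carrier (A Quot I), mult = mult (A Quot I), one = one (A Quot I),
     zero = zero (A Quot I), add = add (A Quot I),
     smult = (\<lambda>r U. \<Union>a\<in>U. I +>\<^bsub>A\<^esub> (r \<odot>\<^bsub>A\<^esub> a))\<rparr>"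


section \<open>Relative cellular algebras\<close>

text \<open>\<open>leq \<epsilon>\<close> is the (reflexive) order \<open>\<le>\<^sub>\<epsilon>\<close> on \<open>X\<close>, and \<open>l\<close> stands for \<open>\<lambda>\<close>. The two functions below are
  \<open>R(\<le>\<^sub>\<epsilon> \<lambda>)\<close> and \<open>R(<\<^sub>\<epsilon> \<lambda>)\<close>.\<close>

definition cell_span_le ::
  "('k, 'm) ring_scheme \<Rightarrow> ('k, 'a, 'n) module_scheme \<Rightarrow> 'x set \<Rightarrow> ('x \<Rightarrow> 's set)
    \<Rightarrow> ('x \<Rightarrow> 's \<Rightarrow> 's \<Rightarrow> 'a) \<Rightarrow> ('a \<Rightarrow> 'x rel) \<Rightarrow> 'a \<Rightarrow> 'x \<Rightarrow> 'a set" where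
  "cell_span_le K R X M C leq \<epsilon> l = LinearCombinations.module.span K R
    {C m S T | m S T. m \<in> X \<and> (m, l) \<in> leq \<epsilon> \<and> S \<in> M m \<and> T \<in> M m}"

definition cell_span_less ::
  "('k, 'm) ring_scheme \<Rightarrow> ('k, 'a, 'n) module_scheme \<Rightarrow> 'x set \<Rightarrow> ('x \<Rightarrow> 's set)
    \<Rightarrow> ('x \<Rightarrow> 's \<Rightarrow> 's \<Rightarrow> 'a) \<Rightarrow> ('a \<Rightarrow> 'x rel) \<Rightarrow> 'a \<Rightarrow> 'x \<Rightarrow> 'a set" where
  "cell_span_less K R X M C leq \<epsilon> l = LinearCombinations.module.span K R
    {C m S T | m S T. m \<in> X \<and> (m, l) \<in> leq \<epsilon> \<and> m \<noteq> l \<and> S \<in> M m \<and> T \<in> M m}"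

text \<open>Elements of the disjoint unions over \<open>X\<close> are passed as separate arguments: \<open>C \<lambda> S T\<close> is
  \<open>C\<^sup>\<lambda>\<close> at \<open>(S,T)\<close>, and \<open>eps \<lambda> S\<close> is \<open>\<epsilon>\<^sub>S\<close> for \<open>S \<in> M \<lambda>\<close>. In particular the sets \<open>M \<lambda>\<close>
  need not be disjoint, and the scalars \<open>r\<^sub>a(S',S)\<close> are \<open>r a \<lambda> S' S\<close>.\<close>

locale relative_cell_datum = k_algebra K R
  for K :: "('k, 'm) ring_scheme" and R :: "('k, 'a, 'n) module_scheme" +
  fixes X :: "'x set"
    and M :: "'x \<Rightarrow> 's set"
    and C :: "'x \<Rightarrow> 's \<Rightarrow> 's \<Rightarrow> 'a"
    and star :: "'a \<Rightarrow> 'a"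
    and E :: "'a set"
    and leq :: "'a \<Rightarrow> 'x rel"
    and eps :: "'x \<Rightarrow> 's \<Rightarrow> 'a"
  assumes finite_M: "l \<in> X \<Longrightarrow> finite (M l)"
    and inj_C: "inj_on (\<lambda>(l, S, T). C l S T) (SIGMA l:X. M l \<times> M l)"
    and basis_C: "basis ((\<lambda>(l, S, T). C l S T) ` (SIGMA l:X. M l \<times> M l))"
    and star_closed: "a \<in> carrier R \<Longrightarrow> star a \<in> carrier R"
    and star_add: "\<lbrakk>a \<in> carrier R; b \<in> carrier R\<rbrakk> \<Longrightarrow> star (a \<oplus>\<^bsub>R\<^esub> b) = star a \<oplus>\<^bsub>R\<^esub> star b"
    and star_smult: "\<lbrakk>r \<in> carrier K; a \<in> carrier R\<rbrakk> \<Longrightarrow> star (r \<odot>\<^bsub>R\<^esub> a) = r \<odot>\<^bsub>R\<^esub> star a"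
    and star_mult: "\<lbrakk>a \<in> carrier R; b \<in> carrier R\<rbrakk> \<Longrightarrow> star (a \<otimes>\<^bsub>R\<^esub> b) = star b \<otimes>\<^bsub>R\<^esub> star a"
    and star_star: "a \<in> carrier R \<Longrightarrow> star (star a) = a"
    and star_C: "\<lbrakk>l \<in> X; S \<in> M l; T \<in> M l\<rbrakk> \<Longrightarrow> star (C l S T) = C l T S"
    and E_closed: "E \<subseteq> carrier R"
    and E_nonzero: "\<zero>\<^bsub>R\<^esub> \<notin> E"
    and E_idem: "\<epsilon> \<in> E \<Longrightarrow> \<epsilon> \<otimes>\<^bsub>R\<^esub> \<epsilon> = \<epsilon>"
    and E_orth: "\<lbrakk>\<epsilon> \<in> E; \<epsilon>' \<in> E; \<epsilon> \<noteq> \<epsilon>'\<rbrakk> \<Longrightarrow> \<epsilon> \<otimes>\<^bsub>R\<^esub> \<epsilon>' = \<zero>\<^bsub>R\<^esub>"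
    and E_star: "\<epsilon> \<in> E \<Longrightarrow> star \<epsilon> = \<epsilon>"
    and order_le: "\<epsilon> \<in> E \<Longrightarrow> partial_order_on X (leq \<epsilon>)"
    and eps_in_E: "\<lbrakk>l \<in> X; S \<in> M l\<rbrakk> \<Longrightarrow> eps l S \<in> E"
    and corner_C: "\<lbrakk>l \<in> X; S \<in> M l; T \<in> M l; \<epsilon> \<in> E; a \<in> carrier R\<rbrakk>
      \<Longrightarrow> \<epsilon> \<otimes>\<^bsub>R\<^esub> a \<otimes>\<^bsub>R\<^esub> \<epsilon> \<otimes>\<^bsub>R\<^esub> C l S T \<in> cell_span_le K R X M C leq \<epsilon> l"
    and eps_C: "\<lbrakk>l \<in> X; S \<in> M l; T \<in> M l; \<epsilon> \<in> E\<rbrakk>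
      \<Longrightarrow> \<epsilon> \<otimes>\<^bsub>R\<^esub> C l S T = (if eps l S = \<epsilon> then C l S T else \<zero>\<^bsub>R\<^esub>)"
    and mult_C: "\<exists>r. \<forall>a\<in>carrier R. \<forall>l\<in>X. \<forall>S\<in>M l.
      (\<forall>S'\<in>M l. r a l S' S \<in> carrier K) \<and>
      (\<forall>T\<in>M l. \<exists>y\<in>cell_span_less K R X M C leq (eps l T) l.
        a \<otimes>\<^bsub>R\<^esub> C l S T =
          (\<Oplus>\<^bsub>R\<^esub>S'\<in>M l. r a l S' S \<odot>\<^bsub>R\<^esub> C l S' T) \<oplus>\<^bsub>R\<^esub> (y \<otimes>\<^bsub>R\<^esub> eps l T))"

text \<open>The type arguments say where the index set \<open>X\<close> and the sets \<open>M \<lambda>\<close> live, since a datum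
  cannot be quantified over all types.\<close>

definition relative_cellular_algebra ::
  "'x itself \<Rightarrow> 's itself \<Rightarrow> ('k, 'm) ring_scheme \<Rightarrow> ('k, 'a, 'n) module_scheme \<Rightarrow> bool" where
  "relative_cellular_algebra _ _ K R \<longleftrightarrow>
    (\<exists>(X :: 'x set) (M :: 'x \<Rightarrow> 's set) C star E leq eps.
      relative_cell_datum K R X M C star E leq eps)"

definition cellular_algebra ::
  "'x itself \<Rightarrow> 's itself \<Rightarrow> ('k, 'm) ring_scheme \<Rightarrow> ('k, 'a, 'n) module_scheme \<Rightarrow> bool" where
  "cellular_algebra _ _ K R \<longleftrightarrow>
    (\<exists>(X :: 'x set) (M :: 'x \<Rightarrow> 's set) C star leq eps.
      relative_cell_datum K R X M C star {\<one>\<^bsub>R\<^esub>} leq eps)"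


section \<open>Path algebras and zigzag algebras\<close>

text \<open>A path in a quiver without parallel arrows is the non-empty list of the vertices it visits,
  \<^term>\<open>[i]\<close> being the path of length zero. Elements of the path algebra are coefficient
  functions on paths. In the product, \<open>k\<close> runs over all ways of cutting \<open>p\<close> at its \<open>k\<close>-th vertex,
  which both parts share; it vanishes off the paths since one part of a non-path is a non-path.\<close>

definition path_algebra ::
  "('k, 'm) ring_scheme \<Rightarrow> 'v pair_pre_digraph \<Rightarrow> ('k, 'v list \<Rightarrow> 'k) module" where
  "path_algebra K Q =
    \<lparr>carrier = {f. (\<forall>p. f p \<in> carrier K) \<and> (\<forall>p. \<not> vwalk p (with_proj Q) \<longrightarrow> f p = \<zero>\<^bsub>K\<^esub>)
                  \<and> finite {p. f p \<noteq> \<zero>\<^bsub>K\<^esub>}},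
     mult = (\<lambda>f g p. \<Oplus>\<^bsub>K\<^esub>k\<in>{..<length p}. f (take (Suc k) p) \<otimes>\<^bsub>K\<^esub> g (drop k p)),
     one = (\<lambda>p. if \<exists>i\<in>pverts Q. p = [i] then \<one>\<^bsub>K\<^esub> else \<zero>\<^bsub>K\<^esub>),
     zero = (\<lambda>p. \<zero>\<^bsub>K\<^esub>),
     add = (\<lambda>f g p. f p \<oplus>\<^bsub>K\<^esub> g p),
     smult = (\<lambda>r f p. r \<otimes>\<^bsub>K\<^esub> f p)\<rparr>"

definition path_elem :: "('k, 'm) ring_scheme \<Rightarrow> 'v list \<Rightarrow> 'v list \<Rightarrow> 'k" where
  "path_elem K p = (\<lambda>q. if q = p then \<one>\<^bsub>K\<^esub> else \<zero>\<^bsub>K\<^esub>)"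

text \<open>Finite simple graphs are represented by \<^locale>\<open>pair_graph\<close>, whose arcs are the edges in both
  orientations, so such a graph is its own double quiver. In the one-vertex case the polynomial
  ring \<open>K[x\<^sub>i]\<close> is taken as the path algebra of the quiver with one loop \<open>x\<^sub>i\<close> at \<open>i\<close>: the power
  \<open>x\<^sub>i\<close> to the \<open>n\<close> is the path with \<open>n + 1\<close> entries \<open>i\<close>.\<close>

definition zigzag_quiver :: "'v pair_pre_digraph \<Rightarrow> 'v pair_pre_digraph" where
  "zigzag_quiver G =
    (if card (pverts G) = 1 then \<lparr>pverts = pverts G, parcs = Id_on (pverts G)\<rparr> else G)"

abbreviation zigzag_path_algebra ::
  "('k, 'm) ring_scheme \<Rightarrow> 'v pair_pre_digraph \<Rightarrow> ('k, 'v list \<Rightarrow> 'k) module" where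
  "zigzag_path_algebra K G \<equiv> path_algebra K (zigzag_quiver G)"

definition zigzag_relations ::
  "('k, 'm) ring_scheme \<Rightarrow> 'v pair_pre_digraph \<Rightarrow> ('v list \<Rightarrow> 'k) set" where
  "zigzag_relations K G =
    (if card (pverts G) = 1 then {path_elem K [i, i, i] | i. i \<in> pverts G}
     else if card (pverts G) = 2 then
       {path_elem K p | p. vwalk p (with_proj G) \<and> vwalk_length p = 3}
     else
       {path_elem K [i, j, k] | i j k. (i, j) \<in> parcs G \<and> (j, k) \<in> parcs G \<and> i \<noteq> k} \<union>
       {path_elem K [i, j, i] \<ominus>\<^bsub>zigzag_path_algebra K G\<^esub> path_elem K [i, k, i] | i j k.
          (i, j) \<in> parcs G \<and> (i, k) \<in> parcs G})"

definition zigzag_ideal ::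
  "('k, 'm) ring_scheme \<Rightarrow> 'v pair_pre_digraph \<Rightarrow> ('v list \<Rightarrow> 'k) set" where
  "zigzag_ideal K G = genideal (zigzag_path_algebra K G) (zigzag_relations K G)"

definition zigzag_algebra ::
  "('k, 'm) ring_scheme \<Rightarrow> 'v pair_pre_digraph \<Rightarrow> ('k, ('v list \<Rightarrow> 'k) set) module" where
  "zigzag_algebra K G = quot_alg (zigzag_path_algebra K G) (zigzag_ideal K G)"

text \<open>The element \<open>x\<^sub>i\<close>; the choice of the neighbour of \<open>i\<close> is immaterial.\<close>

definition zigzag_x ::
  "('k, 'm) ring_scheme \<Rightarrow> 'v pair_pre_digraph \<Rightarrow> 'v \<Rightarrow> ('v list \<Rightarrow> 'k) set" where
  "zigzag_x K G i = zigzag_ideal K G +>\<^bsub>zigzag_path_algebra K G\<^esub>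
    path_elem K (if card (pverts G) = 1 then [i, i] else [i, (SOME j. (i, j) \<in> parcs G), i])"

definition zigzag_vertex_algebra ::
  "('k, 'm) ring_scheme \<Rightarrow> 'v pair_pre_digraph \<Rightarrow> 'v set
    \<Rightarrow> ('k, ('v list \<Rightarrow> 'k) set set) module" where
  "zigzag_vertex_algebra K G C =
    quot_alg (zigzag_algebra K G) (genideal (zigzag_algebra K G) (zigzag_x K G ` C))"


section \<open>Type A graphs\<close>

definition type_A :: "nat \<Rightarrow> nat pair_pre_digraph" where
  "type_A n = \<lparr>pverts = {1..n},
    parcs = {(i, j). i \<in> {1..n} \<and> j \<in> {1..n} \<and> (j = i + 1 \<or> i = j + 1)}\<rparr>"

definition pair_graph_iso ::
  "('u \<Rightarrow> 'v) \<Rightarrow> 'u pair_pre_digraph \<Rightarrow> 'v pair_pre_digraph \<Rightarrow> bool" where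
  "pair_graph_iso \<phi> G H \<longleftrightarrow>
    bij_betw \<phi> (pverts G) (pverts H) \<and> parcs H = map_prod \<phi> \<phi> ` parcs G"

end

theory Submission
  imports Defs
begin

text \<open>The coefficients at the vertex idempotents \<open>e\<^sub>i\<close> are characters of the algebra. Given a relative cell
  datum, each of them fails to vanish on a minimal cell \<open>\<lambda>\<^sub>i\<close>, whose bilinear form has rank one and which
  determines \<open>i\<close>. Say that a cell meets \<open>i\<close> if \<open>e\<^sub>i\<close> acts on its cell module by a non-zero map. If
  \<open>\<lambda>\<^sub>i\<close> meets \<open>j\<close> and \<open>k\<close>, both different from \<open>i\<close>, then \<open>e\<^sub>j R e\<^sub>i R e\<^sub>k\<close> is non-zero, which forces
  \<open>j = k\<close> to be a neighbour of \<open>i\<close> outside \<open>C\<close>. Since \<open>e\<^sub>i R e\<^sub>i\<close> has dimension at most two, at most two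
  cells meet \<open>i\<close>, and only \<open>\<lambda>\<^sub>i\<close> does if \<open>i \<in> C\<close>, while the two ends of an edge are always met by
  a common cell. Hence the relation \<open>\<lambda>\<^sub>i\<close> meets \<open>j\<close> is a partial injection along the edges that never
  enters \<open>C\<close>, and its orbit starting at a vertex of \<open>C\<close> contains all neighbours of its members, so it is
  the whole graph. Conversely, for a line with the condition at its first vertex, the \<open>k\<close>-th cell module
  is spanned by \<open>e\<^sub>k\<close> and the arrow from \<open>k + 1\<close> to \<open>k\<close>, ordered by \<open>k\<close>.\<close>

section \<open>Linear forms and dual bases\<close>

text \<open>The obstacle is that a relative datum has one order per idempotent. In a product a C b,
  left multiplication is bounded in the order of the second index of C and right multiplication in
  the order of the first, so in general the two bounds cannot be combined. Axiom (c), moved to the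
  right by the anti-involution, repairs this when b lies in a corner \<epsilon> R \<epsilon>: both
  bounds then hold in the order of \<epsilon>, and the coefficient of a C b in the cell of C is a
  product of two matrix entries. Since e_j need not lie in such a corner, it is replaced on the
  right by an idempotent w of the corner whose image under the anti-involution acts non-trivially on
  the same cells as e_j. This works because e_j R e_j is local and because the characters are
  invariant under the anti-involution, although e_j itself may be moved. This argument sees the
  algebra through its coordinates only. That the iterated quotient of the path algebra has them is
  separate: candidate coordinates are written down on the path algebra, their common kernel is an
  ideal containing the relations, and normal forms show that it is the whole kernel.\<close>

lemma (in abelian_group) eq_if_minus_zero:
  assumes "a \<in> carrier G" "b \<in> carrier G" "a \<ominus> b = \<zero>"
  shows "a = b"
proof -
  have "a = a \<ominus> b \<oplus> b" using assms(1,2) by (simp add: minus_eq a_assoc l_neg)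
  then show ?thesis using assms(2,3) by simp
qed

definition (in vectorspace) linear_form :: "('c \<Rightarrow> 'a) \<Rightarrow> bool" where
  "linear_form f \<longleftrightarrow> f \<in> carrier V \<rightarrow> carrier K
    \<and> (\<forall>a\<in>carrier V. \<forall>b\<in>carrier V. f (a \<oplus>\<^bsub>V\<^esub> b) = f a \<oplus>\<^bsub>K\<^esub> f b)
    \<and> (\<forall>r\<in>carrier K. \<forall>a\<in>carrier V. f (r \<odot>\<^bsub>V\<^esub> a) = r \<otimes>\<^bsub>K\<^esub> f a)"

context vectorspace
begin

lemma linear_formD:
  assumes "linear_form f"
  shows "a \<in> carrier V \<Longrightarrow> f a \<in> carrier K"
    and "\<lbrakk>a \<in> carrier V; b \<in> carrier V\<rbrakk> \<Longrightarrow> f (a \<oplus>\<^bsub>V\<^esub> b) = f a \<oplus>\<^bsub>K\<^esub> f b"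
    and "\<lbrakk>r \<in> carrier K; a \<in> carrier V\<rbrakk> \<Longrightarrow> f (r \<odot>\<^bsub>V\<^esub> a) = r \<otimes>\<^bsub>K\<^esub> f a"
  using assms by (auto simp: linear_form_def)

lemma linear_form_zero:
  assumes "linear_form f"
  shows "f \<zero>\<^bsub>V\<^esub> = \<zero>\<^bsub>K\<^esub>"
proof -
  have "f (\<zero>\<^bsub>K\<^esub> \<odot>\<^bsub>V\<^esub> \<zero>\<^bsub>V\<^esub>) = \<zero>\<^bsub>K\<^esub> \<otimes>\<^bsub>K\<^esub> f \<zero>\<^bsub>V\<^esub>"
    by (rule linear_formD(3)[OF assms]) auto
  then show ?thesis using linear_formD(1)[OF assms, of "\<zero>\<^bsub>V\<^esub>"] by simp
qed

lemma linear_form_uminus: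
  assumes "linear_form f" "a \<in> carrier V"
  shows "f (\<ominus>\<^bsub>V\<^esub> a) = \<ominus>\<^bsub>K\<^esub> f a"
proof -
  have "f a \<oplus>\<^bsub>K\<^esub> f (\<ominus>\<^bsub>V\<^esub> a) = \<zero>\<^bsub>K\<^esub>"
    using linear_formD(2)[OF assms(1) assms(2), of "\<ominus>\<^bsub>V\<^esub> a"] assms linear_form_zero[OF assms(1)]
    by (simp add: M.r_neg)
  then show ?thesis
    using linear_formD(1)[OF assms(1)] assms(2) by (metis M.a_inv_closed R.minus_equality R.a_comm)
qed

lemma linear_form_minus:
  assumes "linear_form f" "a \<in> carrier V" "b \<in> carrier V"
  shows "f (a \<ominus>\<^bsub>V\<^esub> b) = f a \<ominus>\<^bsub>K\<^esub> f b"
  using assms linear_formD(2)[OF assms(1)] by (simp add: M.minus_eq R.minus_eq linear_form_uminus)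

lemma linear_form_finsum:
  assumes "linear_form f" "g \<in> A \<rightarrow> carrier V"
  shows "f (\<Oplus>\<^bsub>V\<^esub>p\<in>A. g p) = (\<Oplus>\<^bsub>K\<^esub>p\<in>A. f (g p))"
  using assms(2)
proof (induction A rule: infinite_finite_induct)
  case (insert x F)
  then have "f (\<Oplus>\<^bsub>V\<^esub>p\<in>insert x F. g p) = f (g x) \<oplus>\<^bsub>K\<^esub> f (\<Oplus>\<^bsub>V\<^esub>p\<in>F. g p)"
    using linear_formD(2)[OF assms(1)] by (subst M.finsum_insert) (auto simp: Pi_iff)
  also have "\<dots> = (\<Oplus>\<^bsub>K\<^esub>p\<in>insert x F. f (g p))"
    using insert linear_formD(1)[OF assms(1)] by (subst R.finsum_insert) (auto simp: Pi_iff)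
  finally show ?case .
qed (auto simp: linear_form_zero[OF assms(1)])

lemma linear_form_span_zero:
  assumes "linear_form f" "S \<subseteq> carrier V" "\<And>s. s \<in> S \<Longrightarrow> f s = \<zero>\<^bsub>K\<^esub>" "a \<in> span S"
  shows "f a = \<zero>\<^bsub>K\<^esub>"
proof -
  obtain c A where A: "finite A" "A \<subseteq> S" "c \<in> A \<rightarrow> carrier K" "a = lincomb c A"
    using assms(4) by (auto simp: span_def)
  have "f a = (\<Oplus>\<^bsub>K\<^esub>s\<in>A. f (c s \<odot>\<^bsub>V\<^esub> s))"
    unfolding A(4) lincomb_def
    by (rule linear_form_finsum[OF assms(1)]) (use A assms(2) in auto)
  also have "\<dots> = (\<Oplus>\<^bsub>K\<^esub>s\<in>A. \<zero>\<^bsub>K\<^esub>)"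
    using A assms by (intro R.finsum_cong') (auto simp: linear_formD Pi_iff subset_iff)
  finally show ?thesis by simp
qed

end

text \<open>The cell basis is indexed by triples, so coordinates are attached to indices rather than
  to the vectors of a basis given as a set.\<close>

locale indexed_basis = vectorspace K V for K V +
  fixes P :: "'p set" and bv :: "'p \<Rightarrow> 'c"
  assumes finite_P: "finite P" and inj_bv: "inj_on bv P" and basis_bv: "basis (bv ` P)"
begin

lemma bv_closed [simp, intro]: "p \<in> P \<Longrightarrow> bv p \<in> carrier V"
  using basis_bv by (auto simp: basis_def)

lemma lincomb_reindex:
  assumes "c \<in> bv ` P \<rightarrow> carrier K"
  shows "lincomb c (bv ` P) = (\<Oplus>\<^bsub>V\<^esub>p\<in>P. c (bv p) \<odot>\<^bsub>V\<^esub> bv p)"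
  unfolding lincomb_def by (rule M.finsum_reindex[OF _ inj_bv]) (use assms in auto)

lemma ex_coeffs:
  assumes "a \<in> carrier V"
  shows "\<exists>g. g \<in> P \<rightarrow> carrier K \<and> a = (\<Oplus>\<^bsub>V\<^esub>p\<in>P. g p \<odot>\<^bsub>V\<^esub> bv p)"
proof -
  have "a \<in> span (bv ` P)" using assms basis_bv by (simp add: basis_def)
  then obtain c where c: "c \<in> bv ` P \<rightarrow> carrier K" "lincomb c (bv ` P) = a"
    using finite_in_span[of "bv ` P" a] finite_P by blast
  then show ?thesis using lincomb_reindex[OF c(1)]
    by (intro exI[of _ "\<lambda>p. c (bv p)"]) auto
qed

text \<open>The dual basis. Linear independence makes the coefficient family unique on
  \<open>P\<close>, see \<open>coeff_unique\<close>, so the choice is harmless.\<close>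

definition coeff :: "'p \<Rightarrow> 'c \<Rightarrow> 'a" where
  "coeff p a = (SOME g. g \<in> P \<rightarrow> carrier K \<and> a = (\<Oplus>\<^bsub>V\<^esub>p\<in>P. g p \<odot>\<^bsub>V\<^esub> bv p)) p"

lemma coeff_spec:
  assumes "a \<in> carrier V"
  shows "(\<lambda>p. coeff p a) \<in> P \<rightarrow> carrier K" and coeff_expand: "a = (\<Oplus>\<^bsub>V\<^esub>p\<in>P. coeff p a \<odot>\<^bsub>V\<^esub> bv p)"
proof -
  show "(\<lambda>p. coeff p a) \<in> P \<rightarrow> carrier K"
    unfolding coeff_def by (rule conjunct1[OF someI_ex[OF ex_coeffs[OF assms]]])
  show "a = (\<Oplus>\<^bsub>V\<^esub>p\<in>P. coeff p a \<odot>\<^bsub>V\<^esub> bv p)"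
    unfolding coeff_def by (rule conjunct2[OF someI_ex[OF ex_coeffs[OF assms]]])
qed

lemma coeff_closed [simp, intro]: "\<lbrakk>p \<in> P; a \<in> carrier V\<rbrakk> \<Longrightarrow> coeff p a \<in> carrier K"
  using coeff_spec(1) by (auto simp: Pi_iff)

lemma coeffs_zero:
  assumes "g \<in> P \<rightarrow> carrier K" "(\<Oplus>\<^bsub>V\<^esub>p\<in>P. g p \<odot>\<^bsub>V\<^esub> bv p) = \<zero>\<^bsub>V\<^esub>" "q \<in> P"
  shows "g q = \<zero>\<^bsub>K\<^esub>"
proof (rule ccontr)
  assume ne: "g q \<noteq> \<zero>\<^bsub>K\<^esub>"
  define c where "c = (\<lambda>v. g (inv_into P bv v))"
  have inv: "c (bv p) = g p" if "p \<in> P" for p using that inj_bv by (simp add: c_def)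
  have cc: "c \<in> bv ` P \<rightarrow> carrier K" using inv assms(1) by auto
  have "lincomb c (bv ` P) = (\<Oplus>\<^bsub>V\<^esub>p\<in>P. g p \<odot>\<^bsub>V\<^esub> bv p)"
    unfolding lincomb_reindex[OF cc] by (rule M.finsum_cong') (use inv assms(1) in auto)
  then have "lin_dep (bv ` P)"
    unfolding lin_dep_def using finite_P cc assms ne inv
    by (intro exI[of _ "bv ` P"] exI[of _ c] exI[of _ "bv q"]) auto
  then show False using basis_bv by (simp add: basis_def)
qed

lemma coeff_unique:
  assumes g: "g \<in> P \<rightarrow> carrier K" and a: "a = (\<Oplus>\<^bsub>V\<^esub>p\<in>P. g p \<odot>\<^bsub>V\<^esub> bv p)" and q: "q \<in> P"
  shows "coeff q a = g q"
proof -
  have ac: "a \<in> carrier V" unfolding a by (rule M.finsum_closed) (use g in auto)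
  let ?h = "\<lambda>p. g p \<ominus>\<^bsub>K\<^esub> coeff p a"
  have h: "?h \<in> P \<rightarrow> carrier K" using g ac by auto
  \<comment> \<open>Splitting g into \<open>?h\<close> plus the coefficients of a exhibits
    \<open>?h\<close> as a family of coefficients of zero.\<close>
  have "a = (\<Oplus>\<^bsub>V\<^esub>p\<in>P. (?h p \<oplus>\<^bsub>K\<^esub> coeff p a) \<odot>\<^bsub>V\<^esub> bv p)"
    unfolding a[symmetric]
    by (subst a, rule M.finsum_cong') (use g ac in \<open>auto simp: Pi_iff R.minus_eq R.a_assoc R.l_neg\<close>)
  also have "\<dots> = (\<Oplus>\<^bsub>V\<^esub>p\<in>P. ?h p \<odot>\<^bsub>V\<^esub> bv p \<oplus>\<^bsub>V\<^esub> coeff p a \<odot>\<^bsub>V\<^esub> bv p)"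
    by (rule M.finsum_cong') (use g ac in \<open>auto simp: Pi_iff smult_l_distr\<close>)
  also have "\<dots> = (\<Oplus>\<^bsub>V\<^esub>p\<in>P. ?h p \<odot>\<^bsub>V\<^esub> bv p) \<oplus>\<^bsub>V\<^esub> a"
    by (subst M.finsum_addf) (use h ac coeff_expand[OF ac, symmetric] in auto)
  finally have eq: "a = (\<Oplus>\<^bsub>V\<^esub>p\<in>P. ?h p \<odot>\<^bsub>V\<^esub> bv p) \<oplus>\<^bsub>V\<^esub> a" .
  have "(\<Oplus>\<^bsub>V\<^esub>p\<in>P. ?h p \<odot>\<^bsub>V\<^esub> bv p) \<in> carrier V" by (rule M.finsum_closed) (use h in auto)
  then have "(\<Oplus>\<^bsub>V\<^esub>p\<in>P. ?h p \<odot>\<^bsub>V\<^esub> bv p) = \<zero>\<^bsub>V\<^esub>"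
    using eq ac M.add.r_cancel_one' by blast
  from coeffs_zero[OF h this q] show ?thesis
    using g ac q R.eq_if_minus_zero[of "g q" "coeff q a"] by (simp add: Pi_iff)
qed

lemma coeff_form: "q \<in> P \<Longrightarrow> linear_form (coeff q)"
proof -
  assume q: "q \<in> P"
  have "coeff q (a \<oplus>\<^bsub>V\<^esub> b) = coeff q a \<oplus>\<^bsub>K\<^esub> coeff q b" if "a \<in> carrier V" "b \<in> carrier V" for a b
  proof -
    have "(\<Oplus>\<^bsub>V\<^esub>p\<in>P. (coeff p a \<oplus>\<^bsub>K\<^esub> coeff p b) \<odot>\<^bsub>V\<^esub> bv p)
        = (\<Oplus>\<^bsub>V\<^esub>p\<in>P. coeff p a \<odot>\<^bsub>V\<^esub> bv p \<oplus>\<^bsub>V\<^esub> coeff p b \<odot>\<^bsub>V\<^esub> bv p)"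
      by (rule M.finsum_cong') (use that in \<open>auto simp: smult_l_distr\<close>)
    also have "\<dots> = a \<oplus>\<^bsub>V\<^esub> b"
      by (subst M.finsum_addf) (use that coeff_expand[symmetric] in auto)
    finally show ?thesis using that
      by (intro coeff_unique[where g = "\<lambda>p. coeff p a \<oplus>\<^bsub>K\<^esub> coeff p b", OF _ _ q]) (simp_all add: Pi_iff)
  qed
  moreover have "coeff q (r \<odot>\<^bsub>V\<^esub> a) = r \<otimes>\<^bsub>K\<^esub> coeff q a" if "a \<in> carrier V" "r \<in> carrier K" for a r
  proof -
    have "r \<odot>\<^bsub>V\<^esub> a = r \<odot>\<^bsub>V\<^esub> (\<Oplus>\<^bsub>V\<^esub>p\<in>P. coeff p a \<odot>\<^bsub>V\<^esub> bv p)" using coeff_expand[OF that(1)] by (rule arg_cong)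
    also have "\<dots> = (\<Oplus>\<^bsub>V\<^esub>p\<in>P. r \<odot>\<^bsub>V\<^esub> (coeff p a \<odot>\<^bsub>V\<^esub> bv p))"
      by (rule finsum_smult) (use that in auto)
    also have "\<dots> = (\<Oplus>\<^bsub>V\<^esub>p\<in>P. (r \<otimes>\<^bsub>K\<^esub> coeff p a) \<odot>\<^bsub>V\<^esub> bv p)"
      by (rule M.finsum_cong') (use that in \<open>auto simp: smult_assoc1\<close>)
    finally show ?thesis using that
      by (intro coeff_unique[where g = "\<lambda>p. r \<otimes>\<^bsub>K\<^esub> coeff p a", OF _ _ q]) (simp_all add: Pi_iff)
  qed
  ultimately show ?thesis using q by (simp add: linear_form_def Pi_iff)
qed

lemma form_expand:
  assumes "linear_form f" "a \<in> carrier V"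
  shows "f a = (\<Oplus>\<^bsub>K\<^esub>p\<in>P. coeff p a \<otimes>\<^bsub>K\<^esub> f (bv p))"
proof -
  have "f a = f (\<Oplus>\<^bsub>V\<^esub>p\<in>P. coeff p a \<odot>\<^bsub>V\<^esub> bv p)" using coeff_expand[OF assms(2)] by (rule arg_cong)
  also have "\<dots> = (\<Oplus>\<^bsub>K\<^esub>p\<in>P. f (coeff p a \<odot>\<^bsub>V\<^esub> bv p))"
    by (rule linear_form_finsum[OF assms(1)]) (use assms in auto)
  also have "\<dots> = (\<Oplus>\<^bsub>K\<^esub>p\<in>P. coeff p a \<otimes>\<^bsub>K\<^esub> f (bv p))"
    by (rule R.finsum_cong') (use assms linear_formD[OF assms(1)] in auto)
  finally show ?thesis .
qed

lemma coeff_bv: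
  assumes "p \<in> P" "q \<in> P"
  shows "coeff p (bv q) = (if p = q then \<one>\<^bsub>K\<^esub> else \<zero>\<^bsub>K\<^esub>)"
proof -
  have "(\<Oplus>\<^bsub>V\<^esub>p\<in>P. (if p = q then \<one>\<^bsub>K\<^esub> else \<zero>\<^bsub>K\<^esub>) \<odot>\<^bsub>V\<^esub> bv p) = (\<Oplus>\<^bsub>V\<^esub>p\<in>P. if q = p then bv p else \<zero>\<^bsub>V\<^esub>)"
    by (rule M.finsum_cong') auto
  also have "\<dots> = bv q" by (rule M.finsum_singleton) (use assms finite_P in auto)
  finally show ?thesis using assms(1)
    by (intro coeff_unique[where g = "\<lambda>p. if p = q then \<one>\<^bsub>K\<^esub> else \<zero>\<^bsub>K\<^esub>"]) (simp_all add: Pi_iff)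
qed

lemma form_expand_on:
  assumes "linear_form f" "a \<in> carrier V" "Q \<subseteq> P"
    and "\<And>p. \<lbrakk>p \<in> P; p \<notin> Q; coeff p a \<noteq> \<zero>\<^bsub>K\<^esub>\<rbrakk> \<Longrightarrow> f (bv p) = \<zero>\<^bsub>K\<^esub>"
  shows "f a = (\<Oplus>\<^bsub>K\<^esub>p\<in>Q. coeff p a \<otimes>\<^bsub>K\<^esub> f (bv p))"
  unfolding form_expand[OF assms(1,2)]
proof (rule R.add.finprod_mono_neutral_cong_right)
  fix i assume i: "i \<in> P - Q"
  show "coeff i a \<otimes>\<^bsub>K\<^esub> f (bv i) = \<zero>\<^bsub>K\<^esub>"
  proof -
    have "coeff i a \<in> carrier K" "f (bv i) \<in> carrier K"
      using i assms(2) linear_formD(1)[OF assms(1)] by auto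
    then show "coeff i a \<otimes>\<^bsub>K\<^esub> f (bv i) = \<zero>\<^bsub>K\<^esub>"
      using assms(4)[of i] i by (cases "coeff i a = \<zero>\<^bsub>K\<^esub>") auto
  qed
qed (use finite_P assms(2,3) linear_formD(1)[OF assms(1)] in auto)

text \<open>Used to trace a non-zero coefficient of a product back to a single basis element of one
  factor.\<close>

lemma form_nonzeroE:
  assumes "linear_form f" "a \<in> carrier V" "f a \<noteq> \<zero>\<^bsub>K\<^esub>"
  obtains p where "p \<in> P" "coeff p a \<noteq> \<zero>\<^bsub>K\<^esub>" "f (bv p) \<noteq> \<zero>\<^bsub>K\<^esub>"
proof -
  have "\<exists>p\<in>P. coeff p a \<noteq> \<zero>\<^bsub>K\<^esub> \<and> f (bv p) \<noteq> \<zero>\<^bsub>K\<^esub>"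
  proof (rule ccontr)
    assume "\<not> ?thesis"
    then have "f a = (\<Oplus>\<^bsub>K\<^esub>p\<in>{}. coeff p a \<otimes>\<^bsub>K\<^esub> f (bv p))"
      by (intro form_expand_on[OF assms(1,2)]) auto
    then show False using assms(3) by simp
  qed
  then show thesis using that by blast
qed

lemma zero_if_coeffs_zero:
  assumes "a \<in> carrier V" "\<And>p. p \<in> P \<Longrightarrow> coeff p a = \<zero>\<^bsub>K\<^esub>"
  shows "a = \<zero>\<^bsub>V\<^esub>"
proof -
  have "a = (\<Oplus>\<^bsub>V\<^esub>p\<in>P. \<zero>\<^bsub>V\<^esub>)"
    using assms by (subst coeff_expand[OF assms(1)]) (intro M.finsum_cong', auto)
  then show ?thesis by simp
qed

end

context vectorspace
begin

text \<open>Both sides have the same image under every form \<open>F q\<close>, and the forms have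
  no common kernel.\<close>

lemma dual_basis_expand:
  assumes "finite P" "bv \<in> P \<rightarrow> carrier V" "\<And>p. p \<in> P \<Longrightarrow> linear_form (F p)"
    and "\<And>p q. \<lbrakk>p \<in> P; q \<in> P\<rbrakk> \<Longrightarrow> F p (bv q) = (if p = q then \<one>\<^bsub>K\<^esub> else \<zero>\<^bsub>K\<^esub>)"
    and "\<And>a. \<lbrakk>a \<in> carrier V; \<And>p. p \<in> P \<Longrightarrow> F p a = \<zero>\<^bsub>K\<^esub>\<rbrakk> \<Longrightarrow> a = \<zero>\<^bsub>V\<^esub>"
    and "a \<in> carrier V"
  shows "a = (\<Oplus>\<^bsub>V\<^esub>p\<in>P. F p a \<odot>\<^bsub>V\<^esub> bv p)"
proof -
  let ?s = "\<Oplus>\<^bsub>V\<^esub>p\<in>P. F p a \<odot>\<^bsub>V\<^esub> bv p"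
  have Fc: "F p x \<in> carrier K" if "p \<in> P" "x \<in> carrier V" for p x
    using linear_formD(1)[OF assms(3)] that by auto
  have bc: "bv p \<in> carrier V" if "p \<in> P" for p using assms(2) that by auto
  have s: "?s \<in> carrier V" by (rule M.finsum_closed) (use Fc bc assms(6) in auto)
  have "F q ?s = F q a" if q: "q \<in> P" for q
  proof -
    have "F q ?s = (\<Oplus>\<^bsub>K\<^esub>p\<in>P. F q (F p a \<odot>\<^bsub>V\<^esub> bv p))"
      by (rule linear_form_finsum[OF assms(3)[OF q]]) (use Fc bc assms(6) in auto)
    also have "\<dots> = (\<Oplus>\<^bsub>K\<^esub>p\<in>P. if q = p then F p a else \<zero>\<^bsub>K\<^esub>)"
      by (rule R.finsum_cong') (use Fc bc assms(4,6) q linear_formD(3)[OF assms(3)[OF q]] in auto)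
    also have "\<dots> = F q a" by (rule R.finsum_singleton) (use assms(1,6) Fc q in auto)
    finally show ?thesis .
  qed
  then have "a \<ominus>\<^bsub>V\<^esub> ?s = \<zero>\<^bsub>V\<^esub>"
    using s assms(6) Fc by (intro assms(5)) (auto simp: linear_form_minus[OF assms(3)] R.minus_eq R.r_neg)
  then show ?thesis by (rule M.eq_if_minus_zero[OF assms(6) s])
qed

text \<open>Duality gives independence and the absence of a common kernel gives spanning. This
  serves both for the standard basis of a zigzag algebra and for the cell basis of a line.\<close>

lemma dual_basis_basis:
  assumes "finite P" "bv \<in> P \<rightarrow> carrier V" "\<And>p. p \<in> P \<Longrightarrow> linear_form (F p)"
    and "\<And>p q. \<lbrakk>p \<in> P; q \<in> P\<rbrakk> \<Longrightarrow> F p (bv q) = (if p = q then \<one>\<^bsub>K\<^esub> else \<zero>\<^bsub>K\<^esub>)"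
    and "\<And>a. \<lbrakk>a \<in> carrier V; \<And>p. p \<in> P \<Longrightarrow> F p a = \<zero>\<^bsub>K\<^esub>\<rbrakk> \<Longrightarrow> a = \<zero>\<^bsub>V\<^esub>"
  shows "inj_on bv P" "basis (bv ` P)"
proof -
  show inj: "inj_on bv P"
    by (rule inj_onI) (metis assms(4) one_not_zero)
  have bc: "bv ` P \<subseteq> carrier V" using assms(2) by auto
  have Fs: "F p (r \<odot>\<^bsub>V\<^esub> bv q) = (if p = q then r else \<zero>\<^bsub>K\<^esub>)" if "p \<in> P" "q \<in> P" "r \<in> carrier K" for p q r
    using linear_formD(3)[OF assms(3), OF that(1,3), of "bv q"] assms(4)[OF that(1,2)] bc that by auto
  have reindex: "lincomb c (bv ` P) = (\<Oplus>\<^bsub>V\<^esub>p\<in>P. c (bv p) \<odot>\<^bsub>V\<^esub> bv p)"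
    if "c \<in> bv ` P \<rightarrow> carrier K" for c
    unfolding lincomb_def by (rule M.finsum_reindex[OF _ inj]) (use that bc in auto)
  have "lin_indpt (bv ` P)"
  proof (rule finite_lin_indpt2)
    fix c assume c: "c \<in> bv ` P \<rightarrow> carrier K" "lincomb c (bv ` P) = \<zero>\<^bsub>V\<^esub>"
    show "\<forall>v\<in>bv ` P. c v = \<zero>\<^bsub>K\<^esub>"
    proof clarify
      fix q assume q: "q \<in> P"
      have cb: "c (bv p) \<in> carrier K" if "p \<in> P" for p using c(1) that by auto
      have "\<zero>\<^bsub>K\<^esub> = F q (\<Oplus>\<^bsub>V\<^esub>p\<in>P. c (bv p) \<odot>\<^bsub>V\<^esub> bv p)"
        using c reindex[OF c(1)] linear_form_zero[OF assms(3)[OF q]] by simp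
      also have "\<dots> = (\<Oplus>\<^bsub>K\<^esub>p\<in>P. F q (c (bv p) \<odot>\<^bsub>V\<^esub> bv p))"
        by (rule linear_form_finsum[OF assms(3)[OF q]]) (use c bc in auto)
      also have "\<dots> = (\<Oplus>\<^bsub>K\<^esub>p\<in>P. if q = p then c (bv p) else \<zero>\<^bsub>K\<^esub>)"
        by (rule R.finsum_cong') (use cb q Fs in auto)
      also have "\<dots> = c (bv q)" by (rule R.finsum_singleton) (use assms(1) cb q in auto)
      finally show "c (bv q) = \<zero>\<^bsub>K\<^esub>" by simp
    qed
  qed (use bc assms(1) in auto)
  moreover have "span (bv ` P) = carrier V"
  proof
    show "carrier V \<subseteq> span (bv ` P)"
    proof
      fix a assume a: "a \<in> carrier V"
      define c where "c = (\<lambda>v. F (inv_into P bv v) a)"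
      have cc: "c \<in> bv ` P \<rightarrow> carrier K"
        using linear_formD(1)[OF assms(3) a] inj by (auto simp: c_def)
      have "lincomb c (bv ` P) = (\<Oplus>\<^bsub>V\<^esub>p\<in>P. F p a \<odot>\<^bsub>V\<^esub> bv p)"
        unfolding reindex[OF cc]
        by (rule M.finsum_cong') (use inj linear_formD(1)[OF assms(3) a] bc in \<open>auto simp: c_def\<close>)
      also have "\<dots> = a" by (rule dual_basis_expand[OF assms a, symmetric])
      finally show "a \<in> span (bv ` P)" unfolding span_def using assms(1) cc by blast
    qed
  qed (use span_is_subset2[OF bc] in auto)
  ultimately show "basis (bv ` P)" using bc by (simp add: basis_def)
qed

end

section \<open>Coordinates on zigzag algebras with vertex condition\<close>

text \<open>The coordinates of an element are its coefficients \<^term>\<open>u i\<close> at the vertices, \<^term>\<open>t i j\<close> at the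
  arrows \<^term>\<open>i\<close> to \<^term>\<open>j\<close>, and \<^term>\<open>t i i\<close> at the elements \<open>x\<^sub>i\<close> that are not killed.\<close>

locale zigzag_coordinates = k_algebra K R
  for K :: "('k, 'm) ring_scheme" and R :: "('k, 'a, 'n) module_scheme" +
  fixes V :: "'v set" and A :: "'v rel" and C :: "'v set"
    and u :: "'v \<Rightarrow> 'a \<Rightarrow> 'k" and t :: "'v \<Rightarrow> 'v \<Rightarrow> 'a \<Rightarrow> 'k"
  assumes finite_V: "finite V"
    and A_subset: "A \<subseteq> V \<times> V"
    and A_irrefl: "(i, j) \<in> A \<Longrightarrow> i \<noteq> j"
    and A_sym: "(i, j) \<in> A \<Longrightarrow> (j, i) \<in> A"
    and C_subset: "C \<subseteq> V"
    and u_form: "i \<in> V \<Longrightarrow> linear_form (u i)"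
    and t_form: "(i, j) \<in> A \<union> Id_on (V - C) \<Longrightarrow> linear_form (t i j)"
    and u_one: "i \<in> V \<Longrightarrow> u i \<one>\<^bsub>R\<^esub> = \<one>\<^bsub>K\<^esub>"
    and t_one: "(i, j) \<in> A \<union> Id_on (V - C) \<Longrightarrow> t i j \<one>\<^bsub>R\<^esub> = \<zero>\<^bsub>K\<^esub>"
    and u_mult: "\<lbrakk>i \<in> V; a \<in> carrier R; b \<in> carrier R\<rbrakk> \<Longrightarrow> u i (a \<otimes>\<^bsub>R\<^esub> b) = u i a \<otimes>\<^bsub>K\<^esub> u i b"
    and t_mult_arc: "\<lbrakk>(i, j) \<in> A; a \<in> carrier R; b \<in> carrier R\<rbrakk>
      \<Longrightarrow> t i j (a \<otimes>\<^bsub>R\<^esub> b) = u i a \<otimes>\<^bsub>K\<^esub> t i j b \<oplus>\<^bsub>K\<^esub> t i j a \<otimes>\<^bsub>K\<^esub> u j b"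
    and t_mult_loop: "\<lbrakk>i \<in> V - C; a \<in> carrier R; b \<in> carrier R\<rbrakk>
      \<Longrightarrow> t i i (a \<otimes>\<^bsub>R\<^esub> b) = u i a \<otimes>\<^bsub>K\<^esub> t i i b \<oplus>\<^bsub>K\<^esub> t i i a \<otimes>\<^bsub>K\<^esub> u i b
            \<oplus>\<^bsub>K\<^esub> (\<Oplus>\<^bsub>K\<^esub>k\<in>{k. (i, k) \<in> A}. t i k a \<otimes>\<^bsub>K\<^esub> t k i b)"
    and zero_if_coordinates_zero: "\<lbrakk>a \<in> carrier R; \<And>i. i \<in> V \<Longrightarrow> u i a = \<zero>\<^bsub>K\<^esub>;
      \<And>i j. (i, j) \<in> A \<union> Id_on (V - C) \<Longrightarrow> t i j a = \<zero>\<^bsub>K\<^esub>\<rbrakk> \<Longrightarrow> a = \<zero>\<^bsub>R\<^esub>"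
    and ex_coordinates: "\<lbrakk>\<And>i. i \<in> V \<Longrightarrow> f i \<in> carrier K;
      \<And>i j. (i, j) \<in> A \<union> Id_on (V - C) \<Longrightarrow> g i j \<in> carrier K\<rbrakk>
      \<Longrightarrow> \<exists>a\<in>carrier R. (\<forall>i\<in>V. u i a = f i) \<and> (\<forall>(i, j)\<in>A \<union> Id_on (V - C). t i j a = g i j)"
begin

text \<open>Indexes the standard basis elements other than the vertex idempotents: the arrows, and
  the pairs (i, i) standing for the x_i that survive.\<close>

definition D :: "'v rel" where "D = A \<union> Id_on (V - C)"

lemma D_cases:
  assumes "(i, j) \<in> D"
  obtains "(i, j) \<in> A" "i \<noteq> j" "i \<in> V" "j \<in> V" | "i = j" "i \<in> V" "i \<notin> C"
  using assms A_irrefl A_subset by (auto simp: D_def)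

lemma D_verts: "(i, j) \<in> D \<Longrightarrow> i \<in> V" "(i, j) \<in> D \<Longrightarrow> j \<in> V"
  using A_subset by (auto simp: D_def)

lemma A_D: "(i, j) \<in> A \<Longrightarrow> (i, j) \<in> D"
  by (simp add: D_def)

lemma A_verts: "(i, j) \<in> A \<Longrightarrow> i \<in> V" "(i, j) \<in> A \<Longrightarrow> j \<in> V"
  using A_subset by auto

lemma finite_A_row: "finite {k. (i, k) \<in> A}"
  by (rule finite_subset[OF _ finite_V]) (use A_subset in auto)

lemma u_closed [simp, intro]: "\<lbrakk>i \<in> V; a \<in> carrier R\<rbrakk> \<Longrightarrow> u i a \<in> carrier K"
  using linear_formD(1)[OF u_form] by blast

lemma t_closed [intro]: "\<lbrakk>(i, j) \<in> D; a \<in> carrier R\<rbrakk> \<Longrightarrow> t i j a \<in> carrier K"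
  using linear_formD(1)[OF t_form] unfolding D_def by blast

lemma t_closed_A [simp]: "\<lbrakk>(i, j) \<in> A; a \<in> carrier R\<rbrakk> \<Longrightarrow> t i j a \<in> carrier K"
  by (rule t_closed[OF A_D])

lemma t_closed_loop [simp]: "\<lbrakk>i \<in> V; i \<notin> C; a \<in> carrier R\<rbrakk> \<Longrightarrow> t i i a \<in> carrier K"
  by (rule t_closed) (auto simp: D_def)

lemma coordinates_eqI:
  assumes "a \<in> carrier R" "b \<in> carrier R" "\<And>i. i \<in> V \<Longrightarrow> u i a = u i b"
    and "\<And>i j. (i, j) \<in> D \<Longrightarrow> t i j a = t i j b"
  shows "a = b"
proof -
  have "a \<ominus>\<^bsub>R\<^esub> b = \<zero>\<^bsub>R\<^esub>"
  proof (rule zero_if_coordinates_zero)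
    show "u i (a \<ominus>\<^bsub>R\<^esub> b) = \<zero>\<^bsub>K\<^esub>" if "i \<in> V" for i
      using that assms(1-3) by (simp add: linear_form_minus[OF u_form] R.minus_eq R.r_neg)
    show "t i j (a \<ominus>\<^bsub>R\<^esub> b) = \<zero>\<^bsub>K\<^esub>" if "(i, j) \<in> A \<union> Id_on (V - C)" for i j
      using that assms(1,2) assms(4)[of i j] t_closed[of i j b]
      by (simp add: linear_form_minus[OF t_form] R.minus_eq R.r_neg D_def)
  qed (use assms in auto)
  then show ?thesis by (rule M.eq_if_minus_zero[OF assms(1,2)])
qed

text \<open>Existence is an assumption of the locale and uniqueness is
  \<open>coordinates_eqI\<close>, so the choice is determined whenever the prescribed values lie in
  the field.\<close>

definition elt :: "('v \<Rightarrow> 'k) \<Rightarrow> ('v \<Rightarrow> 'v \<Rightarrow> 'k) \<Rightarrow> 'a" where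
  "elt f g = (SOME a. a \<in> carrier R \<and> (\<forall>i\<in>V. u i a = f i) \<and> (\<forall>(i, j)\<in>D. t i j a = g i j))"

lemma elt:
  assumes "\<And>i. i \<in> V \<Longrightarrow> f i \<in> carrier K" "\<And>i j. (i, j) \<in> D \<Longrightarrow> g i j \<in> carrier K"
  shows "elt f g \<in> carrier R" "i \<in> V \<Longrightarrow> u i (elt f g) = f i"
    "(i, j) \<in> D \<Longrightarrow> t i j (elt f g) = g i j"
proof -
  have "\<exists>a. a \<in> carrier R \<and> (\<forall>i\<in>V. u i a = f i) \<and> (\<forall>(i, j)\<in>D. t i j a = g i j)"
    using ex_coordinates[of f g] assms unfolding D_def by blast
  then have "elt f g \<in> carrier R \<and> (\<forall>i\<in>V. u i (elt f g) = f i) \<and> (\<forall>(i, j)\<in>D. t i j (elt f g) = g i j)"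
    unfolding elt_def by (rule someI_ex)
  then show "elt f g \<in> carrier R" "i \<in> V \<Longrightarrow> u i (elt f g) = f i"
    "(i, j) \<in> D \<Longrightarrow> t i j (elt f g) = g i j" by auto
qed

definition ev :: "'v \<Rightarrow> 'a" where
  "ev i = elt (\<lambda>j. if j = i then \<one>\<^bsub>K\<^esub> else \<zero>\<^bsub>K\<^esub>) (\<lambda>_ _. \<zero>\<^bsub>K\<^esub>)"

text \<open>\<open>ar i i\<close> is x_i if i lies outside \<open>C\<close>. For a pair outside
  \<open>D\<close> all coordinates are zero, so the value is the zero element and
  \<open>ar_closed\<close> has no side condition.\<close>

definition ar :: "'v \<Rightarrow> 'v \<Rightarrow> 'a" where
  "ar i j = elt (\<lambda>_. \<zero>\<^bsub>K\<^esub>) (\<lambda>k l. if k = i \<and> l = j then \<one>\<^bsub>K\<^esub> else \<zero>\<^bsub>K\<^esub>)"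

lemma ev_closed [simp]: "ev i \<in> carrier R"
  unfolding ev_def by (rule elt(1)) auto

lemma u_ev [simp]: "j \<in> V \<Longrightarrow> u j (ev i) = (if j = i then \<one>\<^bsub>K\<^esub> else \<zero>\<^bsub>K\<^esub>)"
  unfolding ev_def by (subst elt(2)) auto

lemma t_ev: "(k, l) \<in> D \<Longrightarrow> t k l (ev i) = \<zero>\<^bsub>K\<^esub>"
  unfolding ev_def by (subst elt(3)) auto

lemma ar_closed [simp]: "ar i j \<in> carrier R"
  unfolding ar_def by (rule elt(1)) auto

lemma u_ar [simp]: "k \<in> V \<Longrightarrow> u k (ar i j) = \<zero>\<^bsub>K\<^esub>"
  unfolding ar_def by (subst elt(2)) auto

lemma t_ar: "(k, l) \<in> D \<Longrightarrow> t k l (ar i j) = (if k = i \<and> l = j then \<one>\<^bsub>K\<^esub> else \<zero>\<^bsub>K\<^esub>)"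
  unfolding ar_def by (subst elt(3)) auto

lemma u_simps:
  assumes "i \<in> V"
  shows "\<lbrakk>a \<in> carrier R; b \<in> carrier R\<rbrakk> \<Longrightarrow> u i (a \<oplus>\<^bsub>R\<^esub> b) = u i a \<oplus>\<^bsub>K\<^esub> u i b"
    "\<lbrakk>a \<in> carrier R; b \<in> carrier R\<rbrakk> \<Longrightarrow> u i (a \<otimes>\<^bsub>R\<^esub> b) = u i a \<otimes>\<^bsub>K\<^esub> u i b"
    "\<lbrakk>r \<in> carrier K; a \<in> carrier R\<rbrakk> \<Longrightarrow> u i (r \<odot>\<^bsub>R\<^esub> a) = r \<otimes>\<^bsub>K\<^esub> u i a"
  using assms linear_formD[OF u_form[OF assms]] u_mult by auto

lemma t_simps:
  assumes "(i, j) \<in> D"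
  shows "\<lbrakk>a \<in> carrier R; b \<in> carrier R\<rbrakk> \<Longrightarrow> t i j (a \<oplus>\<^bsub>R\<^esub> b) = t i j a \<oplus>\<^bsub>K\<^esub> t i j b"
    "\<lbrakk>r \<in> carrier K; a \<in> carrier R\<rbrakk> \<Longrightarrow> t i j (r \<odot>\<^bsub>R\<^esub> a) = r \<otimes>\<^bsub>K\<^esub> t i j a"
  using assms linear_formD[OF t_form[of i j]] by (auto simp: D_def)

lemma finsum_row_eq:
  assumes "\<And>k. (i, k) \<in> A \<Longrightarrow> f k = g k" "\<And>k. (i, k) \<in> A \<Longrightarrow> g k \<in> carrier K"
  shows "(\<Oplus>\<^bsub>K\<^esub>k\<in>{k. (i, k) \<in> A}. f k) = (\<Oplus>\<^bsub>K\<^esub>k\<in>{k. (i, k) \<in> A}. g k)"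
  by (rule R.finsum_cong') (use assms in auto)

lemma finsum_row_zero:
  assumes "\<And>k. (i, k) \<in> A \<Longrightarrow> f k = \<zero>\<^bsub>K\<^esub>"
  shows "(\<Oplus>\<^bsub>K\<^esub>k\<in>{k. (i, k) \<in> A}. f k) = \<zero>\<^bsub>K\<^esub>"
  using finsum_row_eq[of i f "\<lambda>_. \<zero>\<^bsub>K\<^esub>"] assms by simp

lemma t_ev_mult:
  assumes "(k, l) \<in> D" "i \<in> V" "a \<in> carrier R"
  shows "t k l (ev i \<otimes>\<^bsub>R\<^esub> a) = (if k = i then t k l a else \<zero>\<^bsub>K\<^esub>)"
  using assms(1)
proof (cases rule: D_cases)
  case 1
  then show ?thesis using assms by (auto simp: t_mult_arc t_ev)
next
  case 2
  have "(\<Oplus>\<^bsub>K\<^esub>m\<in>{m. (k, m) \<in> A}. t k m (ev i) \<otimes>\<^bsub>K\<^esub> t m k a) = \<zero>\<^bsub>K\<^esub>"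
    by (rule finsum_row_zero) (use assms(3) A_sym in \<open>simp add: t_ev A_D\<close>)
  then show ?thesis using 2 assms by (auto simp: t_mult_loop t_ev)
qed

lemma t_mult_ev:
  assumes "(k, l) \<in> D" "i \<in> V" "a \<in> carrier R"
  shows "t k l (a \<otimes>\<^bsub>R\<^esub> ev i) = (if l = i then t k l a else \<zero>\<^bsub>K\<^esub>)"
  using assms(1)
proof (cases rule: D_cases)
  case 1
  then show ?thesis using assms by (auto simp: t_mult_arc t_ev)
next
  case 2
  have "(\<Oplus>\<^bsub>K\<^esub>m\<in>{m. (k, m) \<in> A}. t k m a \<otimes>\<^bsub>K\<^esub> t m k (ev i)) = \<zero>\<^bsub>K\<^esub>"
    by (rule finsum_row_zero) (use assms(3) A_sym in \<open>simp add: t_ev A_D\<close>)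
  then show ?thesis using 2 assms by (auto simp: t_mult_loop t_ev)
qed

lemma ev_idem [simp]: "i \<in> V \<Longrightarrow> ev i \<otimes>\<^bsub>R\<^esub> ev i = ev i"
  by (rule coordinates_eqI) (auto simp: u_mult t_ev_mult t_ev)

lemma ev_ar: "(i, j) \<in> D \<Longrightarrow> ev i \<otimes>\<^bsub>R\<^esub> ar i j = ar i j"
  by (rule coordinates_eqI) (auto simp: u_mult t_ev_mult t_ar D_verts)

lemma ar_ev: "(i, j) \<in> D \<Longrightarrow> ar i j \<otimes>\<^bsub>R\<^esub> ev j = ar i j"
  by (rule coordinates_eqI) (auto simp: u_mult t_mult_ev t_ar D_verts)

lemma t_ar_mult:
  assumes "(i, j) \<in> A" "a \<in> carrier R"
  shows "t i j (ar i j \<otimes>\<^bsub>R\<^esub> a) = u j a"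
  using assms A_verts by (simp add: t_mult_arc t_ar A_D)

text \<open>The corner ring at \<^term>\<open>ev i\<close> is local, with residue map \<^term>\<open>u i\<close>.\<close>

lemma corner_unit:
  assumes i: "i \<in> V" and b: "b \<in> carrier R" and ub: "u i b \<noteq> \<zero>\<^bsub>K\<^esub>"
  obtains z where "z \<in> carrier R" "ev i \<otimes>\<^bsub>R\<^esub> z = z" "z \<otimes>\<^bsub>R\<^esub> ev i = z"
    "ev i \<otimes>\<^bsub>R\<^esub> b \<otimes>\<^bsub>R\<^esub> z = ev i" "z \<otimes>\<^bsub>R\<^esub> b \<otimes>\<^bsub>R\<^esub> ev i = ev i"
proof -
  define c where "c = inv\<^bsub>K\<^esub> (u i b)"
  have c: "c \<in> carrier K" "c \<otimes>\<^bsub>K\<^esub> u i b = \<one>\<^bsub>K\<^esub>" "u i b \<otimes>\<^bsub>K\<^esub> c = \<one>\<^bsub>K\<^esub>"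
    using i b ub field_Units by (auto simp: c_def)
  \<comment> \<open>As x^2 = 0, the inverse of u + t x is 1/u - (t/u^2) x; for i in \<open>C\<close>
    there is no term in x_i.\<close>
  define d where "d = (if i \<in> C then \<zero>\<^bsub>K\<^esub> else \<ominus>\<^bsub>K\<^esub> (c \<otimes>\<^bsub>K\<^esub> c \<otimes>\<^bsub>K\<^esub> t i i b))"
  have d: "d \<in> carrier K" using c i b by (simp add: d_def)
  have db: "u i b \<otimes>\<^bsub>K\<^esub> d \<oplus>\<^bsub>K\<^esub> t i i b \<otimes>\<^bsub>K\<^esub> c = \<zero>\<^bsub>K\<^esub>" "c \<otimes>\<^bsub>K\<^esub> t i i b \<oplus>\<^bsub>K\<^esub> d \<otimes>\<^bsub>K\<^esub> u i b = \<zero>\<^bsub>K\<^esub>" if "i \<notin> C"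
  proof -
    have tb: "t i i b \<in> carrier K" and ubc: "u i b \<in> carrier K" using that i b by auto
    have "u i b \<otimes>\<^bsub>K\<^esub> (c \<otimes>\<^bsub>K\<^esub> c \<otimes>\<^bsub>K\<^esub> t i i b) = c \<otimes>\<^bsub>K\<^esub> t i i b"
      using c tb ubc by (metis R.m_assoc R.l_one R.m_closed)
    then have *: "u i b \<otimes>\<^bsub>K\<^esub> d = \<ominus>\<^bsub>K\<^esub> (c \<otimes>\<^bsub>K\<^esub> t i i b)"
      using that c tb ubc by (simp add: d_def R.r_minus)
    show "u i b \<otimes>\<^bsub>K\<^esub> d \<oplus>\<^bsub>K\<^esub> t i i b \<otimes>\<^bsub>K\<^esub> c = \<zero>\<^bsub>K\<^esub>"
      using * c tb by (simp add: R.m_comm R.l_neg)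
    show "c \<otimes>\<^bsub>K\<^esub> t i i b \<oplus>\<^bsub>K\<^esub> d \<otimes>\<^bsub>K\<^esub> u i b = \<zero>\<^bsub>K\<^esub>"
      using * c tb d ubc by (simp add: R.m_comm[of d] R.r_neg)
  qed
  define z where "z = c \<odot>\<^bsub>R\<^esub> ev i \<oplus>\<^bsub>R\<^esub> d \<odot>\<^bsub>R\<^esub> ar i i"
  have z: "z \<in> carrier R" using c d by (simp add: z_def)
  have uz: "u k z = (if k = i then c else \<zero>\<^bsub>K\<^esub>)" if "k \<in> V" for k
    using that c d by (simp add: z_def u_simps)
  have tz: "t k l z = (if k = i \<and> l = i then d else \<zero>\<^bsub>K\<^esub>)" if "(k, l) \<in> D" for k l
    using that c d by (simp add: z_def t_simps t_ev t_ar)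
  have ez: "ev i \<otimes>\<^bsub>R\<^esub> z = z" "z \<otimes>\<^bsub>R\<^esub> ev i = z"
    by (rule coordinates_eqI; use z i c d in \<open>auto simp: u_mult uz t_ev_mult t_mult_ev tz\<close>)+
  \<comment> \<open>z has no component along a proper arrow, so no product with z returns to k
    through a neighbour.\<close>
  have row: "(\<Oplus>\<^bsub>K\<^esub>m\<in>{m. (k, m) \<in> A}. t k m x \<otimes>\<^bsub>K\<^esub> t m k z) = \<zero>\<^bsub>K\<^esub>"
    "(\<Oplus>\<^bsub>K\<^esub>m\<in>{m. (k, m) \<in> A}. t k m z \<otimes>\<^bsub>K\<^esub> t m k x) = \<zero>\<^bsub>K\<^esub>" if "x \<in> carrier R" for k x
    using A_irrefl A_sym that by (intro finsum_row_zero; fastforce simp: tz A_D)+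
  have "ev i \<otimes>\<^bsub>R\<^esub> (b \<otimes>\<^bsub>R\<^esub> z) = ev i"
  proof (rule coordinates_eqI)
    fix k l assume kl: "(k, l) \<in> D"
    have "t i i (b \<otimes>\<^bsub>R\<^esub> z) = \<zero>\<^bsub>K\<^esub>" if "i \<notin> C"
      using that b z i c db row(1)[OF b] by (simp add: t_mult_loop uz tz D_def Id_on_iff)
    moreover have "t i l (b \<otimes>\<^bsub>R\<^esub> z) = \<zero>\<^bsub>K\<^esub>" if "(i, l) \<in> A"
      using that b z i A_verts[OF that] A_irrefl[OF that] A_D[OF that] by (simp add: t_mult_arc uz tz)
    ultimately show "t k l (ev i \<otimes>\<^bsub>R\<^esub> (b \<otimes>\<^bsub>R\<^esub> z)) = t k l (ev i)"
      using kl i b z t_ev_mult[OF kl i, of "b \<otimes>\<^bsub>R\<^esub> z"] t_ev[OF kl, of i] by (auto simp: D_def)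
  qed (use i b z c in \<open>auto simp: u_mult uz\<close>)
  moreover have "(z \<otimes>\<^bsub>R\<^esub> b) \<otimes>\<^bsub>R\<^esub> ev i = ev i"
  proof (rule coordinates_eqI)
    fix k l assume kl: "(k, l) \<in> D"
    have "t i i (z \<otimes>\<^bsub>R\<^esub> b) = \<zero>\<^bsub>K\<^esub>" if "i \<notin> C"
      using that b z i c db row(2)[OF b] by (simp add: t_mult_loop uz tz D_def Id_on_iff)
    moreover have "t k i (z \<otimes>\<^bsub>R\<^esub> b) = \<zero>\<^bsub>K\<^esub>" if "(k, i) \<in> A"
      using that b z i A_verts[OF that] A_irrefl[OF that] A_D[OF that] by (simp add: t_mult_arc uz tz)
    ultimately show "t k l ((z \<otimes>\<^bsub>R\<^esub> b) \<otimes>\<^bsub>R\<^esub> ev i) = t k l (ev i)"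
      using kl i b z t_mult_ev[OF kl i, of "z \<otimes>\<^bsub>R\<^esub> b"] t_ev[OF kl, of i] by (auto simp: D_def)
  qed (use i b z c in \<open>auto simp: u_mult uz\<close>)
  ultimately show thesis using that[OF z ez] b z by (simp add: m_assoc)
qed

text \<open>The elements of the corner with zero residue are the multiples of x_i, and x_i is zero
  when i lies in \<open>C\<close>.\<close>

lemma corner_nilpotent_line:
  assumes i: "i \<in> V" and s: "s \<in> carrier R" "s' \<in> carrier R" and u0: "u i s = \<zero>\<^bsub>K\<^esub>" "u i s' = \<zero>\<^bsub>K\<^esub>"
    and ne: "ev i \<otimes>\<^bsub>R\<^esub> s \<otimes>\<^bsub>R\<^esub> ev i \<noteq> \<zero>\<^bsub>R\<^esub>"
  shows "i \<notin> C" "\<exists>r\<in>carrier K. ev i \<otimes>\<^bsub>R\<^esub> s' \<otimes>\<^bsub>R\<^esub> ev i = r \<odot>\<^bsub>R\<^esub> (ev i \<otimes>\<^bsub>R\<^esub> s \<otimes>\<^bsub>R\<^esub> ev i)"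
proof -
  have uc: "u k (ev i \<otimes>\<^bsub>R\<^esub> x \<otimes>\<^bsub>R\<^esub> ev i) = \<zero>\<^bsub>K\<^esub>" if "x \<in> carrier R" "u i x = \<zero>\<^bsub>K\<^esub>" "k \<in> V" for x k
    using that i by (auto simp: u_mult)
  have tc: "t k l (ev i \<otimes>\<^bsub>R\<^esub> x \<otimes>\<^bsub>R\<^esub> ev i) = (if k = i \<and> l = i then t k l x else \<zero>\<^bsub>K\<^esub>)"
    if "x \<in> carrier R" "(k, l) \<in> D" for x k l
    using that i by (auto simp: t_mult_ev t_ev_mult)
  have ne': "i \<notin> C \<and> t i i s \<noteq> \<zero>\<^bsub>K\<^esub>"
  proof (rule ccontr)
    assume *: "\<not> ?thesis"
    have "ev i \<otimes>\<^bsub>R\<^esub> s \<otimes>\<^bsub>R\<^esub> ev i = \<zero>\<^bsub>R\<^esub>"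
    proof (rule zero_if_coordinates_zero)
      show "t k l (ev i \<otimes>\<^bsub>R\<^esub> s \<otimes>\<^bsub>R\<^esub> ev i) = \<zero>\<^bsub>K\<^esub>" if "(k, l) \<in> A \<union> Id_on (V - C)" for k l
        using * tc[OF s(1), of k l] that A_irrefl by (auto simp: D_def)
    qed (use uc[OF s(1) u0(1)] s in auto)
    then show False using ne by simp
  qed
  then show "i \<notin> C" by simp
  let ?r = "t i i s' \<otimes>\<^bsub>K\<^esub> inv\<^bsub>K\<^esub> (t i i s)"
  have ti: "t i i s \<in> carrier K" "t i i s' \<in> carrier K" using ne' i s by auto
  have iv: "inv\<^bsub>K\<^esub> (t i i s) \<in> carrier K" "inv\<^bsub>K\<^esub> (t i i s) \<otimes>\<^bsub>K\<^esub> t i i s = \<one>\<^bsub>K\<^esub>"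
    using ne' ti field_Units by auto
  have r: "?r \<in> carrier K" "?r \<otimes>\<^bsub>K\<^esub> t i i s = t i i s'"
    using iv ti by (auto simp: R.m_assoc)
  have "ev i \<otimes>\<^bsub>R\<^esub> s' \<otimes>\<^bsub>R\<^esub> ev i = ?r \<odot>\<^bsub>R\<^esub> (ev i \<otimes>\<^bsub>R\<^esub> s \<otimes>\<^bsub>R\<^esub> ev i)"
    by (rule coordinates_eqI) (use i s r(1) in \<open>auto simp: u_simps uc u0 t_simps tc r(2)\<close>)
  then show "\<exists>r\<in>carrier K. ev i \<otimes>\<^bsub>R\<^esub> s' \<otimes>\<^bsub>R\<^esub> ev i = r \<odot>\<^bsub>R\<^esub> (ev i \<otimes>\<^bsub>R\<^esub> s \<otimes>\<^bsub>R\<^esub> ev i)" using r(1) by blast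
qed

text \<open>As j and k differ from i, the two factors are multiples of the arrows from j to i and
  from i to k. Their product can survive only as a multiple of x_j.\<close>

lemma path_through_vertex:
  assumes ijk: "i \<in> V" "j \<in> V" "k \<in> V" "j \<noteq> i" "k \<noteq> i" and ab: "a \<in> carrier R" "b \<in> carrier R"
    and ne: "(ev j \<otimes>\<^bsub>R\<^esub> a \<otimes>\<^bsub>R\<^esub> ev i) \<otimes>\<^bsub>R\<^esub> (ev i \<otimes>\<^bsub>R\<^esub> b \<otimes>\<^bsub>R\<^esub> ev k) \<noteq> \<zero>\<^bsub>R\<^esub>"
  shows "j = k" "j \<notin> C" "(i, j) \<in> A"
proof -
  let ?X = "ev j \<otimes>\<^bsub>R\<^esub> a \<otimes>\<^bsub>R\<^esub> ev i" and ?Y = "ev i \<otimes>\<^bsub>R\<^esub> b \<otimes>\<^bsub>R\<^esub> ev k"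
  have XY: "?X \<in> carrier R" "?Y \<in> carrier R" using ab by auto
  have ux: "u m ?X = \<zero>\<^bsub>K\<^esub>" "u m ?Y = \<zero>\<^bsub>K\<^esub>" if "m \<in> V" for m
    using that ijk ab by (auto simp: u_mult)
  have tx: "t p q ?X = (if p = j \<and> q = i then t p q a else \<zero>\<^bsub>K\<^esub>)"
    "t p q ?Y = (if p = i \<and> q = k then t p q b else \<zero>\<^bsub>K\<^esub>)" if "(p, q) \<in> D" for p q
    using that ijk ab by (auto simp: t_mult_ev t_ev_mult)
  have "\<exists>p q. (p, q) \<in> D \<and> t p q (?X \<otimes>\<^bsub>R\<^esub> ?Y) \<noteq> \<zero>\<^bsub>K\<^esub>"
    using ne zero_if_coordinates_zero[of "?X \<otimes>\<^bsub>R\<^esub> ?Y"] XY ux unfolding D_def by (auto simp: u_mult)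
  then obtain p q where pq: "(p, q) \<in> D" "t p q (?X \<otimes>\<^bsub>R\<^esub> ?Y) \<noteq> \<zero>\<^bsub>K\<^esub>" by blast
  from pq(1) have "j = k \<and> j \<notin> C \<and> (i, j) \<in> A"
  proof (cases rule: D_cases)
    \<comment> \<open>Each term of the product rule at an arrow contains a vertex coordinate of one
      factor, and these all vanish, so this case is void.\<close>
    case 1
    then show ?thesis using pq(2) XY ux by (simp add: t_mult_arc)
  next
    case 2
    then have "(\<Oplus>\<^bsub>K\<^esub>m\<in>{m. (p, m) \<in> A}. t p m ?X \<otimes>\<^bsub>K\<^esub> t m p ?Y) \<noteq> \<zero>\<^bsub>K\<^esub>"
      using pq XY ux by (auto simp: t_mult_loop)
    then have "\<not> (\<forall>m. (p, m) \<in> A \<longrightarrow> t p m ?X \<otimes>\<^bsub>K\<^esub> t m p ?Y = \<zero>\<^bsub>K\<^esub>)"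
      using finsum_row_zero[of p "\<lambda>m. t p m ?X \<otimes>\<^bsub>K\<^esub> t m p ?Y"] by argo
    then obtain m where m: "(p, m) \<in> A" "t p m ?X \<otimes>\<^bsub>K\<^esub> t m p ?Y \<noteq> \<zero>\<^bsub>K\<^esub>"
      by auto
    have mp: "(m, p) \<in> A" by (rule A_sym[OF m(1)])
    have "t p m ?X \<noteq> \<zero>\<^bsub>K\<^esub>" "t m p ?Y \<noteq> \<zero>\<^bsub>K\<^esub>"
      using m(2) XY t_closed_A[OF m(1) XY(1)] t_closed_A[OF mp XY(2)] by (metis R.l_null R.r_null)+
    then have "p = j \<and> m = i \<and> p = k"
      using tx(1)[OF A_D[OF m(1)]] tx(2)[OF A_D[OF mp]] by (auto split: if_splits)
    then show ?thesis using m 2 A_sym by auto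
  qed
  then show "j = k" "j \<notin> C" "(i, j) \<in> A" by auto
qed

text \<open>Finite dimension makes the index set of any cell basis finite, which is what allows
  extremal cells to be chosen.\<close>

lemma fin_dim: "fin_dim"
proof -
  define P where "P = Inl ` V \<union> Inr ` D"
  define bv where "bv = case_sum ev (\<lambda>(i, j). ar i j)"
  define F where "F = case_sum u (\<lambda>(i, j). t i j)"
  have "finite D" using finite_V A_subset
    by (intro finite_subset[of D "V \<times> V"]) (auto simp: D_def)
  then have P: "finite P" using finite_V by (simp add: P_def)
  have "basis (bv ` P)"
  proof (rule dual_basis_basis(2)[OF P, where F = F])
    show "bv \<in> P \<rightarrow> carrier R" by (auto simp: P_def bv_def)
    show "linear_form (F p)" if "p \<in> P" for p
      using that t_form u_form by (auto simp: P_def F_def D_def Id_on_def)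
    show "F p (bv q) = (if p = q then \<one>\<^bsub>K\<^esub> else \<zero>\<^bsub>K\<^esub>)" if "p \<in> P" "q \<in> P" for p q
      using that by (auto simp: P_def F_def bv_def t_ev t_ar D_verts split: if_splits)
    fix a assume a: "a \<in> carrier R" "\<And>p. p \<in> P \<Longrightarrow> F p a = \<zero>\<^bsub>K\<^esub>"
    show "a = \<zero>\<^bsub>R\<^esub>"
    proof (rule zero_if_coordinates_zero[OF a(1)])
      show "u i a = \<zero>\<^bsub>K\<^esub>" if "i \<in> V" for i
        using a(2)[of "Inl i"] that by (simp add: P_def F_def)
      show "t i j a = \<zero>\<^bsub>K\<^esub>" if "(i, j) \<in> A \<union> Id_on (V - C)" for i j
        using a(2)[of "Inr (i, j)"] that by (simp add: P_def F_def D_def)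
    qed
  qed
  then show ?thesis
    unfolding fin_dim_def by (intro exI[of _ "bv ` P"]) (use P in \<open>simp add: basis_def\<close>)
qed

end

section \<open>Finite-dimensional relative cellular algebras\<close>

lemma partial_order_on_ex_minimal:
  assumes "partial_order_on X r" "finite A" "A \<noteq> {}"
  shows "\<exists>m\<in>A. \<forall>a\<in>A. (a, m) \<in> r \<longrightarrow> a = m"
  using assms(2,3)
proof (induction A rule: finite_ne_induct)
  case (insert x F)
  have trans: "trans r" and antisym: "antisym r"
    using assms(1) by (auto simp: partial_order_on_def preorder_on_def)
  from insert obtain m where m: "m \<in> F" "\<forall>a\<in>F. (a, m) \<in> r \<longrightarrow> a = m" by blast
  show ?case
  proof (cases "(x, m) \<in> r")
    case True
    have "a = x" if "a \<in> insert x F" "(a, x) \<in> r" for a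
      using that m True trans antisym by (metis antisymD insertE transD)
    then show ?thesis by blast
  next
    case False
    then show ?thesis using m by blast
  qed
qed simp

context vectorspace
begin

lemma one_if_idem:
  assumes "x \<in> carrier K" "x \<otimes>\<^bsub>K\<^esub> x = x" "x \<noteq> \<zero>\<^bsub>K\<^esub>"
  shows "x = \<one>\<^bsub>K\<^esub>"
proof -
  have "x \<otimes>\<^bsub>K\<^esub> x = x \<otimes>\<^bsub>K\<^esub> \<one>\<^bsub>K\<^esub>" using assms by simp
  then show ?thesis using assms m_lcancel by blast
qed

lemma K_cancel:
  assumes "x \<otimes>\<^bsub>K\<^esub> z = y \<otimes>\<^bsub>K\<^esub> z" "x \<in> carrier K" "y \<in> carrier K" "z \<in> carrier K" "z \<noteq> \<zero>\<^bsub>K\<^esub>"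
  shows "x = y"
  using assms m_rcancel by blast

end

context k_algebra
begin

lemma form_mult_left: "\<lbrakk>linear_form f; a \<in> carrier R\<rbrakk> \<Longrightarrow> linear_form (\<lambda>x. f (a \<otimes>\<^bsub>R\<^esub> x))"
  unfolding linear_form_def by (auto simp: r_distr smult_mult_right Pi_iff)

lemma form_mult_right: "\<lbrakk>linear_form f; a \<in> carrier R\<rbrakk> \<Longrightarrow> linear_form (\<lambda>x. f (x \<otimes>\<^bsub>R\<^esub> a))"
  unfolding linear_form_def by (auto simp: l_distr smult_mult_left Pi_iff)

definition character :: "('a \<Rightarrow> 'k) \<Rightarrow> bool" where
  "character f \<longleftrightarrow> linear_form f \<and> f \<one>\<^bsub>R\<^esub> = \<one>\<^bsub>K\<^esub>
    \<and> (\<forall>a\<in>carrier R. \<forall>b\<in>carrier R. f (a \<otimes>\<^bsub>R\<^esub> b) = f a \<otimes>\<^bsub>K\<^esub> f b)"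

lemma characterD:
  assumes "character f"
  shows "linear_form f" "f \<one>\<^bsub>R\<^esub> = \<one>\<^bsub>K\<^esub>"
    "\<lbrakk>a \<in> carrier R; b \<in> carrier R\<rbrakk> \<Longrightarrow> f (a \<otimes>\<^bsub>R\<^esub> b) = f a \<otimes>\<^bsub>K\<^esub> f b"
    "a \<in> carrier R \<Longrightarrow> f a \<in> carrier K"
  using assms linear_formD(1) by (auto simp: character_def)

end

section \<open>Coefficients of products in a cell basis\<close>

locale finite_cell_datum = relative_cell_datum K R X M C star E leq eps
  for K :: "('k, 'm) ring_scheme" and R :: "('k, 'a, 'n) module_scheme"
    and X :: "'x set" and M :: "'x \<Rightarrow> 's set" and C star E leq eps +
  assumes finite_dim: "fin_dim"
begin

sublocale cells: indexed_basis K R "SIGMA l:X. M l \<times> M l" "\<lambda>(l, S, T). C l S T"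
proof
  have "finite ((\<lambda>(l, S, T). C l S T) ` (SIGMA l:X. M l \<times> M l))"
    using basis_C fin_dim_li_fin[OF finite_dim] by (simp add: basis_def)
  then show "finite (SIGMA l:X. M l \<times> M l)" by (rule finite_imageD[OF _ inj_C])
qed (rule inj_C basis_C)+

abbreviation cf :: "'x \<Rightarrow> 's \<Rightarrow> 's \<Rightarrow> 'a \<Rightarrow> 'k" where
  "cf l S T \<equiv> cells.coeff (l, S, T)"

lemma C_closed [simp]: "\<lbrakk>l \<in> X; S \<in> M l; T \<in> M l\<rbrakk> \<Longrightarrow> C l S T \<in> carrier R"
  using cells.bv_closed[of "(l, S, T)"] by simp

lemma cf_form: "\<lbrakk>l \<in> X; S \<in> M l; T \<in> M l\<rbrakk> \<Longrightarrow> linear_form (cf l S T)"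
  by (rule cells.coeff_form) simp

lemma cf_closed [simp]: "\<lbrakk>l \<in> X; S \<in> M l; T \<in> M l; a \<in> carrier R\<rbrakk> \<Longrightarrow> cf l S T a \<in> carrier K"
  by (rule cells.coeff_closed) simp_all

lemma cf_C:
  "\<lbrakk>l \<in> X; S \<in> M l; T \<in> M l; m \<in> X; U \<in> M m; W \<in> M m\<rbrakk>
    \<Longrightarrow> cf m U W (C l S T) = (if m = l \<and> U = S \<and> W = T then \<one>\<^bsub>K\<^esub> else \<zero>\<^bsub>K\<^esub>)"
  using cells.coeff_bv[of "(m, U, W)" "(l, S, T)"] by simp

lemma form_nonzeroE:
  assumes "linear_form f" "a \<in> carrier R" "f a \<noteq> \<zero>\<^bsub>K\<^esub>"
  obtains m U W where "m \<in> X" "U \<in> M m" "W \<in> M m" "cf m U W a \<noteq> \<zero>\<^bsub>K\<^esub>" "f (C m U W) \<noteq> \<zero>\<^bsub>K\<^esub>"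
proof (rule cells.form_nonzeroE[OF assms])
  fix p assume p: "p \<in> (SIGMA l:X. M l \<times> M l)" "cells.coeff p a \<noteq> \<zero>\<^bsub>K\<^esub>"
    "f (case p of (l, S, T) \<Rightarrow> C l S T) \<noteq> \<zero>\<^bsub>K\<^esub>"
  obtain m U W where "p = (m, U, W)" by (cases p)
  then show thesis using that[of m U W] p by simp
qed

text \<open>The premise \<open>van\<close> is what the order axioms and the choice of a minimal cell
  deliver: nothing outside the column T of the cell l contributes.\<close>

lemma form_column:
  assumes f: "linear_form f" and a: "a \<in> carrier R" and l: "l \<in> X" "T \<in> M l"
    and van: "\<And>m U W. \<lbrakk>m \<in> X; U \<in> M m; W \<in> M m; cf m U W a \<noteq> \<zero>\<^bsub>K\<^esub>; f (C m U W) \<noteq> \<zero>\<^bsub>K\<^esub>\<rbrakk>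
      \<Longrightarrow> m = l \<and> W = T"
  shows "f a = (\<Oplus>\<^bsub>K\<^esub>U\<in>M l. cf l U T a \<otimes>\<^bsub>K\<^esub> f (C l U T))"
proof -
  have "f a = (\<Oplus>\<^bsub>K\<^esub>p\<in>(\<lambda>U. (l, U, T)) ` M l. cells.coeff p a \<otimes>\<^bsub>K\<^esub> f (case p of (l, S, T) \<Rightarrow> C l S T))"
  proof (rule cells.form_expand_on[OF f a])
    fix p assume p: "p \<in> (SIGMA l:X. M l \<times> M l)" "p \<notin> (\<lambda>U. (l, U, T)) ` M l" "cells.coeff p a \<noteq> \<zero>\<^bsub>K\<^esub>"
    obtain m U W where mUW: "p = (m, U, W)" by (cases p)
    have m: "m \<in> X" "U \<in> M m" "W \<in> M m" "cf m U W a \<noteq> \<zero>\<^bsub>K\<^esub>" using p unfolding mUW by auto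
    show "f (case p of (l, S, T) \<Rightarrow> C l S T) = \<zero>\<^bsub>K\<^esub>"
    proof (rule ccontr)
      assume "f (case p of (l, S, T) \<Rightarrow> C l S T) \<noteq> \<zero>\<^bsub>K\<^esub>"
      then have "f (C m U W) \<noteq> \<zero>\<^bsub>K\<^esub>" by (simp add: mUW)
      from van[OF m this] show False using p(1,2) unfolding mUW by auto
    qed
  qed (use l in auto)
  also have "\<dots> = (\<Oplus>\<^bsub>K\<^esub>U\<in>M l. cf l U T a \<otimes>\<^bsub>K\<^esub> f (C l U T))"
    by (subst R.finsum_reindex)
      (use l a linear_formD(1)[OF f] in \<open>auto simp: inj_on_def intro!: R.m_closed\<close>)
  finally show ?thesis .
qed

lemma form_single:
  assumes f: "linear_form f" and a: "a \<in> carrier R" and l: "l \<in> X" "S \<in> M l" "T \<in> M l"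
    and van: "\<And>m U W. \<lbrakk>m \<in> X; U \<in> M m; W \<in> M m; cf m U W a \<noteq> \<zero>\<^bsub>K\<^esub>; f (C m U W) \<noteq> \<zero>\<^bsub>K\<^esub>\<rbrakk>
      \<Longrightarrow> m = l \<and> U = S \<and> W = T"
  shows "f a = cf l S T a \<otimes>\<^bsub>K\<^esub> f (C l S T)"
proof -
  have "f a = (\<Oplus>\<^bsub>K\<^esub>p\<in>{(l, S, T)}. cells.coeff p a \<otimes>\<^bsub>K\<^esub> f (case p of (l, S, T) \<Rightarrow> C l S T))"
  proof (rule cells.form_expand_on[OF f a])
    fix p assume p: "p \<in> (SIGMA l:X. M l \<times> M l)" "p \<notin> {(l, S, T)}" "cells.coeff p a \<noteq> \<zero>\<^bsub>K\<^esub>"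
    obtain m U W where mUW: "p = (m, U, W)" by (cases p)
    have m: "m \<in> X" "U \<in> M m" "W \<in> M m" "cf m U W a \<noteq> \<zero>\<^bsub>K\<^esub>" using p unfolding mUW by auto
    show "f (case p of (l, S, T) \<Rightarrow> C l S T) = \<zero>\<^bsub>K\<^esub>"
    proof (rule ccontr)
      assume "f (case p of (l, S, T) \<Rightarrow> C l S T) \<noteq> \<zero>\<^bsub>K\<^esub>"
      then have "f (C m U W) \<noteq> \<zero>\<^bsub>K\<^esub>" by (simp add: mUW)
      from van[OF m this] show False using p(1,2) unfolding mUW by auto
    qed
  qed (use l in auto)
  then show ?thesis using l a linear_formD(1)[OF f] by simp
qed

lemma form_eqI:
  assumes f: "linear_form f" and g: "linear_form g" and a: "a \<in> carrier R"
    and eq: "\<And>l S T. \<lbrakk>l \<in> X; S \<in> M l; T \<in> M l\<rbrakk> \<Longrightarrow> f (C l S T) = g (C l S T)"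
  shows "f a = g a"
  unfolding cells.form_expand[OF f a] cells.form_expand[OF g a]
  by (rule R.finsum_cong') (use eq a linear_formD(1)[OF g] in auto)

lemma nonzero_cfE:
  assumes "a \<in> carrier R" "a \<noteq> \<zero>\<^bsub>R\<^esub>"
  obtains m U W where "m \<in> X" "U \<in> M m" "W \<in> M m" "cf m U W a \<noteq> \<zero>\<^bsub>K\<^esub>"
  using cells.zero_if_coeffs_zero[OF assms(1)] assms(2) by auto

lemma eps_closed [simp]: "\<lbrakk>l \<in> X; S \<in> M l\<rbrakk> \<Longrightarrow> eps l S \<in> carrier R"
  using eps_in_E E_closed by auto

lemma leq_trans: "\<lbrakk>e \<in> E; (a, b) \<in> leq e; (b, c) \<in> leq e\<rbrakk> \<Longrightarrow> (a, c) \<in> leq e"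
  using order_le by (metis partial_order_on_def preorder_on_def transD)

lemma leq_antisym: "\<lbrakk>e \<in> E; (a, b) \<in> leq e; (b, a) \<in> leq e\<rbrakk> \<Longrightarrow> a = b"
  using order_le by (metis partial_order_on_def antisymD)

lemma leq_refl: "\<lbrakk>e \<in> E; a \<in> X\<rbrakk> \<Longrightarrow> (a, a) \<in> leq e"
  using order_le by (metis partial_order_on_def preorder_on_def refl_onD)

lemma star_zero: "star \<zero>\<^bsub>R\<^esub> = \<zero>\<^bsub>R\<^esub>"
  using star_smult[of "\<zero>\<^bsub>K\<^esub>" "\<zero>\<^bsub>R\<^esub>"] star_closed by simp

lemma form_star: "linear_form f \<Longrightarrow> linear_form (\<lambda>x. f (star x))"
  unfolding linear_form_def by (auto simp: star_add star_smult star_closed Pi_iff)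

lemma cf_star:
  assumes "l \<in> X" "S \<in> M l" "T \<in> M l" "a \<in> carrier R"
  shows "cf l S T (star a) = cf l T S a"
  by (rule form_eqI[OF form_star[OF cf_form[OF assms(1-3)]] cf_form[OF assms(1,3,2)] assms(4)])
    (use assms(1-3) in \<open>auto simp: star_C cf_C\<close>)

text \<open>The right-hand version of the axiom on idempotents: the anti-involution fixes e and
  exchanges S and T.\<close>

lemma C_eps:
  assumes "l \<in> X" "S \<in> M l" "T \<in> M l" "e \<in> E"
  shows "C l S T \<otimes>\<^bsub>R\<^esub> e = (if eps l T = e then C l S T else \<zero>\<^bsub>R\<^esub>)"
proof -
  have e: "e \<in> carrier R" using assms E_closed by auto
  have "C l S T \<otimes>\<^bsub>R\<^esub> e = star (star e \<otimes>\<^bsub>R\<^esub> star (C l S T))"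
    using assms e by (simp add: star_mult[symmetric] star_star)
  also have "\<dots> = star (e \<otimes>\<^bsub>R\<^esub> C l T S)" using assms by (simp add: E_star star_C)
  also have "\<dots> = (if eps l T = e then C l S T else \<zero>\<^bsub>R\<^esub>)"
    using assms by (simp add: eps_C star_C star_zero)
  finally show ?thesis .
qed

lemma cf_mult_eps:
  assumes "l \<in> X" "S \<in> M l" "T \<in> M l" "e \<in> E" "a \<in> carrier R"
  shows "cf l S T (a \<otimes>\<^bsub>R\<^esub> e) = (if eps l T = e then cf l S T a else \<zero>\<^bsub>K\<^esub>)"
proof -
  have ec: "e \<in> carrier R" using assms(4) E_closed by auto
  have 0: "cf l S T \<zero>\<^bsub>R\<^esub> = \<zero>\<^bsub>K\<^esub>" by (rule linear_form_zero[OF cf_form[OF assms(1-3)]])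
  note f = form_mult_right[OF cf_form[OF assms(1-3)] ec]
  show ?thesis
  proof (cases "eps l T = e")
    case True
    have "cf l S T (a \<otimes>\<^bsub>R\<^esub> e) = cf l S T a"
      by (rule form_eqI[OF f cf_form[OF assms(1-3)] assms(5)])
        (use assms(1-4) True 0 in \<open>auto simp: cf_C C_eps\<close>)
    then show ?thesis using True by simp
  next
    case False
    have "linear_form (\<lambda>_. \<zero>\<^bsub>K\<^esub>)" by (simp add: linear_form_def)
    then have "cf l S T (a \<otimes>\<^bsub>R\<^esub> e) = \<zero>\<^bsub>K\<^esub>"
      by (rule form_eqI[OF f _ assms(5)]) (use assms(1-4) False 0 in \<open>auto simp: cf_C C_eps\<close>)
    then show ?thesis using False by simp
  qed
qed

lemma cf_span_le:
  assumes "y \<in> cell_span_le K R X M C leq e l" "m \<in> X" "U \<in> M m" "W \<in> M m" "cf m U W y \<noteq> \<zero>\<^bsub>K\<^esub>"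
  shows "(m, l) \<in> leq e"
proof (rule ccontr)
  assume no: "(m, l) \<notin> leq e"
  have "cf m U W y = \<zero>\<^bsub>K\<^esub>"
    by (rule linear_form_span_zero[OF cf_form _ _ assms(1)[unfolded cell_span_le_def]])
      (use assms(2-4) no in \<open>auto simp: cf_C\<close>)
  then show False using assms(5) by simp
qed

lemma cf_span_less:
  assumes "y \<in> cell_span_less K R X M C leq e l" "m \<in> X" "U \<in> M m" "W \<in> M m" "cf m U W y \<noteq> \<zero>\<^bsub>K\<^esub>"
  shows "(m, l) \<in> leq e" "m \<noteq> l"
proof -
  have "(m, l) \<in> leq e \<and> m \<noteq> l"
  proof (rule ccontr)
    assume no: "\<not> ?thesis"
    have "cf m U W y = \<zero>\<^bsub>K\<^esub>"
      by (rule linear_form_span_zero[OF cf_form _ _ assms(1)[unfolded cell_span_less_def]])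
        (use assms(2-4) no in \<open>auto simp: cf_C\<close>)
    then show False using assms(5) by simp
  qed
  then show "(m, l) \<in> leq e" "m \<noteq> l" by auto
qed

lemma span_less_closed: "y \<in> cell_span_less K R X M C leq e l \<Longrightarrow> y \<in> carrier R"
  unfolding cell_span_less_def by (rule span_closed[rotated]) auto

text \<open>The matrices of the algebra on the cell modules, with row S' and column S. They are
  chosen for all elements at once because axiom (d) asserts the existence of one function r.\<close>

definition act :: "'a \<Rightarrow> 'x \<Rightarrow> 's \<Rightarrow> 's \<Rightarrow> 'k" where
  "act = (SOME r. \<forall>a\<in>carrier R. \<forall>l\<in>X. \<forall>S\<in>M l.
      (\<forall>S'\<in>M l. r a l S' S \<in> carrier K) \<and>
      (\<forall>T\<in>M l. \<exists>y\<in>cell_span_less K R X M C leq (eps l T) l.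
        a \<otimes>\<^bsub>R\<^esub> C l S T =
          (\<Oplus>\<^bsub>R\<^esub>S'\<in>M l. r a l S' S \<odot>\<^bsub>R\<^esub> C l S' T) \<oplus>\<^bsub>R\<^esub> (y \<otimes>\<^bsub>R\<^esub> eps l T)))"

lemma act_spec:
  assumes "a \<in> carrier R" "l \<in> X" "S \<in> M l"
  shows "S' \<in> M l \<Longrightarrow> act a l S' S \<in> carrier K"
    and "T \<in> M l \<Longrightarrow> \<exists>y\<in>cell_span_less K R X M C leq (eps l T) l.
        a \<otimes>\<^bsub>R\<^esub> C l S T =
          (\<Oplus>\<^bsub>R\<^esub>S'\<in>M l. act a l S' S \<odot>\<^bsub>R\<^esub> C l S' T) \<oplus>\<^bsub>R\<^esub> (y \<otimes>\<^bsub>R\<^esub> eps l T)"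
  using someI_ex[OF mult_C, folded act_def] assms by blast+

lemma act_closed [simp]: "\<lbrakk>a \<in> carrier R; l \<in> X; S \<in> M l; S' \<in> M l\<rbrakk> \<Longrightarrow> act a l S' S \<in> carrier K"
  by (rule act_spec(1))

lemma cf_mult_C_aux:
  assumes "a \<in> carrier R" "l \<in> X" "S \<in> M l" "T \<in> M l" "m \<in> X" "U \<in> M m" "W \<in> M m"
  obtains y where "y \<in> cell_span_less K R X M C leq (eps l T) l"
    "cf m U W (a \<otimes>\<^bsub>R\<^esub> C l S T) =
      (if m = l \<and> W = T then act a l U S else \<zero>\<^bsub>K\<^esub>) \<oplus>\<^bsub>K\<^esub> cf m U W (y \<otimes>\<^bsub>R\<^esub> eps l T)"
proof -
  obtain y where y: "y \<in> cell_span_less K R X M C leq (eps l T) l" and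
    eq: "a \<otimes>\<^bsub>R\<^esub> C l S T =
          (\<Oplus>\<^bsub>R\<^esub>S'\<in>M l. act a l S' S \<odot>\<^bsub>R\<^esub> C l S' T) \<oplus>\<^bsub>R\<^esub> (y \<otimes>\<^bsub>R\<^esub> eps l T)"
    using act_spec(2)[OF assms(1-4)] by blast
  note f = cf_form[OF assms(5-7)]
  have smc: "(\<Oplus>\<^bsub>R\<^esub>S'\<in>M l. act a l S' S \<odot>\<^bsub>R\<^esub> C l S' T) \<in> carrier R"
    by (rule finsum_closed) (use assms in auto)
  have "cf m U W (\<Oplus>\<^bsub>R\<^esub>S'\<in>M l. act a l S' S \<odot>\<^bsub>R\<^esub> C l S' T)
      = (\<Oplus>\<^bsub>K\<^esub>S'\<in>M l. cf m U W (act a l S' S \<odot>\<^bsub>R\<^esub> C l S' T))"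
    by (rule linear_form_finsum[OF f]) (use assms in auto)
  also have "\<dots> = (\<Oplus>\<^bsub>K\<^esub>S'\<in>M l. if U = S' then (if m = l \<and> W = T then act a l S' S else \<zero>\<^bsub>K\<^esub>) else \<zero>\<^bsub>K\<^esub>)"
    by (rule R.finsum_cong') (use assms in \<open>auto simp: linear_formD(3)[OF f] cf_C\<close>)
  also have "\<dots> = (if m = l \<and> W = T then act a l U S else \<zero>\<^bsub>K\<^esub>)"
  proof (cases "m = l \<and> W = T")
    case True
    then have "U \<in> M l" using assms by simp
    then show ?thesis by (rule R.finsum_singleton) (use assms(1-4) finite_M in auto)
  next
    case False
    have "(\<Oplus>\<^bsub>K\<^esub>S'\<in>M l. if U = S' then (if m = l \<and> W = T then act a l S' S else \<zero>\<^bsub>K\<^esub>) else \<zero>\<^bsub>K\<^esub>)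
        = (\<Oplus>\<^bsub>K\<^esub>S'\<in>M l. \<zero>\<^bsub>K\<^esub>)"
      by (rule R.finsum_cong') (use False in auto)
    also have "\<dots> = \<zero>\<^bsub>K\<^esub>" by simp
    finally show ?thesis by (simp only: if_not_P[OF False])
  qed
  finally show thesis
    using that[OF y] eq smc span_less_closed[OF y] assms by (simp add: linear_formD(2)[OF f])
qed

text \<open>The remainder in axiom (d) lies strictly below l, and right multiplication by an
  idempotent of \<open>E\<close> does not enlarge its support, so it has no coefficient in the cell
  l.\<close>

lemma cf_mult_C:
  assumes "a \<in> carrier R" "l \<in> X" "S \<in> M l" "T \<in> M l" "S' \<in> M l" "T' \<in> M l"
  shows "cf l S' T' (a \<otimes>\<^bsub>R\<^esub> C l S T) = (if T' = T then act a l S' S else \<zero>\<^bsub>K\<^esub>)"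
proof -
  obtain y where y: "y \<in> cell_span_less K R X M C leq (eps l T) l"
    "cf l S' T' (a \<otimes>\<^bsub>R\<^esub> C l S T) =
      (if l = l \<and> T' = T then act a l S' S else \<zero>\<^bsub>K\<^esub>) \<oplus>\<^bsub>K\<^esub> cf l S' T' (y \<otimes>\<^bsub>R\<^esub> eps l T)"
    by (rule cf_mult_C_aux[OF assms(1-4,2,5,6)])
  have "cf l S' T' (y \<otimes>\<^bsub>R\<^esub> eps l T) = \<zero>\<^bsub>K\<^esub>"
    using cf_mult_eps[OF assms(2,5,6) eps_in_E[OF assms(2,4)] span_less_closed[OF y(1)]]
      cf_span_less(2)[OF y(1) assms(2,5,6)] by auto
  then show ?thesis using y(2) assms by simp
qed

text \<open>The remainder is strictly below l in the order of \<open>eps l T\<close> and carries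
  \<open>eps l T\<close> as a right factor. The right factor forces the same idempotent on every
  basis element that occurs, so successive bounds refer to one order and can be chained.\<close>

lemma cf_mult_C_nonzero:
  assumes "a \<in> carrier R" "l \<in> X" "S \<in> M l" "T \<in> M l" "m \<in> X" "U \<in> M m" "W \<in> M m"
    and ne: "cf m U W (a \<otimes>\<^bsub>R\<^esub> C l S T) \<noteq> \<zero>\<^bsub>K\<^esub>"
  shows "(m, l) \<in> leq (eps l T)" "eps m W = eps l T" "m = l \<Longrightarrow> W = T"
proof -
  have "(m, l) \<in> leq (eps l T) \<and> eps m W = eps l T \<and> (m = l \<longrightarrow> W = T)"
  proof (cases "m = l")
    case True
    then have "W = T" using cf_mult_C[OF assms(1-4), of U W] assms by (auto split: if_splits)
    then show ?thesis using True leq_refl eps_in_E assms by auto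
  next
    case False
    obtain y where y: "y \<in> cell_span_less K R X M C leq (eps l T) l"
      "cf m U W (a \<otimes>\<^bsub>R\<^esub> C l S T) =
        (if m = l \<and> W = T then act a l U S else \<zero>\<^bsub>K\<^esub>) \<oplus>\<^bsub>K\<^esub> cf m U W (y \<otimes>\<^bsub>R\<^esub> eps l T)"
      by (rule cf_mult_C_aux[OF assms(1-7)])
    have yc: "y \<in> carrier R" by (rule span_less_closed[OF y(1)])
    have "cf m U W (y \<otimes>\<^bsub>R\<^esub> eps l T) \<noteq> \<zero>\<^bsub>K\<^esub>" using y(2) ne False assms yc by auto
    then have "eps m W = eps l T" "cf m U W y \<noteq> \<zero>\<^bsub>K\<^esub>"
      using cf_mult_eps[OF assms(5-7) eps_in_E[OF assms(2,4)] yc] by (auto split: if_splits)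
    then show ?thesis using cf_span_less(1)[OF y(1) assms(5-7)] False by simp
  qed
  then show "(m, l) \<in> leq (eps l T)" "eps m W = eps l T" "m = l \<Longrightarrow> W = T" by auto
qed

lemma cf_C_mult_eq:
  assumes "b \<in> carrier R" "l \<in> X" "S \<in> M l" "T \<in> M l" "m \<in> X" "U \<in> M m" "W \<in> M m"
  shows "cf m U W (C l S T \<otimes>\<^bsub>R\<^esub> b) = cf m W U (star b \<otimes>\<^bsub>R\<^esub> C l T S)"
  using assms cf_star[of m W U "C l S T \<otimes>\<^bsub>R\<^esub> b"] by (simp add: star_mult star_C)

lemma cf_C_mult:
  assumes "b \<in> carrier R" "l \<in> X" "S \<in> M l" "T \<in> M l" "S' \<in> M l" "T' \<in> M l"
  shows "cf l S' T' (C l S T \<otimes>\<^bsub>R\<^esub> b) = (if S' = S then act (star b) l T' T else \<zero>\<^bsub>K\<^esub>)"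
  using assms by (simp add: cf_C_mult_eq cf_mult_C star_closed)

lemma cf_C_mult_nonzero:
  assumes "b \<in> carrier R" "l \<in> X" "S \<in> M l" "T \<in> M l" "m \<in> X" "U \<in> M m" "W \<in> M m"
    and ne: "cf m U W (C l S T \<otimes>\<^bsub>R\<^esub> b) \<noteq> \<zero>\<^bsub>K\<^esub>"
  shows "(m, l) \<in> leq (eps l S)" "eps m U = eps l S" "m = l \<Longrightarrow> U = S"
  using cf_mult_C_nonzero[of "star b" l T S m W U] assms
  by (simp_all add: cf_C_mult_eq star_closed)

text \<open>For arbitrary b, right multiplication is bounded only in the order of
  \<open>eps l S\<close>. For b in the corner at e, axiom (c) transported by the anti-involution
  gives a bound in the order of e, and e becomes the right idempotent of the result. A left
  multiplication performed afterwards is then bounded in that same order.\<close>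

lemma cf_C_mult_corner_nonzero:
  assumes "b \<in> carrier R" "l \<in> X" "S \<in> M l" "T \<in> M l" "m \<in> X" "U \<in> M m" "W \<in> M m"
    and e: "e \<in> E" "e \<otimes>\<^bsub>R\<^esub> b \<otimes>\<^bsub>R\<^esub> e = b" and ne: "cf m U W (C l S T \<otimes>\<^bsub>R\<^esub> b) \<noteq> \<zero>\<^bsub>K\<^esub>"
  shows "(m, l) \<in> leq e" "eps m W = e"
proof -
  have ec: "e \<in> carrier R" using e E_closed by auto
  have "star b = star (e \<otimes>\<^bsub>R\<^esub> b \<otimes>\<^bsub>R\<^esub> e)" using e by simp
  also have "\<dots> = e \<otimes>\<^bsub>R\<^esub> star b \<otimes>\<^bsub>R\<^esub> e"
    using ec e(1) assms(1) by (simp add: star_mult E_star star_closed m_assoc)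
  finally have "star b \<otimes>\<^bsub>R\<^esub> C l T S \<in> cell_span_le K R X M C leq e l"
    using corner_C[OF assms(2,4,3) e(1) star_closed[OF assms(1)]] by simp
  then show "(m, l) \<in> leq e"
    by (rule cf_span_le[of _ _ _ m W U]) (use assms ne in \<open>simp_all add: cf_C_mult_eq\<close>)
  have "b \<otimes>\<^bsub>R\<^esub> e = b"
    using e(2) E_idem[OF e(1)] ec assms(1) by (metis m_assoc m_closed)
  then have "C l S T \<otimes>\<^bsub>R\<^esub> b = C l S T \<otimes>\<^bsub>R\<^esub> b \<otimes>\<^bsub>R\<^esub> e"
    using ec assms(1-4) by (simp add: m_assoc)
  then show "eps m W = e"
    using ne cf_mult_eps[OF assms(5-7) e(1), of "C l S T \<otimes>\<^bsub>R\<^esub> b"] assms(1-4) by (auto split: if_splits)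
qed

text \<open>A contribution through a cell m has m below l and l below m in the order of e. Hence m =
  l, and the coefficient splits into a left and a right action.\<close>

lemma cf_mult_C_mult:
  assumes ab: "a \<in> carrier R" "b \<in> carrier R" and l: "l \<in> X" "S \<in> M l" "T \<in> M l" "S' \<in> M l" "T' \<in> M l"
    and e: "e \<in> E" "e \<otimes>\<^bsub>R\<^esub> b \<otimes>\<^bsub>R\<^esub> e = b"
  shows "cf l S' T' (a \<otimes>\<^bsub>R\<^esub> C l S T \<otimes>\<^bsub>R\<^esub> b) = act a l S' S \<otimes>\<^bsub>K\<^esub> act (star b) l T' T"
proof -
  have "cf l S' T' (a \<otimes>\<^bsub>R\<^esub> (C l S T \<otimes>\<^bsub>R\<^esub> b))
      = cf l S T' (C l S T \<otimes>\<^bsub>R\<^esub> b) \<otimes>\<^bsub>K\<^esub> cf l S' T' (a \<otimes>\<^bsub>R\<^esub> C l S T')"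
  proof (rule form_single[OF form_mult_left[OF cf_form]])
    fix m U W assume m: "m \<in> X" "U \<in> M m" "W \<in> M m" "cf m U W (C l S T \<otimes>\<^bsub>R\<^esub> b) \<noteq> \<zero>\<^bsub>K\<^esub>"
      "cf l S' T' (a \<otimes>\<^bsub>R\<^esub> C m U W) \<noteq> \<zero>\<^bsub>K\<^esub>"
    have 1: "(m, l) \<in> leq e" "eps m W = e" "m = l \<Longrightarrow> U = S"
      using cf_C_mult_corner_nonzero[OF ab(2) l(1-3) m(1-3) e m(4)]
        cf_C_mult_nonzero(3)[OF ab(2) l(1-3) m(1-4)] by auto
    have 2: "(l, m) \<in> leq (eps m W)" "l = m \<Longrightarrow> T' = W"
      using cf_mult_C_nonzero[OF ab(1) m(1-3) l(1,4,5) m(5)] by auto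
    have "m = l" using 1 2 leq_antisym[OF e(1)] by simp
    then show "m = l \<and> U = S \<and> W = T'" using 1 2 by simp
  qed (use ab l in auto)
  then show ?thesis
    using ab l by (simp add: m_assoc cf_C_mult cf_mult_C star_closed R.m_comm)
qed

text \<open>The corner bound for b and the bound for left multiplication by a refer to the same
  order, so they compose.\<close>

lemma cf_mult_C_mult_nonzero:
  assumes ab: "a \<in> carrier R" "b \<in> carrier R" and l: "l \<in> X" "S \<in> M l" "T \<in> M l"
    and m: "m \<in> X" "U \<in> M m" "W \<in> M m"
    and e: "e \<in> E" "e \<otimes>\<^bsub>R\<^esub> b \<otimes>\<^bsub>R\<^esub> e = b" and ne: "cf m U W (a \<otimes>\<^bsub>R\<^esub> C l S T \<otimes>\<^bsub>R\<^esub> b) \<noteq> \<zero>\<^bsub>K\<^esub>"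
  shows "(m, l) \<in> leq e"
proof -
  have "cf m U W (a \<otimes>\<^bsub>R\<^esub> (C l S T \<otimes>\<^bsub>R\<^esub> b)) \<noteq> \<zero>\<^bsub>K\<^esub>" using ne ab l by (simp add: m_assoc)
  moreover have "C l S T \<otimes>\<^bsub>R\<^esub> b \<in> carrier R" using ab l by simp
  ultimately obtain n A B where n: "n \<in> X" "A \<in> M n" "B \<in> M n" "cf n A B (C l S T \<otimes>\<^bsub>R\<^esub> b) \<noteq> \<zero>\<^bsub>K\<^esub>"
    "cf m U W (a \<otimes>\<^bsub>R\<^esub> C n A B) \<noteq> \<zero>\<^bsub>K\<^esub>"
    using form_nonzeroE[OF form_mult_left[OF cf_form[OF m] ab(1)]] by blast
  have "(n, l) \<in> leq e" "eps n B = e"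
    using cf_C_mult_corner_nonzero[OF ab(2) l n(1-3) e n(4)] by auto
  moreover have "(m, n) \<in> leq (eps n B)"
    using cf_mult_C_nonzero[OF ab(1) n(1-3) m n(5)] by auto
  ultimately show ?thesis using leq_trans[OF e(1)] by simp
qed

definition acts :: "'x \<Rightarrow> 'a \<Rightarrow> bool" where
  "acts l a \<longleftrightarrow> l \<in> X \<and> (\<exists>S\<in>M l. \<exists>S'\<in>M l. act a l S' S \<noteq> \<zero>\<^bsub>K\<^esub>)"

text \<open>A non-zero entry for the product is traced back to one basis element of b C. Its cell is
  both below and above l in the order of \<open>eps l S\<close>, hence equal to l, and both factors
  have a non-zero entry there.\<close>

lemma acts_mult:
  assumes "acts l (a \<otimes>\<^bsub>R\<^esub> b)" "a \<in> carrier R" "b \<in> carrier R"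
  shows "acts l a" "acts l b"
proof -
  obtain S S' where S: "l \<in> X" "S \<in> M l" "S' \<in> M l" "act (a \<otimes>\<^bsub>R\<^esub> b) l S' S \<noteq> \<zero>\<^bsub>K\<^esub>"
    using assms(1) by (auto simp: acts_def)
  then have "cf l S' S (a \<otimes>\<^bsub>R\<^esub> (b \<otimes>\<^bsub>R\<^esub> C l S S)) \<noteq> \<zero>\<^bsub>K\<^esub>"
    using assms(2,3) cf_mult_C[of "a \<otimes>\<^bsub>R\<^esub> b" l S S S' S] by (simp add: m_assoc)
  moreover have "b \<otimes>\<^bsub>R\<^esub> C l S S \<in> carrier R" using assms(3) S by simp
  ultimately obtain m U W where m: "m \<in> X" "U \<in> M m" "W \<in> M m" "cf m U W (b \<otimes>\<^bsub>R\<^esub> C l S S) \<noteq> \<zero>\<^bsub>K\<^esub>"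
    "cf l S' S (a \<otimes>\<^bsub>R\<^esub> C m U W) \<noteq> \<zero>\<^bsub>K\<^esub>"
    using form_nonzeroE[OF form_mult_left[OF cf_form[OF S(1,3,2)] assms(2)]] by blast
  have 1: "(m, l) \<in> leq (eps l S)" "eps m W = eps l S" "m = l \<Longrightarrow> W = S"
    using cf_mult_C_nonzero[OF assms(3) S(1,2,2) m(1-4)] by auto
  have 2: "(l, m) \<in> leq (eps m W)"
    using cf_mult_C_nonzero[OF assms(2) m(1-3) S(1,3,2) m(5)] by auto
  have ml: "m = l" using 1 2 leq_antisym eps_in_E[OF S(1,2)] by auto
  with 1 have "W = S" by simp
  then have "act b l U S \<noteq> \<zero>\<^bsub>K\<^esub>" "act a l S' U \<noteq> \<zero>\<^bsub>K\<^esub>"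
    using m ml S assms by (simp_all add: cf_mult_C)
  then show "acts l a" "acts l b" using S m ml by (auto simp: acts_def)
qed

end

section \<open>Characters of relative cellular algebras\<close>

locale cell_character = finite_cell_datum K R X M C star E leq eps
  for K :: "('k, 'm) ring_scheme" and R :: "('k, 'a, 'n) module_scheme"
    and X :: "'x set" and M :: "'x \<Rightarrow> 's set" and C star E leq eps +
  fixes h :: "'a \<Rightarrow> 'k"
  assumes character: "character h"
begin

lemmas h_form = characterD(1)[OF character]
lemmas h_one = characterD(2)[OF character]
lemmas h_mult = characterD(3)[OF character]
lemmas h_closed [simp, intro] = characterD(4)[OF character]

lemma h_idem:
  assumes "e \<in> E" "h e \<noteq> \<zero>\<^bsub>K\<^esub>"
  shows "h e = \<one>\<^bsub>K\<^esub>"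
proof (rule one_if_idem)
  have e: "e \<in> carrier R" using assms(1) E_closed by auto
  then show "h e \<otimes>\<^bsub>K\<^esub> h e = h e" using h_mult[OF e e] E_idem[OF assms(1)] by simp
qed (use assms E_closed in auto)

text \<open>The idempotents of the two indices fix the basis element from the left and from the
  right, so the multiplicative h cannot vanish on them.\<close>

lemma h_C_nonzero:
  assumes "l \<in> X" "S \<in> M l" "T \<in> M l" "h (C l S T) \<noteq> \<zero>\<^bsub>K\<^esub>"
  shows "h (eps l S) = \<one>\<^bsub>K\<^esub>" "h (eps l T) = \<one>\<^bsub>K\<^esub>"
proof -
  have "h (eps l S) \<otimes>\<^bsub>K\<^esub> h (C l S T) = h (C l S T)" "h (C l S T) \<otimes>\<^bsub>K\<^esub> h (eps l T) = h (C l S T)"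
    using assms(1-3) eps_C[OF assms(1-3) eps_in_E[OF assms(1,2)]]
      C_eps[OF assms(1-3) eps_in_E[OF assms(1,3)]] by (simp_all add: h_mult[symmetric])
  then have "h (eps l S) \<noteq> \<zero>\<^bsub>K\<^esub>" "h (eps l T) \<noteq> \<zero>\<^bsub>K\<^esub>" using assms by auto
  then show "h (eps l S) = \<one>\<^bsub>K\<^esub>" "h (eps l T) = \<one>\<^bsub>K\<^esub>" using h_idem eps_in_E assms by auto
qed

lemma ex_h_C: "\<exists>l\<in>X. \<exists>S\<in>M l. \<exists>T\<in>M l. h (C l S T) \<noteq> \<zero>\<^bsub>K\<^esub>"
proof -
  have "h \<one>\<^bsub>R\<^esub> \<noteq> \<zero>\<^bsub>K\<^esub>" by (simp add: h_one)
  then show ?thesis using form_nonzeroE[OF h_form one_closed] by blast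
qed

text \<open>A character is non-zero on exactly one member of \<open>E\<close>: orthogonality
  excludes two, and expanding the unit element in the cell basis yields one. Its order is the one in
  which a minimal cell for h is chosen.\<close>

definition idem :: 'a where "idem = (SOME e. e \<in> E \<and> h e = \<one>\<^bsub>K\<^esub>)"

lemma idem: "idem \<in> E" "h idem = \<one>\<^bsub>K\<^esub>"
proof -
  have "\<exists>e. e \<in> E \<and> h e = \<one>\<^bsub>K\<^esub>"
    using ex_h_C h_C_nonzero(1) eps_in_E by blast
  then have "idem \<in> E \<and> h idem = \<one>\<^bsub>K\<^esub>" unfolding idem_def by (rule someI_ex)
  then show "idem \<in> E" "h idem = \<one>\<^bsub>K\<^esub>" by auto
qed

lemma idem_closed [simp]: "idem \<in> carrier R"
  using idem(1) E_closed by auto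

lemma idem_unique:
  assumes "e \<in> E" "h e = \<one>\<^bsub>K\<^esub>"
  shows "e = idem"
proof (rule ccontr)
  assume "e \<noteq> idem"
  then have "e \<otimes>\<^bsub>R\<^esub> idem = \<zero>\<^bsub>R\<^esub>" using E_orth assms(1) idem(1) by blast
  then have "h e \<otimes>\<^bsub>K\<^esub> h idem = \<zero>\<^bsub>K\<^esub>"
    using h_mult[of e idem] assms(1) E_closed linear_form_zero[OF h_form] by auto
  then show False using assms(2) idem(2) by simp
qed

lemma eps_idem:
  assumes "l \<in> X" "S \<in> M l" "T \<in> M l" "h (C l S T) \<noteq> \<zero>\<^bsub>K\<^esub>"
  shows "eps l S = idem" "eps l T = idem"
  using h_C_nonzero[OF assms] eps_in_E assms idem_unique by auto

text \<open>The simple module given by \<^term>\<open>h\<close> is the head of the cell module of this cell.\<close>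

definition top_cell :: 'x where
  "top_cell = (SOME l. l \<in> X \<and> (\<exists>S\<in>M l. \<exists>T\<in>M l. h (C l S T) \<noteq> \<zero>\<^bsub>K\<^esub>) \<and>
    (\<forall>m\<in>X. \<forall>S\<in>M m. \<forall>T\<in>M m. (m, l) \<in> leq idem \<longrightarrow> h (C m S T) \<noteq> \<zero>\<^bsub>K\<^esub> \<longrightarrow> m = l))"

lemma top_cell:
  shows "top_cell \<in> X" "\<exists>S\<in>M top_cell. \<exists>T\<in>M top_cell. h (C top_cell S T) \<noteq> \<zero>\<^bsub>K\<^esub>"
    and "\<lbrakk>m \<in> X; S \<in> M m; T \<in> M m; (m, top_cell) \<in> leq idem; h (C m S T) \<noteq> \<zero>\<^bsub>K\<^esub>\<rbrakk> \<Longrightarrow> m = top_cell"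
proof -
  let ?A = "{l \<in> X. \<exists>S\<in>M l. \<exists>T\<in>M l. h (C l S T) \<noteq> \<zero>\<^bsub>K\<^esub>}"
  have "?A \<subseteq> fst ` (SIGMA l:X. M l \<times> M l)" by force
  then have fin: "finite ?A" using cells.finite_P finite_subset by blast
  have "?A \<noteq> {}" using ex_h_C by blast
  from partial_order_on_ex_minimal[OF order_le[OF idem(1)] fin this]
  obtain l where l: "l \<in> ?A" "\<forall>a\<in>?A. (a, l) \<in> leq idem \<longrightarrow> a = l" by blast
  let ?Q = "\<lambda>l. l \<in> X \<and> (\<exists>S\<in>M l. \<exists>T\<in>M l. h (C l S T) \<noteq> \<zero>\<^bsub>K\<^esub>) \<and>
    (\<forall>m\<in>X. \<forall>S\<in>M m. \<forall>T\<in>M m. (m, l) \<in> leq idem \<longrightarrow> h (C m S T) \<noteq> \<zero>\<^bsub>K\<^esub> \<longrightarrow> m = l)"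
  have "?Q l" using l by blast
  then have Q: "?Q top_cell" unfolding top_cell_def by (rule someI)
  show "top_cell \<in> X" using Q by (rule conjunct1)
  show "\<exists>S\<in>M top_cell. \<exists>T\<in>M top_cell. h (C top_cell S T) \<noteq> \<zero>\<^bsub>K\<^esub>"
    using Q by (rule conjunct1[OF conjunct2])
  show "m = top_cell" if "m \<in> X" "S \<in> M m" "T \<in> M m" "(m, top_cell) \<in> leq idem" "h (C m S T) \<noteq> \<zero>\<^bsub>K\<^esub>"
    using conjunct2[OF conjunct2[OF Q]] that by blast
qed

end

section \<open>The bilinear form of a cell\<close>

context finite_cell_datum
begin

text \<open>The Graham-Lehrer form on a cell module. T also serves as outer index here; by
  \<open>cf_C_mult_C\<close> every outer index gives the same scalar.\<close>

definition gram :: "'x \<Rightarrow> 's \<Rightarrow> 's \<Rightarrow> 'k" where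
  "gram l T U = act (C l T T) l T U"

lemma gram_closed [simp]: "\<lbrakk>l \<in> X; T \<in> M l; U \<in> M l\<rbrakk> \<Longrightarrow> gram l T U \<in> carrier K"
  by (simp add: gram_def)

text \<open>Within the cell, the product is at once a left action, which preserves W, and a right
  action, which preserves S. Comparing the two readings shows that the scalar can depend on T and U
  only.\<close>

lemma cf_C_mult_C:
  assumes l: "l \<in> X" "S \<in> M l" "T \<in> M l" "U \<in> M l" "W \<in> M l" and SW: "S' \<in> M l" "W' \<in> M l"
  shows "cf l S' W' (C l S T \<otimes>\<^bsub>R\<^esub> C l U W) = (if S' = S \<and> W' = W then gram l T U else \<zero>\<^bsub>K\<^esub>)"
proof -
  have eq: "(if W'' = W0 then act (C l S0 T) l S'' U else \<zero>\<^bsub>K\<^esub>)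
      = (if S'' = S0 then act (C l W0 U) l W'' T else \<zero>\<^bsub>K\<^esub>)"
    if "S'' \<in> M l" "W'' \<in> M l" "S0 \<in> M l" "W0 \<in> M l" for S'' W'' S0 W0
  proof -
    have C: "C l S0 T \<in> carrier R" "C l U W0 \<in> carrier R" "star (C l U W0) = C l W0 U"
      using that l by (simp_all add: star_C)
    show ?thesis
      using cf_mult_C[OF C(1) l(1,4) that(4,1,2)] cf_C_mult[OF C(2) l(1) that(3) l(3) that(1,2)]
      unfolding C(3) by (rule trans[OF sym])
  qed
  show ?thesis
  proof (cases "S' = S \<and> W' = W")
    case True
    have "act (C l S T) l S U = gram l T U"
      using eq[of S T S T] eq[of T T T T] l by (simp add: gram_def)
    then show ?thesis using True l by (simp add: cf_mult_C)
  next
    case False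
    then show ?thesis
      using l SW cf_mult_C[of "C l S T" l U W S' W'] cf_C_mult[of "C l U W" l S T S' W'] by auto
  qed
qed

lemma gram_sym:
  assumes "l \<in> X" "T \<in> M l" "U \<in> M l"
  shows "gram l T U = gram l U T"
proof -
  have "cf l T T (C l T T \<otimes>\<^bsub>R\<^esub> C l U T) = cf l T T (star (C l T T \<otimes>\<^bsub>R\<^esub> C l U T))"
    using assms by (simp add: cf_star)
  also have "star (C l T T \<otimes>\<^bsub>R\<^esub> C l U T) = C l T U \<otimes>\<^bsub>R\<^esub> C l T T"
    using assms by (simp add: star_mult star_C)
  finally show ?thesis using assms by (simp add: cf_C_mult_C)
qed

end

context cell_character
begin

text \<open>Terms in lower cells disappear: where h is non-zero the right idempotent is
  \<open>idem\<close>, so the bound holds in the very order for which \<open>top_cell\<close> is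
  minimal.\<close>

lemma h_column:
  assumes a: "a \<in> carrier R" and S: "S \<in> M top_cell" "T \<in> M top_cell"
  shows "h (a \<otimes>\<^bsub>R\<^esub> C top_cell S T)
    = (\<Oplus>\<^bsub>K\<^esub>U\<in>M top_cell. act a top_cell U S \<otimes>\<^bsub>K\<^esub> h (C top_cell U T))"
proof -
  have "h (a \<otimes>\<^bsub>R\<^esub> C top_cell S T)
    = (\<Oplus>\<^bsub>K\<^esub>U\<in>M top_cell. cf top_cell U T (a \<otimes>\<^bsub>R\<^esub> C top_cell S T) \<otimes>\<^bsub>K\<^esub> h (C top_cell U T))"
  proof (rule form_column[OF h_form _ top_cell(1) S(2)])
    fix m U W assume m: "m \<in> X" "U \<in> M m" "W \<in> M m"
      "cf m U W (a \<otimes>\<^bsub>R\<^esub> C top_cell S T) \<noteq> \<zero>\<^bsub>K\<^esub>" "h (C m U W) \<noteq> \<zero>\<^bsub>K\<^esub>"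
    have 1: "(m, top_cell) \<in> leq (eps top_cell T)" "eps m W = eps top_cell T" "m = top_cell \<Longrightarrow> W = T"
      using cf_mult_C_nonzero[OF a top_cell(1) S m(1-4)] by auto
    have "eps m W = idem" using eps_idem[OF m(1-3,5)] by simp
    then have "m = top_cell" using 1 top_cell(3)[OF m(1-3) _ m(5)] by simp
    then show "m = top_cell \<and> W = T" using 1 by simp
  qed (use a S top_cell(1) in simp)
  also have "\<dots> = (\<Oplus>\<^bsub>K\<^esub>U\<in>M top_cell. act a top_cell U S \<otimes>\<^bsub>K\<^esub> h (C top_cell U T))"
    by (rule R.finsum_cong') (use a S top_cell(1) in \<open>auto simp: cf_mult_C\<close>)
  finally show ?thesis .
qed

lemma h_C_mult_C:
  assumes "S \<in> M top_cell" "T \<in> M top_cell" "U \<in> M top_cell" "W \<in> M top_cell"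
  shows "h (C top_cell S T) \<otimes>\<^bsub>K\<^esub> h (C top_cell U W) = gram top_cell T U \<otimes>\<^bsub>K\<^esub> h (C top_cell S W)"
proof -
  note l = top_cell(1)
  have "h (C top_cell S T \<otimes>\<^bsub>R\<^esub> C top_cell U W)
    = cf top_cell S W (C top_cell S T \<otimes>\<^bsub>R\<^esub> C top_cell U W) \<otimes>\<^bsub>K\<^esub> h (C top_cell S W)"
  proof (rule form_single[OF h_form _ l assms(1,4)])
    fix m A B assume m: "m \<in> X" "A \<in> M m" "B \<in> M m"
      "cf m A B (C top_cell S T \<otimes>\<^bsub>R\<^esub> C top_cell U W) \<noteq> \<zero>\<^bsub>K\<^esub>" "h (C m A B) \<noteq> \<zero>\<^bsub>K\<^esub>"
    have 1: "(m, top_cell) \<in> leq (eps top_cell W)" "eps m B = eps top_cell W"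
      using cf_mult_C_nonzero[OF C_closed[OF l assms(1,2)] l assms(3,4) m(1-4)] by auto
    have "eps m B = idem" using eps_idem[OF m(1-3,5)] by simp
    then have "m = top_cell" using 1 top_cell(3)[OF m(1-3) _ m(5)] by simp
    then show "m = top_cell \<and> A = S \<and> B = W"
      using m cf_C_mult_C[OF l assms, of A B] by (auto split: if_splits)
  qed (use l assms in simp)
  then show ?thesis using l assms by (simp add: h_mult cf_C_mult_C)
qed

text \<open>If h(C_ST) is non-zero, the product rule yields \<open>gram\<close> at (T, S) equal to
  h(C_ST), and then h(C_SS) h(C_TT) = h(C_ST)^2 by symmetry of the form.\<close>

lemma ex_diagonal: "\<exists>S\<in>M top_cell. h (C top_cell S S) \<noteq> \<zero>\<^bsub>K\<^esub>"
proof -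
  note l = top_cell(1)
  obtain S T where S: "S \<in> M top_cell" "T \<in> M top_cell" "h (C top_cell S T) \<noteq> \<zero>\<^bsub>K\<^esub>"
    using top_cell(2) by blast
  have "gram top_cell T S = h (C top_cell S T)"
    using K_cancel[of "h (C top_cell S T)" "h (C top_cell S T)" "gram top_cell T S"]
      h_C_mult_C[OF S(1,2,1,2)] S l by simp
  then have "h (C top_cell S S) \<otimes>\<^bsub>K\<^esub> h (C top_cell T T) = h (C top_cell S T) \<otimes>\<^bsub>K\<^esub> h (C top_cell S T)"
    using h_C_mult_C[OF S(1,1,2,2)] gram_sym[OF l S(1,2)] by simp
  then have "h (C top_cell S S) \<noteq> \<zero>\<^bsub>K\<^esub>"
    using S l integral_iff[of "h (C top_cell S T)" "h (C top_cell S T)"] by auto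
  then show ?thesis using S by blast
qed

text \<open>Fix Z with h(C_ZZ) non-zero, compare products whose indices pass through Z, and cancel
  h(C_ZZ). Together with \<open>h_C_mult_C\<close> this says that the form has rank one.\<close>

lemma h_C:
  assumes "T \<in> M top_cell" "U \<in> M top_cell"
  shows "h (C top_cell T U) = gram top_cell T U"
proof -
  note l = top_cell(1)
  let ?h = "\<lambda>T U. h (C top_cell T U)" and ?g = "gram top_cell"
  obtain Z where Z: "Z \<in> M top_cell" "?h Z Z \<noteq> \<zero>\<^bsub>K\<^esub>" using ex_diagonal by blast
  have hc: "?h A B \<in> carrier K" if "A \<in> M top_cell" "B \<in> M top_cell" for A B using that l by simp
  have gc: "?g A B \<in> carrier K" if "A \<in> M top_cell" "B \<in> M top_cell" for A B using that l by simp
  have col: "?h A Z = ?g Z A" if A: "A \<in> M top_cell" for A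
  proof (rule K_cancel[where z = "?h Z Z"])
    show "?h A Z \<otimes>\<^bsub>K\<^esub> ?h Z Z = ?g Z A \<otimes>\<^bsub>K\<^esub> ?h Z Z"
      using h_C_mult_C[of Z Z A Z] A Z hc by (simp add: R.m_comm)
  qed (use A Z hc gc in auto)
  have row: "?h Z A = ?g A Z" if A: "A \<in> M top_cell" for A
  proof (rule K_cancel[where z = "?h Z Z"])
    show "?h Z A \<otimes>\<^bsub>K\<^esub> ?h Z Z = ?g A Z \<otimes>\<^bsub>K\<^esub> ?h Z Z"
      using h_C_mult_C[of Z A Z Z] A Z by simp
  qed (use A Z hc gc in auto)
  show ?thesis
  proof (rule K_cancel[where z = "?h Z Z"])
    have "?h T U \<otimes>\<^bsub>K\<^esub> ?h Z Z = ?g U Z \<otimes>\<^bsub>K\<^esub> ?h T Z" by (rule h_C_mult_C[OF assms Z(1) Z(1)])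
    also have "\<dots> = ?h Z T \<otimes>\<^bsub>K\<^esub> ?h U Z"
      using col row gram_sym[OF l] assms Z gc by (simp add: R.m_comm)
    also have "\<dots> = ?g T U \<otimes>\<^bsub>K\<^esub> ?h Z Z" by (rule h_C_mult_C[OF Z(1) assms Z(1)])
    finally show "?h T U \<otimes>\<^bsub>K\<^esub> ?h Z Z = ?g T U \<otimes>\<^bsub>K\<^esub> ?h Z Z" .
  qed (use assms Z hc gc in auto)
qed

text \<open>Pairing with T is a module homomorphism from the cell module to the one-dimensional
  module given by h.\<close>

lemma h_expand:
  assumes "a \<in> carrier R" "S \<in> M top_cell" "T \<in> M top_cell"
  shows "h a \<otimes>\<^bsub>K\<^esub> gram top_cell S T
    = (\<Oplus>\<^bsub>K\<^esub>U\<in>M top_cell. act a top_cell U S \<otimes>\<^bsub>K\<^esub> gram top_cell U T)"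
proof -
  have "h a \<otimes>\<^bsub>K\<^esub> gram top_cell S T = h (a \<otimes>\<^bsub>R\<^esub> C top_cell S T)"
    using assms top_cell(1) by (simp add: h_mult h_C)
  also have "\<dots> = (\<Oplus>\<^bsub>K\<^esub>U\<in>M top_cell. act a top_cell U S \<otimes>\<^bsub>K\<^esub> gram top_cell U T)"
    unfolding h_column[OF assms]
    by (rule R.finsum_cong') (use assms top_cell(1) in \<open>auto simp: h_C\<close>)
  finally show ?thesis .
qed

lemma ex_gram_diagonal: "\<exists>S\<in>M top_cell. gram top_cell S S \<noteq> \<zero>\<^bsub>K\<^esub>"
  using ex_diagonal h_C by metis

lemma acts_top_cell:
  assumes "a \<in> carrier R" "h a \<noteq> \<zero>\<^bsub>K\<^esub>"
  shows "acts top_cell a"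
proof (rule ccontr)
  assume no: "\<not> acts top_cell a"
  obtain S where S: "S \<in> M top_cell" "gram top_cell S S \<noteq> \<zero>\<^bsub>K\<^esub>" using ex_gram_diagonal by blast
  have "h a \<otimes>\<^bsub>K\<^esub> gram top_cell S S = (\<Oplus>\<^bsub>K\<^esub>U\<in>M top_cell. \<zero>\<^bsub>K\<^esub>)"
    unfolding h_expand[OF assms(1) S(1,1)]
    by (rule R.finsum_cong') (use no S top_cell(1) in \<open>auto simp: acts_def\<close>)
  then have "h a \<otimes>\<^bsub>K\<^esub> gram top_cell S S = \<zero>\<^bsub>K\<^esub>" by simp
  from integral[OF this] show False using assms S top_cell(1) by auto
qed

text \<open>On the cell module, \<open>C top_cell S Z\<close> sends U to S times the value of the
  form at (Z, U). As pairing with Z is compatible with h, the factor y contributes only the scalar h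
  y.\<close>

lemma act_through_top_cell:
  assumes x: "x \<in> carrier R" and y: "y \<in> carrier R"
    and S: "S \<in> M top_cell" "S' \<in> M top_cell" "Z \<in> M top_cell"
  shows "act (x \<otimes>\<^bsub>R\<^esub> C top_cell S Z \<otimes>\<^bsub>R\<^esub> y) top_cell S' Z
    = act x top_cell S' S \<otimes>\<^bsub>K\<^esub> (h y \<otimes>\<^bsub>K\<^esub> gram top_cell Z Z)"
proof -
  note l = top_cell(1)
  let ?l = top_cell
  let ?f = "\<lambda>w. cf ?l S' Z (x \<otimes>\<^bsub>R\<^esub> C ?l S Z \<otimes>\<^bsub>R\<^esub> w)"
  have xC: "x \<otimes>\<^bsub>R\<^esub> C ?l S Z \<in> carrier R" using x l S by simp
  have f: "linear_form ?f" by (rule form_mult_left[OF cf_form[OF l S(2,3)] xC])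
  \<comment> \<open>Terms of the inner product in lower cells cannot reach the top cell again under
    x, by antisymmetry of the order of \<open>eps ?l Z\<close>.\<close>
  have fC: "?f (C ?l U Z) = gram ?l Z U \<otimes>\<^bsub>K\<^esub> act x ?l S' S" if U: "U \<in> M ?l" for U
  proof -
    have "cf ?l S' Z (x \<otimes>\<^bsub>R\<^esub> (C ?l S Z \<otimes>\<^bsub>R\<^esub> C ?l U Z))
        = cf ?l S Z (C ?l S Z \<otimes>\<^bsub>R\<^esub> C ?l U Z) \<otimes>\<^bsub>K\<^esub> cf ?l S' Z (x \<otimes>\<^bsub>R\<^esub> C ?l S Z)"
    proof (rule form_single[OF form_mult_left[OF cf_form[OF l S(2,3)] x]])
      fix m A B assume m: "m \<in> X" "A \<in> M m" "B \<in> M m"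
        "cf m A B (C ?l S Z \<otimes>\<^bsub>R\<^esub> C ?l U Z) \<noteq> \<zero>\<^bsub>K\<^esub>" "cf ?l S' Z (x \<otimes>\<^bsub>R\<^esub> C m A B) \<noteq> \<zero>\<^bsub>K\<^esub>"
      have 1: "(m, ?l) \<in> leq (eps ?l Z)" "eps m B = eps ?l Z"
        using cf_mult_C_nonzero[OF C_closed[OF l S(1,3)] l U S(3) m(1-4)] by auto
      have "(?l, m) \<in> leq (eps m B)"
        using cf_mult_C_nonzero[OF x m(1-3) l S(2,3) m(5)] by auto
      then have "m = ?l" using 1 leq_antisym eps_in_E[OF l S(3)] by auto
      then show "m = ?l \<and> A = S \<and> B = Z"
        using m cf_C_mult_C[OF l S(1,3) U S(3), of A B] by (auto split: if_splits)
    qed (use l S U in auto)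
    moreover have "cf ?l S Z (C ?l S Z \<otimes>\<^bsub>R\<^esub> C ?l U Z) = gram ?l Z U"
      using cf_C_mult_C[OF l S(1,3) U S(3) S(1,3)] by simp
    moreover have "cf ?l S' Z (x \<otimes>\<^bsub>R\<^esub> C ?l S Z) = act x ?l S' S"
      using cf_mult_C[OF x l S(1,3,2,3)] by simp
    moreover have "x \<otimes>\<^bsub>R\<^esub> C ?l S Z \<otimes>\<^bsub>R\<^esub> C ?l U Z = x \<otimes>\<^bsub>R\<^esub> (C ?l S Z \<otimes>\<^bsub>R\<^esub> C ?l U Z)"
      using x l S U by (intro m_assoc) auto
    ultimately show ?thesis by simp
  qed
  have "act (x \<otimes>\<^bsub>R\<^esub> C ?l S Z \<otimes>\<^bsub>R\<^esub> y) ?l S' Z = ?f (y \<otimes>\<^bsub>R\<^esub> C ?l Z Z)"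
  proof -
    have "x \<otimes>\<^bsub>R\<^esub> C ?l S Z \<otimes>\<^bsub>R\<^esub> y \<otimes>\<^bsub>R\<^esub> C ?l Z Z = x \<otimes>\<^bsub>R\<^esub> C ?l S Z \<otimes>\<^bsub>R\<^esub> (y \<otimes>\<^bsub>R\<^esub> C ?l Z Z)"
      using xC y l S by (intro m_assoc) auto
    then show ?thesis
      using cf_mult_C[OF m_closed[OF xC y] l S(3,3,2,3)] by simp
  qed
  also have "\<dots> = (\<Oplus>\<^bsub>K\<^esub>U\<in>M ?l. cf ?l U Z (y \<otimes>\<^bsub>R\<^esub> C ?l Z Z) \<otimes>\<^bsub>K\<^esub> ?f (C ?l U Z))"
  proof (rule form_column[OF f _ l S(3)])
    fix m A B assume m: "m \<in> X" "A \<in> M m" "B \<in> M m"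
      "cf m A B (y \<otimes>\<^bsub>R\<^esub> C ?l Z Z) \<noteq> \<zero>\<^bsub>K\<^esub>" "?f (C m A B) \<noteq> \<zero>\<^bsub>K\<^esub>"
    have 1: "(m, ?l) \<in> leq (eps ?l Z)" "eps m B = eps ?l Z" "m = ?l \<Longrightarrow> B = Z"
      using cf_mult_C_nonzero[OF y l S(3,3) m(1-4)] by auto
    have "(?l, m) \<in> leq (eps m B)"
      using cf_mult_C_nonzero[OF xC m(1-3) l S(2,3) m(5)] by auto
    then have "m = ?l" using 1 leq_antisym eps_in_E[OF l S(3)] by auto
    then show "m = ?l \<and> B = Z" using 1 by simp
  qed (use y l S in simp)
  also have "\<dots> = (\<Oplus>\<^bsub>K\<^esub>U\<in>M ?l. act x ?l S' S \<otimes>\<^bsub>K\<^esub> (act y ?l U Z \<otimes>\<^bsub>K\<^esub> gram ?l U Z))"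
  proof (rule R.finsum_cong')
    fix U assume U: "U \<in> M ?l"
    have "gram ?l Z U = gram ?l U Z" by (rule gram_sym[OF l S(3) U])
    moreover have "act y ?l U Z \<in> carrier K" "act x ?l S' S \<in> carrier K" "gram ?l U Z \<in> carrier K"
      using x y l S U by auto
    moreover have "cf ?l U Z (y \<otimes>\<^bsub>R\<^esub> C ?l Z Z) = act y ?l U Z"
      using cf_mult_C[OF y l S(3,3) U S(3)] by simp
    ultimately show "cf ?l U Z (y \<otimes>\<^bsub>R\<^esub> C ?l Z Z) \<otimes>\<^bsub>K\<^esub> ?f (C ?l U Z)
        = act x ?l S' S \<otimes>\<^bsub>K\<^esub> (act y ?l U Z \<otimes>\<^bsub>K\<^esub> gram ?l U Z)"
      unfolding fC[OF U] by (simp add: R.m_ac)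
  qed (use x y l S in auto)
  also have "\<dots> = act x ?l S' S \<otimes>\<^bsub>K\<^esub> (\<Oplus>\<^bsub>K\<^esub>U\<in>M ?l. act y ?l U Z \<otimes>\<^bsub>K\<^esub> gram ?l U Z)"
    by (rule R.finsum_rdistr[symmetric]) (use x y l S finite_M in auto)
  also have "\<dots> = act x ?l S' S \<otimes>\<^bsub>K\<^esub> (h y \<otimes>\<^bsub>K\<^esub> gram ?l Z Z)"
    by (simp only: h_expand[OF y S(3,3)])
  finally show ?thesis .
qed

end

context finite_cell_datum
begin

text \<open>\<open>h_expand\<close> at an S with non-zero diagonal value expresses the character
  through action matrices and the form, and these depend on the cell alone.\<close>

lemma top_cell_inj:
  assumes "character f" "character g"
    and "cell_character.top_cell K X M C E leq f = cell_character.top_cell K X M C E leq g"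
    and a: "a \<in> carrier R"
  shows "f a = g a"
proof -
  interpret f: cell_character K R X M C star E leq eps f by standard (rule assms(1))
  interpret g: cell_character K R X M C star E leq eps g by standard (rule assms(2))
  have eq: "f.top_cell = g.top_cell" using assms(3) by simp
  obtain S where S: "S \<in> M f.top_cell" "gram f.top_cell S S \<noteq> \<zero>\<^bsub>K\<^esub>" using f.ex_gram_diagonal by blast
  have "f a \<otimes>\<^bsub>K\<^esub> gram f.top_cell S S = g a \<otimes>\<^bsub>K\<^esub> gram f.top_cell S S"
    using f.h_expand[OF a S(1,1)] g.h_expand[of a S S] a S eq by simp
  then show ?thesis
    by (rule K_cancel[OF _ _ _ _ S(2)]) (use S f.top_cell(1) a in auto)
qed

end

section \<open>Relative cellular zigzag algebras come from lines\<close>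

context cell_character
begin

text \<open>The scalar h(star(a C_SS)) is computed twice. Reversing the product gives h(star a)
  times the diagonal value of the form; expanding a C_SS along its column gives h a times the same
  value, by \<open>h_expand\<close> and symmetry of the form.\<close>

lemma h_star:
  assumes a: "a \<in> carrier R"
  shows "h (star a) = h a"
proof -
  note l = top_cell(1)
  obtain S where S: "S \<in> M top_cell" "gram top_cell S S \<noteq> \<zero>\<^bsub>K\<^esub>" using ex_gram_diagonal by blast
  have "h (star (a \<otimes>\<^bsub>R\<^esub> C top_cell S S)) = gram top_cell S S \<otimes>\<^bsub>K\<^esub> h (star a)"
    using a l S by (simp add: star_mult star_C h_mult star_closed h_C)
  moreover have "h (star (a \<otimes>\<^bsub>R\<^esub> C top_cell S S))
    = (\<Oplus>\<^bsub>K\<^esub>U\<in>M top_cell. cf top_cell U S (a \<otimes>\<^bsub>R\<^esub> C top_cell S S) \<otimes>\<^bsub>K\<^esub> h (star (C top_cell U S)))"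
  proof (rule form_column[OF form_star[OF h_form] _ l S(1)])
    fix m U W assume m: "m \<in> X" "U \<in> M m" "W \<in> M m"
      "cf m U W (a \<otimes>\<^bsub>R\<^esub> C top_cell S S) \<noteq> \<zero>\<^bsub>K\<^esub>" "h (star (C m U W)) \<noteq> \<zero>\<^bsub>K\<^esub>"
    have m5: "h (C m W U) \<noteq> \<zero>\<^bsub>K\<^esub>" using m by (simp add: star_C)
    have 1: "(m, top_cell) \<in> leq (eps top_cell S)" "eps m W = eps top_cell S" "m = top_cell \<Longrightarrow> W = S"
      using cf_mult_C_nonzero[OF a l S(1,1) m(1-4)] by auto
    have "eps m W = idem" using eps_idem[OF m(1,3,2) m5] by simp
    then have "m = top_cell" using 1 top_cell(3)[OF m(1,3,2) _ m5] by simp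
    then show "m = top_cell \<and> W = S" using 1 by simp
  qed (use a S l in simp)
  moreover have "(\<Oplus>\<^bsub>K\<^esub>U\<in>M top_cell. cf top_cell U S (a \<otimes>\<^bsub>R\<^esub> C top_cell S S) \<otimes>\<^bsub>K\<^esub> h (star (C top_cell U S)))
    = (\<Oplus>\<^bsub>K\<^esub>U\<in>M top_cell. act a top_cell U S \<otimes>\<^bsub>K\<^esub> gram top_cell U S)"
  proof (rule R.finsum_cong')
    fix U assume U: "U \<in> M top_cell"
    have "cf top_cell U S (a \<otimes>\<^bsub>R\<^esub> C top_cell S S) = act a top_cell U S"
      using cf_mult_C[OF a l S(1,1) U S(1)] by simp
    moreover have "h (star (C top_cell U S)) = gram top_cell U S"
      using l S U gram_sym[OF l S(1) U] by (simp add: star_C h_C)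
    ultimately show "cf top_cell U S (a \<otimes>\<^bsub>R\<^esub> C top_cell S S) \<otimes>\<^bsub>K\<^esub> h (star (C top_cell U S))
      = act a top_cell U S \<otimes>\<^bsub>K\<^esub> gram top_cell U S" by simp
  qed (use a l S in auto)
  ultimately have "h (star a) \<otimes>\<^bsub>K\<^esub> gram top_cell S S = h a \<otimes>\<^bsub>K\<^esub> gram top_cell S S"
    using h_expand[OF a S(1,1)] a l S by (simp add: R.m_comm star_closed)
  then show ?thesis by (rule K_cancel[OF _ _ _ _ S(2)]) (use a l S in \<open>auto simp: star_closed\<close>)
qed

end

locale zigzag_cell_datum = zigzag_coordinates K R V A VC u t + relative_cell_datum K R X M C star E leq eps
  for K :: "('k, 'm) ring_scheme" and R :: "('k, 'a, 'n) module_scheme"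
    and V :: "'v set" and A VC u t
    and X :: "'x set" and M :: "'x \<Rightarrow> 's set" and C star E leq eps
begin

sublocale finite_cell_datum K R X M C star E leq eps
  by standard (rule fin_dim)

abbreviation "idem_at i \<equiv> cell_character.idem K E (u i)"
abbreviation "cell_at i \<equiv> cell_character.top_cell K X M C E leq (u i)"

lemma cell_character_u: "i \<in> V \<Longrightarrow> cell_character K R X M C star E leq eps (u i)"
  by standard (simp add: character_def u_form u_one u_mult)

lemmas idem_at = cell_character.idem[OF cell_character_u]
lemmas cell_at = cell_character.top_cell[OF cell_character_u]

lemma idem_at_closed [simp]: "i \<in> V \<Longrightarrow> idem_at i \<in> carrier R"
  using idem_at(1) E_closed by blast

lemma u_star: "\<lbrakk>i \<in> V; a \<in> carrier R\<rbrakk> \<Longrightarrow> u i (star a) = u i a"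
  by (rule cell_character.h_star[OF cell_character_u])

lemma cell_at_inj:
  assumes "i \<in> V" "j \<in> V" "cell_at i = cell_at j"
  shows "i = j"
proof (rule ccontr)
  assume "i \<noteq> j"
  moreover have "character (u i)" "character (u j)"
    using assms by (simp_all add: character_def u_form u_one u_mult)
  ultimately show False
    using top_cell_inj[of "u i" "u j" "ev i"] assms by simp
qed

lemma acts_cell_at: "i \<in> V \<Longrightarrow> acts (cell_at i) (ev i)"
  by (rule cell_character.acts_top_cell[OF cell_character_u]) auto

text \<open>By \<open>corner_unit\<close>, the idempotent \<open>ev i\<close> factors through
  b.\<close>

lemma acts_if_u_nonzero:
  assumes "acts l (ev i)" "i \<in> V" "b \<in> carrier R" "u i b \<noteq> \<zero>\<^bsub>K\<^esub>"
  shows "acts l b"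
proof -
  obtain z where z: "z \<in> carrier R" "z \<otimes>\<^bsub>R\<^esub> b \<otimes>\<^bsub>R\<^esub> ev i = ev i"
    using corner_unit[OF assms(2-4)] by blast
  then have "acts l (z \<otimes>\<^bsub>R\<^esub> b \<otimes>\<^bsub>R\<^esub> ev i)" using assms(1) by simp
  then have "acts l (z \<otimes>\<^bsub>R\<^esub> b)" by (rule acts_mult(1)) (use z assms(3) in auto)
  then show ?thesis by (rule acts_mult(2)) (use z assms(3) in auto)
qed

text \<open>The anti-involution may move \<open>ev i\<close> but keeps its residue at i by
  \<open>u_star\<close>, so the compression of \<open>star (ev i)\<close> to the corner at i is
  invertible. Applying \<open>star\<close> to the resulting identity writes
  \<open>star (ev i)\<close> as a product with a factor \<open>ev i\<close>.\<close>

lemma acts_ev_if_star: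
  assumes "acts l (star (ev i))" "i \<in> V"
  shows "acts l (ev i)"
proof -
  have s: "star (ev i) \<in> carrier R" by (simp add: star_closed)
  obtain z where z: "z \<in> carrier R" "ev i \<otimes>\<^bsub>R\<^esub> star (ev i) \<otimes>\<^bsub>R\<^esub> z = ev i"
    using corner_unit[OF assms(2) s] assms(2) by (auto simp: u_star)
  have sz: "star z \<in> carrier R" using z by (simp add: star_closed)
  have "star (ev i \<otimes>\<^bsub>R\<^esub> star (ev i) \<otimes>\<^bsub>R\<^esub> z) = star z \<otimes>\<^bsub>R\<^esub> (ev i \<otimes>\<^bsub>R\<^esub> star (ev i))"
    using z(1) s by (simp add: star_mult star_star)
  then have "star z \<otimes>\<^bsub>R\<^esub> (ev i \<otimes>\<^bsub>R\<^esub> star (ev i)) = star (ev i)" using z(2) by simp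
  then have "acts l (star z \<otimes>\<^bsub>R\<^esub> (ev i \<otimes>\<^bsub>R\<^esub> star (ev i)))" using assms(1) by simp
  then have "acts l (ev i \<otimes>\<^bsub>R\<^esub> star (ev i))" by (rule acts_mult(2)) (use sz s in auto)
  then show ?thesis by (rule acts_mult(1)) (use s in auto)
qed

text \<open>An idempotent in the corner at \<^term>\<open>idem_at i\<close> that stands in for \<^term>\<open>ev i\<close>, which need not
  lie in that corner.\<close>

lemma corner_idem:
  assumes i: "i \<in> V"
  obtains z w where "z \<in> carrier R" "w \<in> carrier R"
    "w = idem_at i \<otimes>\<^bsub>R\<^esub> z \<otimes>\<^bsub>R\<^esub> idem_at i" "z \<otimes>\<^bsub>R\<^esub> ev i = z"
    "idem_at i \<otimes>\<^bsub>R\<^esub> w \<otimes>\<^bsub>R\<^esub> idem_at i = w" "ev i \<otimes>\<^bsub>R\<^esub> idem_at i \<otimes>\<^bsub>R\<^esub> w = ev i \<otimes>\<^bsub>R\<^esub> idem_at i"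
    "\<And>l. acts l (star w) \<longleftrightarrow> acts l (ev i)"
proof -
  let ?e = "idem_at i"
  have e: "?e \<in> carrier R" "?e \<otimes>\<^bsub>R\<^esub> ?e = ?e" "star ?e = ?e"
    using i E_idem[OF idem_at(1)] E_star[OF idem_at(1)] by auto
  have ee: "?e \<otimes>\<^bsub>R\<^esub> (?e \<otimes>\<^bsub>R\<^esub> x) = ?e \<otimes>\<^bsub>R\<^esub> x" if "x \<in> carrier R" for x
    using e that by (simp add: m_assoc[symmetric])
  have ue: "u i ?e = \<one>\<^bsub>K\<^esub>" by (rule idem_at(2)[OF i])
  then have "u i ?e \<noteq> \<zero>\<^bsub>K\<^esub>" by simp
  \<comment> \<open>z inverts the compression of e to the corner at \<open>ev i\<close>. Hence z e z
    = z, and e z e is an idempotent of the corner at e.\<close>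
  then obtain z where z: "z \<in> carrier R" "ev i \<otimes>\<^bsub>R\<^esub> z = z" "z \<otimes>\<^bsub>R\<^esub> ev i = z" "ev i \<otimes>\<^bsub>R\<^esub> ?e \<otimes>\<^bsub>R\<^esub> z = ev i"
    using corner_unit[OF i e(1)] by metis
  let ?w = "?e \<otimes>\<^bsub>R\<^esub> z \<otimes>\<^bsub>R\<^esub> ?e"
  have w: "?w \<in> carrier R" using e z by simp
  have "u i (ev i \<otimes>\<^bsub>R\<^esub> ?e \<otimes>\<^bsub>R\<^esub> z) = \<one>\<^bsub>K\<^esub>" using z(4) i by simp
  then have "u i z = \<one>\<^bsub>K\<^esub>" using z(1) e(1) i ue by (simp add: u_mult)
  then have uw: "u i ?w = \<one>\<^bsub>K\<^esub>" using z(1) e(1) i ue by (simp add: u_mult)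
  have "acts l (star ?w) \<longleftrightarrow> acts l (ev i)" for l
  proof
    assume "acts l (ev i)"
    then show "acts l (star ?w)"
      by (rule acts_if_u_nonzero[OF _ i star_closed[OF w]]) (use uw i w in \<open>simp add: u_star\<close>)
  next
    have se: "star (ev i) \<in> carrier R" "star z \<in> carrier R" using z by (auto simp: star_closed)
    have "star z = star (ev i \<otimes>\<^bsub>R\<^esub> z)" using z(2) by simp
    then have sz: "star z = star z \<otimes>\<^bsub>R\<^esub> star (ev i)" using z(1) by (simp add: star_mult)
    assume "acts l (star ?w)"
    moreover have "star ?w = ?e \<otimes>\<^bsub>R\<^esub> (star z \<otimes>\<^bsub>R\<^esub> ?e)" using z(1) e by (simp add: star_mult)
    ultimately have "acts l (star z \<otimes>\<^bsub>R\<^esub> ?e)" using acts_mult(2)[of l ?e "star z \<otimes>\<^bsub>R\<^esub> ?e"] e se by simp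
    then have "acts l (star z)" using acts_mult(1) e se by blast
    then have "acts l (star z \<otimes>\<^bsub>R\<^esub> star (ev i))" using sz by simp
    then have "acts l (star (ev i))" using acts_mult(2) se by blast
    then show "acts l (ev i)" by (rule acts_ev_if_star[OF _ i])
  qed
  moreover have "?e \<otimes>\<^bsub>R\<^esub> ?w \<otimes>\<^bsub>R\<^esub> ?e = ?w" using e z(1) ee by (simp add: m_assoc)
  moreover have "ev i \<otimes>\<^bsub>R\<^esub> ?e \<otimes>\<^bsub>R\<^esub> ?w = ev i \<otimes>\<^bsub>R\<^esub> ?e"
  proof -
    have "ev i \<otimes>\<^bsub>R\<^esub> ?e \<otimes>\<^bsub>R\<^esub> ?w = (ev i \<otimes>\<^bsub>R\<^esub> ?e \<otimes>\<^bsub>R\<^esub> z) \<otimes>\<^bsub>R\<^esub> ?e" using e z(1) ee by (simp add: m_assoc)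
    then show ?thesis using z(4) by simp
  qed
  ultimately show thesis using that[OF z(1) w refl z(3)] by simp
qed

text \<open>With w in the place of \<open>ev k\<close>, the product of \<open>ev j\<close>, C_SZ,
  \<open>ev i\<close>, C_ZT and w has a non-zero coefficient in the cell: at an index Z with
  non-zero diagonal value the middle \<open>ev i\<close> contributes only its residue one. Such a
  product is a path from j through i to k.\<close>

lemma acts_cell_at_unique:
  assumes ijk: "i \<in> V" "j \<in> V" "k \<in> V" "j \<noteq> i" "k \<noteq> i"
    and ac: "acts (cell_at i) (ev j)" "acts (cell_at i) (ev k)"
  shows "j = k" "j \<notin> VC" "(i, j) \<in> A"
proof -
  let ?l = "cell_at i" and ?e = "idem_at k"
  note l = cell_at(1)[OF ijk(1)]
  obtain z w where zw: "z \<in> carrier R" "w \<in> carrier R" "w = ?e \<otimes>\<^bsub>R\<^esub> z \<otimes>\<^bsub>R\<^esub> ?e" "z \<otimes>\<^bsub>R\<^esub> ev k = z"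
    "?e \<otimes>\<^bsub>R\<^esub> w \<otimes>\<^bsub>R\<^esub> ?e = w" "acts ?l (star w)"
    using corner_idem[OF ijk(3)] ac(2) by metis
  have e: "?e \<in> carrier R" "?e \<in> E" using ijk idem_at by auto
  obtain S S' where S: "S \<in> M ?l" "S' \<in> M ?l" "act (ev j) ?l S' S \<noteq> \<zero>\<^bsub>K\<^esub>"
    using ac(1) by (auto simp: acts_def)
  obtain T T' where T: "T \<in> M ?l" "T' \<in> M ?l" "act (star w) ?l T' T \<noteq> \<zero>\<^bsub>K\<^esub>"
    using zw(6) by (auto simp: acts_def)
  obtain Z where Z: "Z \<in> M ?l" "gram ?l Z Z \<noteq> \<zero>\<^bsub>K\<^esub>"
    using cell_character.ex_gram_diagonal[OF cell_character_u[OF ijk(1)]] by blast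
  let ?a = "ev j \<otimes>\<^bsub>R\<^esub> C ?l S Z \<otimes>\<^bsub>R\<^esub> ev i"
  have C: "C ?l S Z \<in> carrier R" "C ?l Z T \<in> carrier R" using l S T Z by auto
  have a: "?a \<in> carrier R" using C by simp
  have "act ?a ?l S' Z = act (ev j) ?l S' S \<otimes>\<^bsub>K\<^esub> (u i (ev i) \<otimes>\<^bsub>K\<^esub> gram ?l Z Z)"
    by (rule cell_character.act_through_top_cell[OF cell_character_u[OF ijk(1)]]) (use S Z in auto)
  then have "act ?a ?l S' Z = act (ev j) ?l S' S \<otimes>\<^bsub>K\<^esub> gram ?l Z Z" using ijk(1) l Z by simp
  moreover have "act (ev j) ?l S' S \<in> carrier K" "gram ?l Z Z \<in> carrier K" "act (star w) ?l T' T \<in> carrier K"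
    using l S T Z zw(2) by (auto simp: star_closed)
  ultimately have "act ?a ?l S' Z \<otimes>\<^bsub>K\<^esub> act (star w) ?l T' T \<noteq> \<zero>\<^bsub>K\<^esub>"
    using S(3) Z(2) T(3) by (metis integral R.m_closed)
  then have "cf ?l S' T' (?a \<otimes>\<^bsub>R\<^esub> C ?l Z T \<otimes>\<^bsub>R\<^esub> w) \<noteq> \<zero>\<^bsub>K\<^esub>"
    using cf_mult_C_mult[OF a zw(2) l Z(1) T(1) S(2) T(2) e(2) zw(5)] by simp
  then have ne: "?a \<otimes>\<^bsub>R\<^esub> C ?l Z T \<otimes>\<^bsub>R\<^esub> w \<noteq> \<zero>\<^bsub>R\<^esub>"
    using linear_form_zero[OF cf_form[OF l S(2) T(2)]] by metis
  \<comment> \<open>Since z absorbs \<open>ev k\<close> on the right, w equals e z (ev k) e, which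
    exposes the required factor \<open>ev k\<close>.\<close>
  let ?b = "C ?l Z T \<otimes>\<^bsub>R\<^esub> (?e \<otimes>\<^bsub>R\<^esub> z)"
  have b: "?b \<in> carrier R" using C e zw by simp
  have i1: "ev i \<otimes>\<^bsub>R\<^esub> (ev i \<otimes>\<^bsub>R\<^esub> x) = ev i \<otimes>\<^bsub>R\<^esub> x" if "x \<in> carrier R" for x
    using ijk(1) that by (simp add: m_assoc[symmetric])
  have z1: "z \<otimes>\<^bsub>R\<^esub> (ev k \<otimes>\<^bsub>R\<^esub> x) = z \<otimes>\<^bsub>R\<^esub> x" if "x \<in> carrier R" for x
    using zw(1,4) that by (simp add: m_assoc[symmetric])
  have "?a \<otimes>\<^bsub>R\<^esub> C ?l Z T \<otimes>\<^bsub>R\<^esub> w = ?a \<otimes>\<^bsub>R\<^esub> (ev i \<otimes>\<^bsub>R\<^esub> ?b \<otimes>\<^bsub>R\<^esub> ev k) \<otimes>\<^bsub>R\<^esub> ?e"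
    unfolding zw(3) using C e zw(1) i1 z1 by (simp add: m_assoc)
  then have "?a \<otimes>\<^bsub>R\<^esub> (ev i \<otimes>\<^bsub>R\<^esub> ?b \<otimes>\<^bsub>R\<^esub> ev k) \<noteq> \<zero>\<^bsub>R\<^esub>" using ne e by auto
  from path_through_vertex[OF ijk C(1) b this] show "j = k" "j \<notin> VC" "(i, j) \<in> A" by auto
qed

text \<open>Take a non-zero y that is fixed by \<open>ev i\<close> on the left and by the stand-in w
  for \<open>ev j\<close> on the right. In a cell that is maximal in the support of y, a coefficient
  of (ev i) y w can come only from the same cell, so both sides act there.\<close>

lemma ex_common_cell:
  assumes ij: "(i, j) \<in> A"
  shows "\<exists>l. acts l (ev i) \<and> acts l (ev j)"
proof -
  have i: "i \<in> V" and j: "j \<in> V" using A_verts[OF ij] by auto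
  let ?e = "idem_at j"
  obtain z w where w: "w \<in> carrier R" "?e \<otimes>\<^bsub>R\<^esub> w \<otimes>\<^bsub>R\<^esub> ?e = w"
    "ev j \<otimes>\<^bsub>R\<^esub> ?e \<otimes>\<^bsub>R\<^esub> w = ev j \<otimes>\<^bsub>R\<^esub> ?e" "\<And>l. acts l (star w) \<longleftrightarrow> acts l (ev j)"
    using corner_idem[OF j] by metis
  have e: "?e \<in> carrier R" "?e \<in> E" using j idem_at by auto
  \<comment> \<open>The factor e makes the element fixed by w, because ev j e w = ev j e; the
    residue of e at j is one, so the arrow coordinate stays non-zero.\<close>
  let ?y = "ar i j \<otimes>\<^bsub>R\<^esub> ?e"
  have y: "?y \<in> carrier R" using e by simp
  have "t i j ?y = \<one>\<^bsub>K\<^esub>" using t_ar_mult[OF ij e(1)] idem_at(2)[OF j] by simp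
  then have "?y \<noteq> \<zero>\<^bsub>R\<^esub>" using linear_form_zero[OF t_form[of i j]] ij by fastforce
  have "ev i \<otimes>\<^bsub>R\<^esub> ?y = ?y" using ev_ar[OF A_D[OF ij]] e by (simp add: m_assoc[symmetric])
  moreover have "?y \<otimes>\<^bsub>R\<^esub> w = ?y"
  proof -
    have "?y \<otimes>\<^bsub>R\<^esub> w = ar i j \<otimes>\<^bsub>R\<^esub> ev j \<otimes>\<^bsub>R\<^esub> ?e \<otimes>\<^bsub>R\<^esub> w" using ar_ev[OF A_D[OF ij]] by simp
    also have "\<dots> = ar i j \<otimes>\<^bsub>R\<^esub> (ev j \<otimes>\<^bsub>R\<^esub> ?e \<otimes>\<^bsub>R\<^esub> w)" using e w by (simp add: m_assoc)
    also have "\<dots> = ar i j \<otimes>\<^bsub>R\<^esub> ev j \<otimes>\<^bsub>R\<^esub> ?e" using e by (simp add: w(3) m_assoc)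
    finally show ?thesis using ar_ev[OF A_D[OF ij]] by simp
  qed
  ultimately have ywy: "ev i \<otimes>\<^bsub>R\<^esub> (?y \<otimes>\<^bsub>R\<^esub> w) = ?y" by simp
  let ?B = "{l \<in> X. \<exists>S\<in>M l. \<exists>T\<in>M l. cf l S T ?y \<noteq> \<zero>\<^bsub>K\<^esub>}"
  have "?B \<subseteq> fst ` (SIGMA l:X. M l \<times> M l)" by force
  then have fin: "finite ?B" using cells.finite_P finite_subset by blast
  obtain m0 U0 W0 where "m0 \<in> X" "U0 \<in> M m0" "W0 \<in> M m0" "cf m0 U0 W0 ?y \<noteq> \<zero>\<^bsub>K\<^esub>"
    by (rule nonzero_cfE[OF y \<open>?y \<noteq> \<zero>\<^bsub>R\<^esub>\<close>])
  then have ne: "?B \<noteq> {}" by blast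
  \<comment> \<open>A maximal cell is a minimal one for the converse order.\<close>
  have "partial_order_on X ((leq ?e)\<inverse>)" using order_le[OF e(2)] by simp
  from partial_order_on_ex_minimal[OF this fin ne]
  obtain l where l: "l \<in> ?B" "\<forall>a\<in>?B. (l, a) \<in> leq ?e \<longrightarrow> a = l" by (auto simp only: converse_iff)
  then obtain S' T' where S': "l \<in> X" "S' \<in> M l" "T' \<in> M l" "cf l S' T' ?y \<noteq> \<zero>\<^bsub>K\<^esub>" by blast
  note f = form_mult_right[OF form_mult_left[OF cf_form[OF S'(1-3)] ev_closed[of i]] w(1)]
  have "cf l S' T' (ev i \<otimes>\<^bsub>R\<^esub> (?y \<otimes>\<^bsub>R\<^esub> w)) \<noteq> \<zero>\<^bsub>K\<^esub>" using S'(4) ywy by simp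
  then obtain m S T where m: "m \<in> X" "S \<in> M m" "T \<in> M m" "cf m S T ?y \<noteq> \<zero>\<^bsub>K\<^esub>"
    "cf l S' T' (ev i \<otimes>\<^bsub>R\<^esub> (C m S T \<otimes>\<^bsub>R\<^esub> w)) \<noteq> \<zero>\<^bsub>K\<^esub>"
    using form_nonzeroE[OF f y] by blast
  then have m5: "cf l S' T' (ev i \<otimes>\<^bsub>R\<^esub> C m S T \<otimes>\<^bsub>R\<^esub> w) \<noteq> \<zero>\<^bsub>K\<^esub>" using w(1) by (simp add: m_assoc)
  have "(l, m) \<in> leq ?e"
    by (rule cf_mult_C_mult_nonzero[OF ev_closed w(1) m(1-3) S'(1-3) e(2) w(2) m5])
  then have ml: "m = l" using l(2) m by blast
  have "act (ev i) l S' S \<otimes>\<^bsub>K\<^esub> act (star w) l T' T \<noteq> \<zero>\<^bsub>K\<^esub>"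
    using m5 cf_mult_C_mult[OF ev_closed w(1) S'(1) _ _ S'(2,3) e(2) w(2), of S T i] m ml by simp
  moreover have "act (ev i) l S' S \<in> carrier K" "act (star w) l T' T \<in> carrier K"
    using m ml S' w(1) by (auto simp: star_closed)
  ultimately have "act (ev i) l S' S \<noteq> \<zero>\<^bsub>K\<^esub>" "act (star w) l T' T \<noteq> \<zero>\<^bsub>K\<^esub>" by auto
  then have "acts l (ev i)" "acts l (star w)" using m ml S' by (auto simp: acts_def)
  then show ?thesis using w(4) by blast
qed

text \<open>The element (ev i) C_ST w has a non-zero coefficient in l, and all its left multiples
  are supported below l. So if the element belonging to another cell is a left multiple of this one,
  that cell lies below l. Writing it as (ev i) s (ev i) e allows the comparison to take place in the
  small corner at \<open>ev i\<close>.\<close>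

lemma ex_leading_element:
  assumes i: "i \<in> V" and l: "acts l (ev i)"
  shows "\<exists>s. s \<in> carrier R \<and> ev i \<otimes>\<^bsub>R\<^esub> s \<otimes>\<^bsub>R\<^esub> ev i \<noteq> \<zero>\<^bsub>R\<^esub> \<and>
    (\<exists>U\<in>M l. \<exists>W\<in>M l. cf l U W (ev i \<otimes>\<^bsub>R\<^esub> s \<otimes>\<^bsub>R\<^esub> ev i \<otimes>\<^bsub>R\<^esub> idem_at i) \<noteq> \<zero>\<^bsub>K\<^esub>) \<and>
    (\<forall>m\<in>X. \<forall>U\<in>M m. \<forall>W\<in>M m. \<forall>a\<in>carrier R.
      cf m U W (a \<otimes>\<^bsub>R\<^esub> (ev i \<otimes>\<^bsub>R\<^esub> s \<otimes>\<^bsub>R\<^esub> ev i \<otimes>\<^bsub>R\<^esub> idem_at i)) \<noteq> \<zero>\<^bsub>K\<^esub> \<longrightarrow> (m, l) \<in> leq (idem_at i))"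
proof -
  let ?e = "idem_at i"
  obtain z w where zw: "z \<in> carrier R" "w \<in> carrier R" "w = ?e \<otimes>\<^bsub>R\<^esub> z \<otimes>\<^bsub>R\<^esub> ?e" "z \<otimes>\<^bsub>R\<^esub> ev i = z"
    "?e \<otimes>\<^bsub>R\<^esub> w \<otimes>\<^bsub>R\<^esub> ?e = w" "acts l (star w)"
    using corner_idem[OF i] l by metis
  have e: "?e \<in> carrier R" "?e \<in> E" using i idem_at by auto
  have lX: "l \<in> X" using l by (simp add: acts_def)
  obtain S S' where S: "S \<in> M l" "S' \<in> M l" "act (ev i) l S' S \<noteq> \<zero>\<^bsub>K\<^esub>"
    using l by (auto simp: acts_def)
  obtain T T' where T: "T \<in> M l" "T' \<in> M l" "act (star w) l T' T \<noteq> \<zero>\<^bsub>K\<^esub>"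
    using zw(6) by (auto simp: acts_def)
  let ?s = "C l S T \<otimes>\<^bsub>R\<^esub> (?e \<otimes>\<^bsub>R\<^esub> z)"
  let ?y = "ev i \<otimes>\<^bsub>R\<^esub> ?s \<otimes>\<^bsub>R\<^esub> ev i \<otimes>\<^bsub>R\<^esub> ?e"
  have C: "C l S T \<in> carrier R" using lX S T by simp
  have s: "?s \<in> carrier R" using C e zw by simp
  have z1: "z \<otimes>\<^bsub>R\<^esub> (ev i \<otimes>\<^bsub>R\<^esub> x) = z \<otimes>\<^bsub>R\<^esub> x" if "x \<in> carrier R" for x
    using zw(1,4) that by (simp add: m_assoc[symmetric])
  have yeq: "?y = ev i \<otimes>\<^bsub>R\<^esub> C l S T \<otimes>\<^bsub>R\<^esub> w"
    unfolding zw(3) using C e zw(1) z1 by (simp add: m_assoc)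
  have "act (ev i) l S' S \<in> carrier K" "act (star w) l T' T \<in> carrier K"
    using lX S T zw(2) by (auto simp: star_closed)
  then have "act (ev i) l S' S \<otimes>\<^bsub>K\<^esub> act (star w) l T' T \<noteq> \<zero>\<^bsub>K\<^esub>" using S(3) T(3) integral by blast
  then have ne: "cf l S' T' ?y \<noteq> \<zero>\<^bsub>K\<^esub>"
    unfolding yeq using cf_mult_C_mult[OF ev_closed zw(2) lX S(1) T(1) S(2) T(2) e(2) zw(5)] by simp
  then have "?y \<noteq> \<zero>\<^bsub>R\<^esub>" using linear_form_zero[OF cf_form[OF lX S(2) T(2)]] by metis
  then have ne2: "ev i \<otimes>\<^bsub>R\<^esub> ?s \<otimes>\<^bsub>R\<^esub> ev i \<noteq> \<zero>\<^bsub>R\<^esub>" using e(1) by auto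
  have "(m, l) \<in> leq ?e" if m: "m \<in> X" "U \<in> M m" "W \<in> M m" "a \<in> carrier R" "cf m U W (a \<otimes>\<^bsub>R\<^esub> ?y) \<noteq> \<zero>\<^bsub>K\<^esub>"
    for m U W a
  proof -
    have "a \<otimes>\<^bsub>R\<^esub> ?y = (a \<otimes>\<^bsub>R\<^esub> ev i) \<otimes>\<^bsub>R\<^esub> C l S T \<otimes>\<^bsub>R\<^esub> w"
      unfolding yeq using m(4) C zw(2) by (simp add: m_assoc)
    then have "cf m U W ((a \<otimes>\<^bsub>R\<^esub> ev i) \<otimes>\<^bsub>R\<^esub> C l S T \<otimes>\<^bsub>R\<^esub> w) \<noteq> \<zero>\<^bsub>K\<^esub>" using m(5) by simp
    then show ?thesis
      by (rule cf_mult_C_mult_nonzero[OF _ zw(2) lX S(1) T(1) m(1-3) e(2) zw(5), rotated])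
        (use m(4) in simp)
  qed
  then show ?thesis using s ne ne2 S(2) T(2) by blast
qed

text \<open>The corner at \<^term>\<open>ev i\<close> has dimension at most two, so that at most two cells meet it.\<close>

lemma cells_at_vertex:
  assumes i: "i \<in> V"
  shows "\<exists>Q. (\<forall>l l'. acts l (ev i) \<longrightarrow> acts l' (ev i) \<longrightarrow> Q l = Q l' \<longrightarrow> l = l')
    \<and> (i \<in> VC \<longrightarrow> (\<forall>l. acts l (ev i) \<longrightarrow> Q l))"
proof -
  let ?e = "idem_at i"
  have e: "?e \<in> carrier R" "?e \<in> E" using i idem_at by auto
  define s where "s = (\<lambda>l. SOME s. s \<in> carrier R \<and> ev i \<otimes>\<^bsub>R\<^esub> s \<otimes>\<^bsub>R\<^esub> ev i \<noteq> \<zero>\<^bsub>R\<^esub> \<and>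
    (\<exists>U\<in>M l. \<exists>W\<in>M l. cf l U W (ev i \<otimes>\<^bsub>R\<^esub> s \<otimes>\<^bsub>R\<^esub> ev i \<otimes>\<^bsub>R\<^esub> ?e) \<noteq> \<zero>\<^bsub>K\<^esub>) \<and>
    (\<forall>m\<in>X. \<forall>U\<in>M m. \<forall>W\<in>M m. \<forall>a\<in>carrier R.
      cf m U W (a \<otimes>\<^bsub>R\<^esub> (ev i \<otimes>\<^bsub>R\<^esub> s \<otimes>\<^bsub>R\<^esub> ev i \<otimes>\<^bsub>R\<^esub> ?e)) \<noteq> \<zero>\<^bsub>K\<^esub> \<longrightarrow> (m, l) \<in> leq ?e))"
  define y where "y = (\<lambda>l. ev i \<otimes>\<^bsub>R\<^esub> s l \<otimes>\<^bsub>R\<^esub> ev i \<otimes>\<^bsub>R\<^esub> ?e)"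
  have sl: "s l \<in> carrier R \<and> ev i \<otimes>\<^bsub>R\<^esub> s l \<otimes>\<^bsub>R\<^esub> ev i \<noteq> \<zero>\<^bsub>R\<^esub> \<and>
    (\<exists>U\<in>M l. \<exists>W\<in>M l. cf l U W (y l) \<noteq> \<zero>\<^bsub>K\<^esub>) \<and>
    (\<forall>m\<in>X. \<forall>U\<in>M m. \<forall>W\<in>M m. \<forall>a\<in>carrier R. cf m U W (a \<otimes>\<^bsub>R\<^esub> y l) \<noteq> \<zero>\<^bsub>K\<^esub> \<longrightarrow> (m, l) \<in> leq ?e)"
    if "acts l (ev i)" for l
    unfolding y_def s_def by (rule someI_ex[OF ex_leading_element[OF i that]])
  have sc: "s l \<in> carrier R" if "acts l (ev i)" for l using sl[OF that] by (rule conjunct1)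
  have sne: "ev i \<otimes>\<^bsub>R\<^esub> s l \<otimes>\<^bsub>R\<^esub> ev i \<noteq> \<zero>\<^bsub>R\<^esub>" if "acts l (ev i)" for l using sl[OF that] by blast
  have le: "(l', l) \<in> leq ?e"
    if l: "acts l (ev i)" "acts l' (ev i)" and a: "a \<in> carrier R" "y l' = a \<otimes>\<^bsub>R\<^esub> y l" for l l' a
  proof -
    obtain U W where UW: "U \<in> M l'" "W \<in> M l'" "cf l' U W (y l') \<noteq> \<zero>\<^bsub>K\<^esub>" using sl[OF l(2)] by blast
    have "l' \<in> X" using l(2) by (simp add: acts_def)
    moreover have "cf l' U W (a \<otimes>\<^bsub>R\<^esub> y l) \<noteq> \<zero>\<^bsub>K\<^esub>" using UW(3) unfolding a(2) .
    ultimately show ?thesis using sl[OF l(1)] UW(1,2) a(1) by blast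
  qed
  \<comment> \<open>The residue of the leading element decides between two kinds of cells. If it is
    non-zero, the element is a unit of the corner and all the others are left multiples of it; if it
    vanishes, the element is a multiple of x_i. Two cells of the same kind are therefore below each
    other.\<close>
  let ?Q = "\<lambda>l. u i (s l) \<noteq> \<zero>\<^bsub>K\<^esub>"
  have top: "(l', l) \<in> leq ?e" if l: "acts l (ev i)" "acts l' (ev i)" "?Q l" for l l'
  proof -
    obtain z where z: "z \<in> carrier R" "z \<otimes>\<^bsub>R\<^esub> ev i = z" "z \<otimes>\<^bsub>R\<^esub> s l \<otimes>\<^bsub>R\<^esub> ev i = ev i"
      using corner_unit[OF i sc[OF l(1)] l(3)] by metis
    have "y l' = ev i \<otimes>\<^bsub>R\<^esub> s l' \<otimes>\<^bsub>R\<^esub> (z \<otimes>\<^bsub>R\<^esub> s l \<otimes>\<^bsub>R\<^esub> ev i) \<otimes>\<^bsub>R\<^esub> ?e" by (simp add: y_def z(3))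
    also have "\<dots> = ev i \<otimes>\<^bsub>R\<^esub> s l' \<otimes>\<^bsub>R\<^esub> ((z \<otimes>\<^bsub>R\<^esub> ev i) \<otimes>\<^bsub>R\<^esub> s l \<otimes>\<^bsub>R\<^esub> ev i) \<otimes>\<^bsub>R\<^esub> ?e" by (simp add: z(2))
    also have "\<dots> = (ev i \<otimes>\<^bsub>R\<^esub> s l' \<otimes>\<^bsub>R\<^esub> z) \<otimes>\<^bsub>R\<^esub> y l"
      unfolding y_def using z(1) e(1) sc l by (simp add: m_assoc)
    finally have "y l' = (ev i \<otimes>\<^bsub>R\<^esub> s l' \<otimes>\<^bsub>R\<^esub> z) \<otimes>\<^bsub>R\<^esub> y l" .
    then show ?thesis by (rule le[OF l(1,2), rotated]) (use z(1) sc[OF l(2)] in simp)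
  qed
  have nil: "(l', l) \<in> leq ?e \<and> i \<notin> VC" if l: "acts l (ev i)" "acts l' (ev i)" "\<not> ?Q l" "\<not> ?Q l'" for l l'
  proof -
    have u0: "u i (s l) = \<zero>\<^bsub>K\<^esub>" "u i (s l') = \<zero>\<^bsub>K\<^esub>" using l(3,4) by auto
    note line = corner_nilpotent_line[OF i sc[OF l(1)] sc[OF l(2)] u0 sne[OF l(1)]]
    obtain r where r: "r \<in> carrier K"
      "ev i \<otimes>\<^bsub>R\<^esub> s l' \<otimes>\<^bsub>R\<^esub> ev i = r \<odot>\<^bsub>R\<^esub> (ev i \<otimes>\<^bsub>R\<^esub> s l \<otimes>\<^bsub>R\<^esub> ev i)" using line(2) by blast
    have yc: "y l \<in> carrier R" using e sc[OF l(1)] by (simp add: y_def)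
    have "y l' = r \<odot>\<^bsub>R\<^esub> y l"
      unfolding y_def r(2) using r(1) e sc[OF l(1)] by (simp add: smult_mult_left)
    also have "\<dots> = (r \<odot>\<^bsub>R\<^esub> \<one>\<^bsub>R\<^esub>) \<otimes>\<^bsub>R\<^esub> y l" using r(1) yc by (simp add: smult_mult_left)
    finally have "y l' = (r \<odot>\<^bsub>R\<^esub> \<one>\<^bsub>R\<^esub>) \<otimes>\<^bsub>R\<^esub> y l" .
    then have "(l', l) \<in> leq ?e" by (rule le[OF l(1,2), rotated]) (use r(1) in simp)
    then show ?thesis using line(1) by simp
  qed
  have "l = l'" if "acts l (ev i)" "acts l' (ev i)" "?Q l = ?Q l'" for l l'
    using that top[of l l'] top[of l' l] nil[of l l'] nil[of l' l] leq_antisym[OF e(2)] by metis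
  moreover have "?Q l" if "i \<in> VC" "acts l (ev i)" for l using nil[OF that(2,2)] that(1) by blast
  ultimately show ?thesis by (intro exI[of _ ?Q]) blast
qed

end


section \<open>Lines\<close>

text \<open>The combinatorial core, free of algebra: \<open>N l i\<close> stands for the cell l
  meeting the vertex i, \<open>c i\<close> for the distinguished cell of i, and \<open>B\<close> for
  the vertex condition.\<close>

lemma ex_line:
  fixes A :: "'v rel" and N :: "'x \<Rightarrow> 'v \<Rightarrow> bool" and c :: "'v \<Rightarrow> 'x"
  assumes finite: "finite V" and A: "A \<subseteq> V \<times> V" "\<And>i j. (i, j) \<in> A \<Longrightarrow> (j, i) \<in> A" "\<And>i j. (i, j) \<in> A \<Longrightarrow> i \<noteq> j"
    and conn: "\<And>S. \<lbrakk>S \<subseteq> V; S \<noteq> {}; \<And>i j. \<lbrakk>i \<in> S; (i, j) \<in> A\<rbrakk> \<Longrightarrow> j \<in> S\<rbrakk> \<Longrightarrow> S = V"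
    and B: "B \<subseteq> V" "B \<noteq> {}"
    and inj: "inj_on c V" and self: "\<And>i. i \<in> V \<Longrightarrow> N (c i) i"
    and next_unique: "\<And>i j k. \<lbrakk>i \<in> V; j \<in> V; k \<in> V; j \<noteq> i; k \<noteq> i; N (c i) j; N (c i) k\<rbrakk>
      \<Longrightarrow> j = k \<and> j \<notin> B \<and> (i, j) \<in> A"
    and common: "\<And>i j. (i, j) \<in> A \<Longrightarrow> \<exists>l. N l i \<and> N l j"
    and few: "\<And>i. i \<in> V \<Longrightarrow> \<exists>Q. (\<forall>l l'. N l i \<longrightarrow> N l' i \<longrightarrow> Q l = Q l' \<longrightarrow> l = l') \<and> (i \<in> B \<longrightarrow> (\<forall>l. N l i \<longrightarrow> Q l))"
  shows "\<exists>vs. distinct vs \<and> set vs = V \<and> vs \<noteq> [] \<and> B = {hd vs} \<and>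
    A = {(vs ! k, vs ! l) | k l. k < length vs \<and> l < length vs \<and> (l = Suc k \<or> k = Suc l)}"
proof -
  \<comment> \<open>Q separates the cells at i and takes only two values.\<close>
  have three: "l1 = l2 \<or> l1 = l3 \<or> l2 = l3" if "i \<in> V" "N l1 i" "N l2 i" "N l3 i" for i l1 l2 l3
    using few[OF that(1)] that(2-4) by metis
  have cell_B: "l = c i" if "i \<in> B" "N l i" for l i
    using few[of i] that self B(1) by (metis subsetD)
  \<comment> \<open>The step from i to the further vertex met by its distinguished cell. It is
    single-valued by \<open>next_unique\<close>, and injective because at most two cells meet
    j.\<close>
  define s where "s = (\<lambda>i j. i \<in> V \<and> j \<in> V \<and> j \<noteq> i \<and> N (c i) j)"
  have s_A: "(i, j) \<in> A" "j \<notin> B" if "s i j" for i j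
    using next_unique[of i j j] that by (auto simp: s_def)
  have s_fun: "j = k" if "s i j" "s i k" for i j k
    using next_unique[of i j k] that by (auto simp: s_def)
  have s_inj: "i = i'" if "s i j" "s i' j" for i i' j
  proof -
    have "c i \<noteq> c j" "c i' \<noteq> c j" using that inj by (auto simp: s_def inj_on_def)
    then have "c i = c i'" using three[of j "c i" "c i'" "c j"] that self[of j] by (auto simp: s_def)
    then show ?thesis using that inj by (auto simp: s_def inj_on_def)
  qed
  \<comment> \<open>The cells \<open>c p\<close> and \<open>c i\<close> are the only ones at i, so a
    common cell of i and k is one of them; the first leads back to p and the second gives a step to
    k.\<close>
  have nb: "k = p \<or> s i k" if spi: "s p i" and ik: "(i, k) \<in> A" "i \<noteq> k" for p i k
  proof -
    have V: "i \<in> V" "k \<in> V" "p \<in> V" using spi ik A(1) by (auto simp: s_def)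
    obtain l where l: "N l i" "N l k" using common[OF ik(1)] by blast
    have "c p \<noteq> c i" using spi inj by (auto simp: s_def inj_on_def)
    then have "l = c p \<or> l = c i"
      using three[OF V(1) l(1), of "c p" "c i"] spi self[OF V(1)] by (auto simp: s_def)
    then show ?thesis
    proof
      assume "l = c p"
      then have "k = p \<or> s p k" using l V by (auto simp: s_def)
      then show ?thesis using s_fun[OF spi] ik(2) by blast
    next
      assume "l = c i"
      then show ?thesis using l V ik(2) by (auto simp: s_def)
    qed
  qed
  have nbB: "s i k" if iB: "i \<in> B" and ik: "(i, k) \<in> A" "i \<noteq> k" for i k
  proof -
    obtain l where "N l i" "N l k" using common[OF ik(1)] by blast
    then show ?thesis using cell_B[OF iB] iB ik A(1) by (auto simp: s_def)
  qed
  note irrefl = A(3)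
  obtain b where b: "b \<in> B" using B(2) by blast
  \<comment> \<open>Chains of steps that start in B. Having no repetitions, they are bounded in
    length, and a longest one turns out to be the whole line.\<close>
  define P where "P = (\<lambda>vs. vs \<noteq> [] \<and> hd vs = b \<and> distinct vs \<and> set vs \<subseteq> V
    \<and> (\<forall>k. Suc k < length vs \<longrightarrow> s (vs ! k) (vs ! Suc k)))"
  have P1: "P [b]" using b B by (auto simp: P_def)
  have bound: "length vs < Suc (card V)" if "P vs" for vs
    using that card_mono[OF finite, of "set vs"] distinct_card[of vs] by (auto simp: P_def)
  have "\<exists>vs. P vs \<and> (\<forall>ws. P ws \<longrightarrow> length ws \<le> length vs)"
    by (rule ex_has_greatest_nat[of P "[b]" length, OF P1]) (use bound in blast)
  then obtain vs where P: "P vs" and max: "\<And>ws. P ws \<Longrightarrow> length ws \<le> length vs" by blast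
  note vs = P[unfolded P_def]
  have hd0: "vs ! 0 = b" using vs hd_conv_nth[of vs] by simp
  have step: "s (vs ! k) (vs ! Suc k)" if "Suc k < length vs" for k using vs that by blast
  have not_B: "vs ! m \<notin> B" if "0 < m" "m < length vs" for m
    using step[of "m - 1"] s_A(2) that by auto
  have nxt: "Suc k < length vs \<and> x = vs ! Suc k" if k: "k < length vs" and x: "s (vs ! k) x" for k x
  proof (cases "Suc k < length vs")
    case True
    then show ?thesis using s_fun[OF x step] by blast
  next
    case False
    then have kl: "k = length vs - 1" using k by simp
    \<comment> \<open>The target of a further step cannot occur in the chain already: b lies in B,
      which no step enters, and any other recurrence contradicts injectivity.\<close>
    have "x \<notin> set vs"
    proof
      assume "x \<in> set vs"
      then obtain m where m: "m < length vs" "vs ! m = x" by (auto simp: in_set_conv_nth)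
      show False
      proof (cases m)
        case 0
        then show ?thesis using m hd0 b s_A(2)[OF x] by simp
      next
        case (Suc m')
        then have "s (vs ! m') x" using step[of m'] m by simp
        then have "vs ! m' = vs ! k" using s_inj x by blast
        then show ?thesis using vs m k kl Suc by (simp add: nth_eq_iff_index_eq)
      qed
    qed
    moreover have "s ((vs @ [x]) ! m) ((vs @ [x]) ! Suc m)" if "Suc m < length (vs @ [x])" for m
    proof (cases "Suc m < length vs")
      case True
      then show ?thesis using step[of m] by (simp add: nth_append)
    next
      case False
      then have "m = k" using that kl by simp
      then show ?thesis using x k kl False by (simp add: nth_append)
    qed
    moreover have "x \<in> V" using x by (simp add: s_def)
    ultimately have "P (vs @ [x])" using vs by (auto simp: P_def)
    then show ?thesis using max[of "vs @ [x]"] by simp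
  qed
  have nbs: "(0 < k \<and> x = vs ! (k - 1)) \<or> (Suc k < length vs \<and> x = vs ! Suc k)"
    if k: "k < length vs" and x: "(vs ! k, x) \<in> A" for k x
  proof (cases k)
    case 0
    then show ?thesis using nbB[OF _ x irrefl[OF x]] hd0 b nxt[OF k] by simp
  next
    case (Suc k')
    then show ?thesis using nb[OF step[of k'], of x] irrefl[OF x] k x nxt[OF k] by auto
  qed
  have setV: "set vs = V"
  proof (rule conn)
    fix i j assume "i \<in> set vs" "(i, j) \<in> A"
    then obtain k where "k < length vs" "(vs ! k, j) \<in> A" by (metis in_set_conv_nth)
    then show "j \<in> set vs" using nbs[of k j] by auto
  qed (use vs in auto)
  have "A = {(vs ! k, vs ! l) | k l. k < length vs \<and> l < length vs \<and> (l = Suc k \<or> k = Suc l)}" (is "A = ?A")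
  proof (rule subset_antisym; rule subrelI)
    fix i j assume ij: "(i, j) \<in> A"
    then have "i \<in> set vs" using A(1) setV by auto
    then obtain k where k: "k < length vs" "i = vs ! k" by (auto simp: in_set_conv_nth)
    from nbs[OF k(1)] ij k(2) consider "0 < k" "j = vs ! (k - 1)" | "Suc k < length vs" "j = vs ! Suc k"
      by auto
    then show "(i, j) \<in> ?A"
    proof cases
      case 1
      then have "i = vs ! k \<and> j = vs ! (k - 1) \<and> k - 1 < length vs \<and> k = Suc (k - 1)" using k by auto
      then show ?thesis using k(1) by blast
    next
      case 2
      then show ?thesis using k by blast
    qed
  next
    fix i j assume "(i, j) \<in> ?A"
    then show "(i, j) \<in> A" using step s_A(1) A(2) by blast
  qed
  moreover have "B = {hd vs}"
  proof
    show "B \<subseteq> {hd vs}"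
    proof
      fix d assume d: "d \<in> B"
      then have "d \<in> set vs" using B(1) setV by auto
      then obtain m where m: "m < length vs" "d = vs ! m" by (auto simp: in_set_conv_nth)
      then have "m = 0" using not_B[of m] d by blast
      then show "d \<in> {hd vs}" using m hd0 vs by simp
    qed
    show "{hd vs} \<subseteq> B" using vs b by simp
  qed
  ultimately show ?thesis using vs setV by blast
qed

lemma (in zigzag_cell_datum) ex_line_of_cell_datum:
  assumes "\<And>S. \<lbrakk>S \<subseteq> V; S \<noteq> {}; \<And>i j. \<lbrakk>i \<in> S; (i, j) \<in> A\<rbrakk> \<Longrightarrow> j \<in> S\<rbrakk> \<Longrightarrow> S = V" "VC \<noteq> {}"
  shows "\<exists>vs. distinct vs \<and> set vs = V \<and> vs \<noteq> [] \<and> VC = {hd vs} \<and>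
    A = {(vs ! k, vs ! l) | k l. k < length vs \<and> l < length vs \<and> (l = Suc k \<or> k = Suc l)}"
proof (rule ex_line[where N = "\<lambda>l i. acts l (ev i)" and c = cell_at, OF finite_V A_subset])
  show "inj_on cell_at V" using cell_at_inj by (auto simp: inj_on_def)
  show "j = k \<and> j \<notin> VC \<and> (i, j) \<in> A"
    if "i \<in> V" "j \<in> V" "k \<in> V" "j \<noteq> i" "k \<noteq> i" "acts (cell_at i) (ev j)" "acts (cell_at i) (ev k)" for i j k
    using acts_cell_at_unique[OF that] by blast
qed (fact assms(1) assms(2) A_sym A_irrefl C_subset acts_cell_at ex_common_cell cells_at_vertex)+

section \<open>Cell data of lines\<close>

context vectorspace
begin

lemma span_smult_closed:
  assumes "S \<subseteq> carrier V" "r \<in> carrier K" "a \<in> span S"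
  shows "r \<odot>\<^bsub>V\<^esub> a \<in> span S"
proof -
  obtain c A where A: "finite A" "A \<subseteq> S" "c \<in> A \<rightarrow> carrier K" "a = lincomb c A"
    using assms(3) by (auto simp: span_def)
  have "r \<odot>\<^bsub>V\<^esub> a = lincomb (\<lambda>w. r \<otimes>\<^bsub>K\<^esub> c w) A"
    unfolding A(4) by (rule lincomb_smult[symmetric]) (use A assms in auto)
  moreover have "(\<lambda>w. r \<otimes>\<^bsub>K\<^esub> c w) \<in> A \<rightarrow> carrier K" using A(3) assms(2) by auto
  ultimately show ?thesis using A(1,2) unfolding span_def by blast
qed

lemma finsum_in_span:
  assumes "S \<subseteq> carrier V" "f \<in> I \<rightarrow> span S"
  shows "(\<Oplus>\<^bsub>V\<^esub>i\<in>I. f i) \<in> span S"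
  using assms(2)
proof (induction I rule: infinite_finite_induct)
  case (insert i I)
  have "f j \<in> carrier V" if "j \<in> insert i I" for j
    using insert(4) that span_is_subset2[OF assms(1)] by blast
  then have "(\<Oplus>\<^bsub>V\<^esub>i\<in>insert i I. f i) = f i \<oplus>\<^bsub>V\<^esub> (\<Oplus>\<^bsub>V\<^esub>i\<in>I. f i)"
    using insert(1,2) by (intro M.finsum_insert) auto
  then show ?case using insert span_add1[OF assms(1)] by auto
qed (auto simp: span_zero)

end

section \<open>Left multiplication and reversal in coordinates\<close>

context zigzag_coordinates
begin

text \<open>Only e_i and the arrow from j to i compose with the arrow from i to j. The second
  composite is x_j, which is zero for j in \<open>C\<close>.\<close>

lemma mult_ar:
  assumes ij: "(i, j) \<in> A" and a: "a \<in> carrier R"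
  shows "a \<otimes>\<^bsub>R\<^esub> ar i j
    = u i a \<odot>\<^bsub>R\<^esub> ar i j \<oplus>\<^bsub>R\<^esub> (if j \<in> C then \<zero>\<^bsub>K\<^esub> else t j i a) \<odot>\<^bsub>R\<^esub> ar j j" (is "_ = _ \<oplus>\<^bsub>R\<^esub> ?r \<odot>\<^bsub>R\<^esub> _")
proof (rule coordinates_eqI)
  have r: "?r \<in> carrier K" using A_sym[OF ij] a by simp
  have i: "i \<in> V" and j: "j \<in> V" using A_verts[OF ij] by auto
  show "u i a \<odot>\<^bsub>R\<^esub> ar i j \<oplus>\<^bsub>R\<^esub> ?r \<odot>\<^bsub>R\<^esub> ar j j \<in> carrier R" using a r i by simp
  show "u k (a \<otimes>\<^bsub>R\<^esub> ar i j) = u k (u i a \<odot>\<^bsub>R\<^esub> ar i j \<oplus>\<^bsub>R\<^esub> ?r \<odot>\<^bsub>R\<^esub> ar j j)" if "k \<in> V" for k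
    using that a r i by (simp add: u_simps)
  fix k l assume kl: "(k, l) \<in> D"
  have rhs: "t k l (u i a \<odot>\<^bsub>R\<^esub> ar i j \<oplus>\<^bsub>R\<^esub> ?r \<odot>\<^bsub>R\<^esub> ar j j)
      = u i a \<otimes>\<^bsub>K\<^esub> t k l (ar i j) \<oplus>\<^bsub>K\<^esub> ?r \<otimes>\<^bsub>K\<^esub> t k l (ar j j)"
    using kl a r i by (simp add: t_simps)
  show "t k l (a \<otimes>\<^bsub>R\<^esub> ar i j) = t k l (u i a \<odot>\<^bsub>R\<^esub> ar i j \<oplus>\<^bsub>R\<^esub> ?r \<odot>\<^bsub>R\<^esub> ar j j)"
    using kl
  proof (cases rule: D_cases)
    case 1
    then show ?thesis unfolding rhs using kl a r i by (auto simp: t_mult_arc t_ar)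
  next
    case 2
    have "(\<Oplus>\<^bsub>K\<^esub>m\<in>{m. (k, m) \<in> A}. t k m a \<otimes>\<^bsub>K\<^esub> t m k (ar i j))
        = (\<Oplus>\<^bsub>K\<^esub>m\<in>{m. (k, m) \<in> A}. if i = m then (if k = j then t k m a else \<zero>\<^bsub>K\<^esub>) else \<zero>\<^bsub>K\<^esub>)"
      by (rule finsum_row_eq) (use a A_sym in \<open>auto simp: t_ar A_D\<close>)
    also have "\<dots> = (if k = j then t k i a else \<zero>\<^bsub>K\<^esub>)"
    proof (cases "k = j")
      case True
      show ?thesis
        by (rule R.finsum_singleton) (use True A_sym[OF ij] a finite_A_row in auto)
    next
      case False
      then have "(\<Oplus>\<^bsub>K\<^esub>m\<in>{m. (k, m) \<in> A}. if i = m then (if k = j then t k m a else \<zero>\<^bsub>K\<^esub>) else \<zero>\<^bsub>K\<^esub>) = \<zero>\<^bsub>K\<^esub>"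
        by (intro finsum_row_zero) auto
      then show ?thesis using False by simp
    qed
    finally have row: "(\<Oplus>\<^bsub>K\<^esub>m\<in>{m. (k, m) \<in> A}. t k m a \<otimes>\<^bsub>K\<^esub> t m k (ar i j)) = (if k = j then t k i a else \<zero>\<^bsub>K\<^esub>)" .
    show ?thesis unfolding rhs
      using kl 2 a r i row A_irrefl[OF ij] A_sym[OF ij] by (auto simp: t_mult_loop t_ar)
  qed
qed (use a in auto)

lemma mult_loop:
  assumes j: "j \<in> V" "j \<notin> C" and a: "a \<in> carrier R"
  shows "a \<otimes>\<^bsub>R\<^esub> ar j j = u j a \<odot>\<^bsub>R\<^esub> ar j j"
proof (rule coordinates_eqI)
  show "u k (a \<otimes>\<^bsub>R\<^esub> ar j j) = u k (u j a \<odot>\<^bsub>R\<^esub> ar j j)" if "k \<in> V" for k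
    using that a j by (simp add: u_simps)
  fix k l assume kl: "(k, l) \<in> D"
  then show "t k l (a \<otimes>\<^bsub>R\<^esub> ar j j) = t k l (u j a \<odot>\<^bsub>R\<^esub> ar j j)"
  proof (cases rule: D_cases)
    case 1
    then show ?thesis using kl a j by (auto simp: t_mult_arc t_ar t_simps)
  next
    case 2
    have "(\<Oplus>\<^bsub>K\<^esub>m\<in>{m. (k, m) \<in> A}. t k m a \<otimes>\<^bsub>K\<^esub> t m k (ar j j)) = \<zero>\<^bsub>K\<^esub>"
      using A_irrefl A_sym a by (intro finsum_row_zero) (auto simp: t_ar A_D)
    then show ?thesis using kl 2 a j by (auto simp: t_mult_loop t_ar t_simps)
  qed
qed (use a j in auto)

text \<open>The anti-involution of the cell datum: it reverses arrows and fixes every e_i and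
  x_i.\<close>

definition transp :: "'a \<Rightarrow> 'a" where
  "transp a = elt (\<lambda>i. u i a) (\<lambda>i j. t j i a)"

lemma D_sym: "(i, j) \<in> D \<Longrightarrow> (j, i) \<in> D"
  using A_sym by (auto simp: D_def)

lemma transp_closed [simp]: "a \<in> carrier R \<Longrightarrow> transp a \<in> carrier R"
  unfolding transp_def by (rule elt(1)) (auto intro: t_closed D_sym)

lemma u_transp: "\<lbrakk>a \<in> carrier R; i \<in> V\<rbrakk> \<Longrightarrow> u i (transp a) = u i a"
  unfolding transp_def by (subst elt(2)) (auto intro: t_closed D_sym)

lemma t_transp: "\<lbrakk>a \<in> carrier R; (i, j) \<in> D\<rbrakk> \<Longrightarrow> t i j (transp a) = t j i a"
  unfolding transp_def by (subst elt(3)) (auto intro: t_closed D_sym)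

lemma transp_mult:
  assumes "a \<in> carrier R" "b \<in> carrier R"
  shows "transp (a \<otimes>\<^bsub>R\<^esub> b) = transp b \<otimes>\<^bsub>R\<^esub> transp a"
proof (rule coordinates_eqI)
  show "u k (transp (a \<otimes>\<^bsub>R\<^esub> b)) = u k (transp b \<otimes>\<^bsub>R\<^esub> transp a)" if "k \<in> V" for k
    using that assms by (simp add: u_transp u_mult R.m_comm)
  fix k l assume kl: "(k, l) \<in> D"
  then show "t k l (transp (a \<otimes>\<^bsub>R\<^esub> b)) = t k l (transp b \<otimes>\<^bsub>R\<^esub> transp a)"
  proof (cases rule: D_cases)
    case 1
    then show ?thesis
      using kl assms A_sym[OF 1(1)] t_transp[OF m_closed[OF assms] kl]
      by (simp add: t_mult_arc t_transp u_transp R.m_comm R.a_comm)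
  next
    case 2
    have "(\<Oplus>\<^bsub>K\<^esub>m\<in>{m. (k, m) \<in> A}. t k m (transp b) \<otimes>\<^bsub>K\<^esub> t m k (transp a))
        = (\<Oplus>\<^bsub>K\<^esub>m\<in>{m. (k, m) \<in> A}. t k m a \<otimes>\<^bsub>K\<^esub> t m k b)"
      by (rule finsum_row_eq) (use assms A_sym in \<open>auto simp: t_transp A_D R.m_comm\<close>)
    moreover have "(\<Oplus>\<^bsub>K\<^esub>m\<in>{m. (k, m) \<in> A}. t k m a \<otimes>\<^bsub>K\<^esub> t m k b) \<in> carrier K"
      by (rule R.finsum_closed) (use assms A_sym in auto)
    ultimately show ?thesis
      using kl 2 assms t_transp[OF m_closed[OF assms] kl]
      by (simp add: t_mult_loop t_transp u_transp R.m_comm R.a_ac)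
  qed
qed (use assms in auto)

lemma transp_ev: "transp (ev i) = ev i"
  by (rule coordinates_eqI) (auto simp: u_transp t_transp t_ev D_sym)

lemma transp_ar: "transp (ar i j) = ar j i"
  by (rule coordinates_eqI) (auto simp: u_transp t_transp t_ar D_sym)

end

text \<open>Positions on the list serve as names of cells and of indices within a cell; the
  injections \<open>p\<close> and \<open>q\<close> carry them into the prescribed index
  types.\<close>

locale zigzag_line = zigzag_coordinates K R V A VC u t
  for K :: "('k, 'm) ring_scheme" and R :: "('k, 'a, 'n) module_scheme"
    and V :: "'v set" and A VC u t +
  fixes vs :: "'v list" and p :: "nat \<Rightarrow> 'x" and q :: "nat \<Rightarrow> 's"
  assumes vs: "distinct vs" "set vs = V" "vs \<noteq> []" "VC = {hd vs}"
    "A = {(vs ! k, vs ! l) | k l. k < length vs \<and> l < length vs \<and> (l = Suc k \<or> k = Suc l)}"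
    and p: "inj p" and q: "inj q"
begin

abbreviation "n \<equiv> length vs"

lemma vs_V [simp]: "k < n \<Longrightarrow> vs ! k \<in> V"
  using vs(2) by auto

lemma vs_eq_iff [simp]: "\<lbrakk>k < n; l < n\<rbrakk> \<Longrightarrow> vs ! k = vs ! l \<longleftrightarrow> k = l"
  using vs(1) by (simp add: nth_eq_iff_index_eq)

lemma vs_VC: "k < n \<Longrightarrow> vs ! k \<in> VC \<longleftrightarrow> k = 0"
  using vs(3,4) hd_conv_nth[of vs] by (metis length_greater_0_conv singleton_iff vs_eq_iff)

lemma vs_A: "\<lbrakk>k < n; l < n\<rbrakk> \<Longrightarrow> (vs ! k, vs ! l) \<in> A \<longleftrightarrow> l = Suc k \<or> k = Suc l"
  unfolding vs(5) by auto

lemma vs_D: "\<lbrakk>k < n; l < n\<rbrakk> \<Longrightarrow> (vs ! k, vs ! l) \<in> D \<longleftrightarrow> l = Suc k \<or> k = Suc l \<or> (k = l \<and> 0 < k)"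
  using vs_A[of k l] vs_VC[of k] by (auto simp: D_def)

lemma V_E:
  assumes "i \<in> V"
  obtains k where "k < n" "i = vs ! k"
  using assms vs(2) by (metis in_set_conv_nth)

text \<open>In the k-th cell module, k stands for e_k and k + 1 for the arrow from k + 1 to k. The
  bound n removes the latter at the end of the line.\<close>

definition cells :: "nat \<Rightarrow> nat set" where
  "cells k = {s. (s = k \<or> s = Suc k) \<and> s < n}"

text \<open>The entries of the cell k are e_k, the two arrows between k and k + 1, and the x of
  position k + 1. Thus a surviving x belongs to the cell before its vertex, and position 0, which
  has no cell before it, is exactly the one whose x is killed.\<close>

definition cb :: "nat \<Rightarrow> nat \<Rightarrow> nat \<Rightarrow> 'a" where
  "cb k r s = (if r = k \<and> s = k then ev (vs ! k) else ar (vs ! r) (vs ! s))"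

definition cc :: "nat \<Rightarrow> nat \<Rightarrow> nat \<Rightarrow> 'a \<Rightarrow> 'k" where
  "cc k r s = (if r = k \<and> s = k then u (vs ! k) else t (vs ! r) (vs ! s))"

text \<open>The matrix of a on the k-th cell module: vertex coordinates on the diagonal, and one
  further entry that leads from e_k to the arrow from k + 1 to k.\<close>

definition rep :: "'a \<Rightarrow> nat \<Rightarrow> nat \<Rightarrow> nat \<Rightarrow> 'k" where
  "rep a k r s = (if r = s then u (vs ! s) a else if s = k then t (vs ! Suc k) (vs ! k) a else \<zero>\<^bsub>K\<^esub>)"

text \<open>The part of a product with \<open>cb k s j\<close> that leaves the cell k. It involves
  only the arrow from k - 1 to k and x_k, both of which are entries of the cell k - 1.\<close>

definition low :: "'a \<Rightarrow> nat \<Rightarrow> nat \<Rightarrow> nat \<Rightarrow> 'a" where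
  "low a k s j = (if k = 0 \<or> j \<noteq> k then \<zero>\<^bsub>R\<^esub>
    else if s = k then t (vs ! (k - 1)) (vs ! k) a \<odot>\<^bsub>R\<^esub> cb (k - 1) (k - 1) k
      \<oplus>\<^bsub>R\<^esub> t (vs ! k) (vs ! k) a \<odot>\<^bsub>R\<^esub> cb (k - 1) k k
    else t (vs ! k) (vs ! Suc k) a \<odot>\<^bsub>R\<^esub> cb (k - 1) k k)"

lemma cells_iff: "s \<in> cells k \<longleftrightarrow> (s = k \<or> s = Suc k) \<and> s < n"
  by (simp add: cells_def)

lemma finite_cells [simp]: "finite (cells k)"
  by (rule finite_subset[of _ "{k, Suc k}"]) (auto simp: cells_def)

lemma cb_closed [simp]: "cb k r s \<in> carrier R"
  by (simp add: cb_def)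

lemma tv_closed: "\<lbrakk>k < n; l < n; l = Suc k \<or> k = Suc l \<or> (k = l \<and> 0 < k); a \<in> carrier R\<rbrakk>
    \<Longrightarrow> t (vs ! k) (vs ! l) a \<in> carrier K"
  by (rule t_closed) (simp_all add: vs_D)

lemma rep_closed: "\<lbrakk>k < n; r \<in> cells k; s \<in> cells k; a \<in> carrier R\<rbrakk> \<Longrightarrow> rep a k r s \<in> carrier K"
  by (auto simp: rep_def cells_iff tv_closed)

lemma cells_sum:
  assumes "k < n" "f \<in> cells k \<rightarrow> carrier R"
  shows "(\<Oplus>\<^bsub>R\<^esub>r\<in>cells k. f r) = (if Suc k < n then f k \<oplus>\<^bsub>R\<^esub> f (Suc k) else f k)"
proof -
  have "cells k = (if Suc k < n then {k, Suc k} else {k})" using assms(1) by (auto simp: cells_def)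
  then show ?thesis using assms(2) by auto
qed

text \<open>The product with e_k collects all coordinates of a that end at k, \<open>mult_ar\<close>
  handles the two arrows, and the remaining x is only scaled.\<close>

lemma mult_cb:
  assumes k: "k < n" and s: "s \<in> cells k" "j \<in> cells k" and a: "a \<in> carrier R"
  shows "a \<otimes>\<^bsub>R\<^esub> cb k s j = (\<Oplus>\<^bsub>R\<^esub>r\<in>cells k. rep a k r s \<odot>\<^bsub>R\<^esub> cb k r j) \<oplus>\<^bsub>R\<^esub> low a k s j"
proof -
  have sum: "(\<Oplus>\<^bsub>R\<^esub>r\<in>cells k. rep a k r s \<odot>\<^bsub>R\<^esub> cb k r j)
      = (if Suc k < n then rep a k k s \<odot>\<^bsub>R\<^esub> cb k k j \<oplus>\<^bsub>R\<^esub> rep a k (Suc k) s \<odot>\<^bsub>R\<^esub> cb k (Suc k) j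
         else rep a k k s \<odot>\<^bsub>R\<^esub> cb k k j)"
    by (rule cells_sum[OF k]) (use rep_closed[OF k _ s(1) a] in auto)
  have uc: "u (vs ! m) a \<in> carrier K" if "m < n" for m using that a by simp
  consider "s = k" "j = k" | "s = k" "j = Suc k" "Suc k < n" | "s = Suc k" "j = k" "Suc k < n"
    | "s = Suc k" "j = Suc k" "Suc k < n"
    using s by (auto simp: cells_iff)
  then show ?thesis
  proof cases
    case 1
    let ?b = "if Suc k < n then u (vs ! k) a \<odot>\<^bsub>R\<^esub> ev (vs ! k) \<oplus>\<^bsub>R\<^esub> t (vs ! Suc k) (vs ! k) a \<odot>\<^bsub>R\<^esub> ar (vs ! Suc k) (vs ! k)
       else u (vs ! k) a \<odot>\<^bsub>R\<^esub> ev (vs ! k)"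
    let ?d = "if k = 0 then \<zero>\<^bsub>R\<^esub> else t (vs ! (k - 1)) (vs ! k) a \<odot>\<^bsub>R\<^esub> ar (vs ! (k - 1)) (vs ! k)
      \<oplus>\<^bsub>R\<^esub> t (vs ! k) (vs ! k) a \<odot>\<^bsub>R\<^esub> ar (vs ! k) (vs ! k)"
    have tc: "Suc k < n \<Longrightarrow> t (vs ! Suc k) (vs ! k) a \<in> carrier K"
      "k \<noteq> 0 \<Longrightarrow> t (vs ! (k - 1)) (vs ! k) a \<in> carrier K" "k \<noteq> 0 \<Longrightarrow> t (vs ! k) (vs ! k) a \<in> carrier K"
      using k a by (auto intro!: tv_closed)
    have bc: "?b \<in> carrier R" "?d \<in> carrier R" using tc uc[OF k] by auto
    have "a \<otimes>\<^bsub>R\<^esub> ev (vs ! k) = ?b \<oplus>\<^bsub>R\<^esub> ?d"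
    proof (rule coordinates_eqI)
      fix i assume "i \<in> V"
      then obtain m where m: "m < n" "i = vs ! m" by (rule V_E)
      have z: "u i \<zero>\<^bsub>R\<^esub> = \<zero>\<^bsub>K\<^esub>" using linear_form_zero[OF u_form[OF \<open>i \<in> V\<close>]] .
      have b: "u i ?b = (if m = k then u i a else \<zero>\<^bsub>K\<^esub>)"
        using m k a tc uc[OF k] by (auto simp: u_simps)
      have d: "u i ?d = \<zero>\<^bsub>K\<^esub>"
        using m k a tc uc[OF k] z by (auto simp: u_simps)
      have "u i (?b \<oplus>\<^bsub>R\<^esub> ?d) = u i ?b \<oplus>\<^bsub>K\<^esub> u i ?d" by (rule u_simps(1)[OF \<open>i \<in> V\<close> bc])
      then show "u i (a \<otimes>\<^bsub>R\<^esub> ev (vs ! k)) = u i (?b \<oplus>\<^bsub>R\<^esub> ?d)"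
        unfolding b d using m k a by (auto simp: u_simps)
    next
      fix i i' assume D: "(i, i') \<in> D"
      obtain m l where m: "m < n" "i = vs ! m" "l < n" "i' = vs ! l"
        using V_E D_verts[OF D] by metis
      have D': "(vs ! m, vs ! l) \<in> D" using D m by simp
      have ml: "l = Suc m \<or> m = Suc l \<or> (m = l \<and> 0 < m)" using vs_D[OF m(1,3)] D' by simp
      have z: "t (vs ! m) (vs ! l) \<zero>\<^bsub>R\<^esub> = \<zero>\<^bsub>K\<^esub>"
        using linear_form_zero[OF t_form] D' by (simp add: D_def)
      have lhs: "t i i' (a \<otimes>\<^bsub>R\<^esub> ev (vs ! k)) = (if l = k then t (vs ! m) (vs ! l) a else \<zero>\<^bsub>K\<^esub>)"
        using t_mult_ev[OF D, of "vs ! k" a] m k a by simp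
      have b: "t i i' ?b = (if m = Suc k \<and> l = k then t (vs ! m) (vs ! l) a else \<zero>\<^bsub>K\<^esub>)"
        using m k a tc uc[OF k] ml by (auto simp: t_simps t_ev t_ar vs_D)
      have d: "t i i' ?d = (if l = k \<and> (Suc m = k \<or> m = k) then t (vs ! m) (vs ! l) a else \<zero>\<^bsub>K\<^esub>)"
        using m k a tc z ml by (auto simp: t_simps t_ar vs_D)
      have "t i i' (?b \<oplus>\<^bsub>R\<^esub> ?d) = t i i' ?b \<oplus>\<^bsub>K\<^esub> t i i' ?d" by (rule t_simps(1)[OF D bc])
      also have "\<dots> = (if l = k then t (vs ! m) (vs ! l) a else \<zero>\<^bsub>K\<^esub>)"
        unfolding b d using ml t_closed[OF D' a] by auto
      finally show "t i i' (a \<otimes>\<^bsub>R\<^esub> ev (vs ! k)) = t i i' (?b \<oplus>\<^bsub>R\<^esub> ?d)" using lhs by simp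
    qed (use a bc in auto)
    then show ?thesis unfolding sum using 1 k by (auto simp: rep_def low_def cb_def)
  next
    case 2
    have "t (vs ! Suc k) (vs ! k) a \<in> carrier K" using 2 a by (intro tv_closed) auto
    then show ?thesis unfolding sum
      using 2 k a uc mult_ar[of "vs ! k" "vs ! Suc k" a]
      by (simp add: rep_def low_def cb_def vs_A vs_VC)
  next
    \<comment> \<open>For k = 0 the x at position k is killed by the vertex condition, in agreement
      with the zero value of \<open>low\<close>.\<close>
    case 3
    have tc: "t (vs ! k) (vs ! Suc k) a \<in> carrier K" using 3 a by (intro tv_closed) auto
    show ?thesis unfolding sum
      using 3 k a uc tc mult_ar[of "vs ! Suc k" "vs ! k" a]
      by (auto simp: rep_def low_def cb_def vs_A vs_VC)
  next
    case 4
    then show ?thesis unfolding sum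
      using k a uc mult_loop[of "vs ! Suc k" a]
      by (auto simp: rep_def low_def cb_def vs_VC)
  qed
qed

end

section \<open>The cell datum of a line in the prescribed index types\<close>

context zigzag_line
begin

abbreviation "pX \<equiv> p ` {..<n}"
abbreviation "pM \<equiv> \<lambda>l. q ` cells (inv_into UNIV p l)"
abbreviation "pC \<equiv> \<lambda>l S T. cb (inv_into UNIV p l) (inv_into UNIV q S) (inv_into UNIV q T)"
text \<open>Cells closer to the vertex carrying the condition are smaller.\<close>

abbreviation "pL \<equiv> \<lambda>_ :: 'a. {(p k, p m) | k m. k \<le> m \<and> m < n}"

lemma inv_p [simp]: "inv_into UNIV p (p k) = k"
  by (rule inv_f_f[OF p])

lemma inv_q [simp]: "inv_into UNIV q (q k) = k"
  by (rule inv_f_f[OF q])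

lemma p_eq_iff [simp]: "p k = p l \<longleftrightarrow> k = l"
  using p by (auto dest: injD)

lemma q_eq_iff [simp]: "q k = q l \<longleftrightarrow> k = l"
  using q by (auto dest: injD)

lemma pX_E:
  assumes "l \<in> pX" "S \<in> pM l" "T \<in> pM l"
  obtains k r s where "k < n" "l = p k" "S = q r" "T = q s" "r \<in> cells k" "s \<in> cells k"
  using assms by auto

lemma cc_form: "\<lbrakk>k < n; r \<in> cells k; s \<in> cells k\<rbrakk> \<Longrightarrow> linear_form (cc k r s)"
  unfolding cc_def using u_form[OF vs_V] t_form[of "vs ! r" "vs ! s"] vs_D[of r s]
  by (auto simp: cells_iff D_def)

lemma cc_cb:
  assumes "k < n" "r \<in> cells k" "s \<in> cells k" "k' < n" "r' \<in> cells k'" "s' \<in> cells k'"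
  shows "cc k r s (cb k' r' s') = (if k = k' \<and> r = r' \<and> s = s' then \<one>\<^bsub>K\<^esub> else \<zero>\<^bsub>K\<^esub>)"
proof -
  have rs: "r < n" "s < n" "r' < n" "s' < n" using assms by (auto simp: cells_iff)
  show ?thesis
  proof (cases "r = k \<and> s = k")
    case True
    then show ?thesis using assms rs by (auto simp: cc_def cb_def cells_iff)
  next
    case False
    then have D: "(vs ! r, vs ! s) \<in> D" using assms rs by (auto simp: vs_D cells_iff)
    have "t (vs ! r) (vs ! s) (cb k' r' s')
        = (if \<not> (r' = k' \<and> s' = k') \<and> r = r' \<and> s = s' then \<one>\<^bsub>K\<^esub> else \<zero>\<^bsub>K\<^esub>)"
    proof (cases "r' = k' \<and> s' = k'")
      case True
      then show ?thesis by (simp add: cb_def t_ev[OF D])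
    next
      case nd: False
      have "cb k' r' s' = ar (vs ! r') (vs ! s')" using nd by (auto simp: cb_def)
      then have "t (vs ! r) (vs ! s) (cb k' r' s') = (if r = r' \<and> s = s' then \<one>\<^bsub>K\<^esub> else \<zero>\<^bsub>K\<^esub>)"
        using t_ar[OF D, of "vs ! r'" "vs ! s'"] rs by simp
      then show ?thesis using nd by auto
    qed
    then show ?thesis using assms False by (auto simp: cc_def cells_iff)
  qed
qed

lemma zero_if_cc_zero:
  assumes a: "a \<in> carrier R" and z: "\<And>k r s. \<lbrakk>k < n; r \<in> cells k; s \<in> cells k\<rbrakk> \<Longrightarrow> cc k r s a = \<zero>\<^bsub>K\<^esub>"
  shows "a = \<zero>\<^bsub>R\<^esub>"
proof (rule zero_if_coordinates_zero[OF a])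
  fix i assume "i \<in> V"
  then obtain k where "k < n" "i = vs ! k" by (rule V_E)
  then show "u i a = \<zero>\<^bsub>K\<^esub>" using z[of k k k] by (simp add: cc_def cells_iff)
next
  fix i j assume "(i, j) \<in> A \<union> Id_on (V - VC)"
  then have D: "(i, j) \<in> D" by (simp add: D_def)
  obtain k l where k: "k < n" "i = vs ! k" "l < n" "j = vs ! l"
    using V_E D_verts[OF D] by metis
  then consider "l = Suc k" | "k = Suc l" | "k = l" "0 < k" using D vs_D[of k l] by auto
  then show "t i j a = \<zero>\<^bsub>K\<^esub>"
  proof cases
    case 1
    then show ?thesis using z[of k k l] k by (simp add: cc_def cells_iff)
  next
    case 2
    then show ?thesis using z[of l k l] k by (simp add: cc_def cells_iff)
  next
    case 3
    \<comment> \<open>The x of position k is an entry of the previous cell m.\<close>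
    then obtain m where "k = Suc m" by (auto simp: gr0_conv_Suc)
    then show ?thesis using 3(1) z[of m k k] k by (simp add: cc_def cells_iff)
  qed
qed

lemma transp_cb: "\<lbrakk>k < n; r \<in> cells k; s \<in> cells k\<rbrakk> \<Longrightarrow> transp (cb k r s) = cb k s r"
  by (simp add: cb_def transp_ev transp_ar)

lemma low_mem:
  assumes k: "k < n" and s: "s \<in> cells k" "j \<in> cells k" and a: "a \<in> carrier R"
  shows "low a k s j \<in> cell_span_less K R pX pM pC pL \<one>\<^bsub>R\<^esub> (p k)"
proof -
  let ?S = "{pC m S T | m S T. m \<in> pX \<and> (m, p k) \<in> pL \<one>\<^bsub>R\<^esub> \<and> m \<noteq> p k \<and> S \<in> pM m \<and> T \<in> pM m}"
  have S: "?S \<subseteq> carrier R" by auto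
  have gen: "cb (k - 1) r r' \<in> span ?S" if "0 < k" "r \<in> cells (k - 1)" "r' \<in> cells (k - 1)" for r r'
  proof -
    have "cb (k - 1) r r' = pC (p (k - 1)) (q r) (q r')" by simp
    moreover have "p (k - 1) \<in> pX" "(p (k - 1), p k) \<in> pL \<one>\<^bsub>R\<^esub>" "p (k - 1) \<noteq> p k"
      "q r \<in> pM (p (k - 1))" "q r' \<in> pM (p (k - 1))"
      using that k by auto
    ultimately have "cb (k - 1) r r' \<in> ?S" by blast
    then show ?thesis using in_own_span[OF S] by blast
  qed
  have "low a k s j \<in> span ?S"
  proof (cases "k = 0 \<or> j \<noteq> k")
    case True
    then show ?thesis by (simp add: low_def span_zero)
  next
    case False
    then have c: "k - 1 \<in> cells (k - 1)" "k \<in> cells (k - 1)" "0 < k" "j = k"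
      using k by (auto simp: cells_iff)
    show ?thesis
    proof (cases "s = k")
      case True
      have "t (vs ! (k - 1)) (vs ! k) a \<in> carrier K" "t (vs ! k) (vs ! k) a \<in> carrier K"
        using c k a by (auto intro!: tv_closed)
      then have "t (vs ! (k - 1)) (vs ! k) a \<odot>\<^bsub>R\<^esub> cb (k - 1) (k - 1) k \<in> span ?S"
        "t (vs ! k) (vs ! k) a \<odot>\<^bsub>R\<^esub> cb (k - 1) k k \<in> span ?S"
        using span_smult_closed[OF S] gen[OF c(3)] c by blast+
      then have "t (vs ! (k - 1)) (vs ! k) a \<odot>\<^bsub>R\<^esub> cb (k - 1) (k - 1) k
          \<oplus>\<^bsub>R\<^esub> t (vs ! k) (vs ! k) a \<odot>\<^bsub>R\<^esub> cb (k - 1) k k \<in> span ?S"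
        by (rule span_add1[OF S])
      then show ?thesis using True c by (simp add: low_def)
    next
      case s': False
      then have "Suc k < n" using s by (auto simp: cells_iff)
      then have "t (vs ! k) (vs ! Suc k) a \<in> carrier K"
        using k a by (intro tv_closed) auto
      then have "t (vs ! k) (vs ! Suc k) a \<odot>\<^bsub>R\<^esub> cb (k - 1) k k \<in> span ?S"
        using span_smult_closed[OF S] gen[OF c(3)] c by blast
      then show ?thesis using s' c by (simp add: low_def)
    qed
  qed
  then show ?thesis by (simp only: cell_span_less_def)
qed

text \<open>With the unit as only idempotent, the corner in axiom (c) is the whole algebra. The
  bound holds because \<open>mult_cb\<close> consists of a part in the cell and a part below
  it.\<close>

lemma mult_cb_mem:
  assumes k: "k < n" and s: "s \<in> cells k" "j \<in> cells k" and a: "a \<in> carrier R"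
  shows "a \<otimes>\<^bsub>R\<^esub> cb k s j \<in> cell_span_le K R pX pM pC pL \<one>\<^bsub>R\<^esub> (p k)"
proof -
  let ?S = "{pC m S T | m S T. m \<in> pX \<and> (m, p k) \<in> pL \<one>\<^bsub>R\<^esub> \<and> S \<in> pM m \<and> T \<in> pM m}"
  have S: "?S \<subseteq> carrier R" by auto
  have "low a k s j \<in> span ?S"
    using low_mem[OF k s a] unfolding cell_span_less_def
    by (rule subsetD[OF span_is_monotone, rotated]) blast
  moreover have "(\<Oplus>\<^bsub>R\<^esub>r\<in>cells k. rep a k r s \<odot>\<^bsub>R\<^esub> cb k r j) \<in> span ?S"
  proof (rule finsum_in_span[OF S], rule)
    fix r assume r: "r \<in> cells k"
    have "cb k r j = pC (p k) (q r) (q j)" by simp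
    moreover have "p k \<in> pX" "(p k, p k) \<in> pL \<one>\<^bsub>R\<^esub>" "q r \<in> pM (p k)" "q j \<in> pM (p k)"
      using k r s by auto
    ultimately have "cb k r j \<in> ?S" by blast
    then have "cb k r j \<in> span ?S" using in_own_span[OF S] by blast
    then show "rep a k r s \<odot>\<^bsub>R\<^esub> cb k r j \<in> span ?S"
      by (rule span_smult_closed[OF S rep_closed[OF k r s(1) a]])
  qed
  ultimately show ?thesis
    unfolding mult_cb[OF k s a] cell_span_le_def by (intro span_add1[OF S])
qed

lemma line_cell_datum: "relative_cell_datum K R pX pM pC transp {\<one>\<^bsub>R\<^esub>} pL (\<lambda>_ _. \<one>\<^bsub>R\<^esub>)"
proof
  let ?P = "SIGMA l:pX. pM l \<times> pM l"
  let ?b = "\<lambda>(l, S, T). pC l S T"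
  let ?F = "\<lambda>(l, S, T). cc (inv_into UNIV p l) (inv_into UNIV q S) (inv_into UNIV q T)"
  have fin: "finite ?P" by (intro finite_SigmaI) auto
  have "?b \<in> ?P \<rightarrow> carrier R" by auto
  moreover have "?F x (?b y) = (if x = y then \<one>\<^bsub>K\<^esub> else \<zero>\<^bsub>K\<^esub>)" if xy: "x \<in> ?P" "y \<in> ?P" for x y
  proof -
    obtain l S T l' S' T' where x: "x = (l, S, T)" "l \<in> pX" "S \<in> pM l" "T \<in> pM l"
      and y: "y = (l', S', T')" "l' \<in> pX" "S' \<in> pM l'" "T' \<in> pM l'" using xy by auto
    show ?thesis
      by (rule pX_E[OF x(2-4)], rule pX_E[OF y(2-4)]) (simp add: x(1) y(1) cc_cb)
  qed
  moreover have "linear_form (?F x)" if xP: "x \<in> ?P" for x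
  proof -
    obtain l S T where x: "x = (l, S, T)" "l \<in> pX" "S \<in> pM l" "T \<in> pM l" using xP by auto
    show ?thesis by (rule pX_E[OF x(2-4)]) (simp add: x(1) cc_form)
  qed
  moreover have "a = \<zero>\<^bsub>R\<^esub>" if a: "a \<in> carrier R" "\<And>x. x \<in> ?P \<Longrightarrow> ?F x a = \<zero>\<^bsub>K\<^esub>" for a
  proof (rule zero_if_cc_zero[OF a(1)])
    fix k r s assume "k < n" "r \<in> cells k" "s \<in> cells k"
    then show "cc k r s a = \<zero>\<^bsub>K\<^esub>" using a(2)[of "(p k, q r, q s)"] by simp
  qed
  ultimately show "inj_on ?b ?P" "basis (?b ` ?P)"
    using dual_basis_basis[OF fin, where F = ?F] by blast+
  show "transp (a \<oplus>\<^bsub>R\<^esub> b) = transp a \<oplus>\<^bsub>R\<^esub> transp b" if "a \<in> carrier R" "b \<in> carrier R" for a b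
    by (rule coordinates_eqI) (use that in \<open>simp_all add: u_transp t_transp u_simps t_simps D_sym\<close>)
  show "transp (r \<odot>\<^bsub>R\<^esub> a) = r \<odot>\<^bsub>R\<^esub> transp a" if "r \<in> carrier K" "a \<in> carrier R" for r a
    by (rule coordinates_eqI) (use that in \<open>simp_all add: u_transp t_transp u_simps t_simps D_sym\<close>)
  show "transp (transp a) = a" if "a \<in> carrier R" for a
    by (rule coordinates_eqI) (use that in \<open>simp_all add: u_transp t_transp D_sym\<close>)
  show "transp (a \<otimes>\<^bsub>R\<^esub> b) = transp b \<otimes>\<^bsub>R\<^esub> transp a" if "a \<in> carrier R" "b \<in> carrier R" for a b
    by (rule transp_mult[OF that])
  show "transp (pC l S T) = pC l T S" if "l \<in> pX" "S \<in> pM l" "T \<in> pM l" for l S T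
    by (rule pX_E[OF that]) (simp add: transp_cb)
  show "\<zero>\<^bsub>R\<^esub> \<notin> {\<one>\<^bsub>R\<^esub>}"
    using u_one[of "vs ! 0"] linear_form_zero[OF u_form, of "vs ! 0"] vs(3) one_not_zero by force
  show "e \<otimes>\<^bsub>R\<^esub> e = e" if "e \<in> {\<one>\<^bsub>R\<^esub>}" for e using that by simp
  show "transp e = e" if "e \<in> {\<one>\<^bsub>R\<^esub>}" for e
  proof -
    have "transp \<one>\<^bsub>R\<^esub> = \<one>\<^bsub>R\<^esub>"
      by (rule coordinates_eqI) (use t_one D_sym in \<open>auto simp: u_transp t_transp D_def[symmetric]\<close>)
    then show ?thesis using that by simp
  qed
  show "partial_order_on pX (pL e)" for e
    by (auto simp: partial_order_on_def preorder_on_def refl_on_def trans_def antisym_def)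
  show "e \<otimes>\<^bsub>R\<^esub> a \<otimes>\<^bsub>R\<^esub> e \<otimes>\<^bsub>R\<^esub> pC l S T \<in> cell_span_le K R pX pM pC pL e l"
    if "l \<in> pX" "S \<in> pM l" "T \<in> pM l" "e \<in> {\<one>\<^bsub>R\<^esub>}" "a \<in> carrier R" for l S T e a
    by (rule pX_E[OF that(1-3)]) (use that(4,5) in \<open>simp add: mult_cb_mem\<close>)
  show "e \<otimes>\<^bsub>R\<^esub> pC l S T = (if \<one>\<^bsub>R\<^esub> = e then pC l S T else \<zero>\<^bsub>R\<^esub>)"
    if "l \<in> pX" "S \<in> pM l" "T \<in> pM l" "e \<in> {\<one>\<^bsub>R\<^esub>}" for l S T e
    using that(4) by simp
  show "\<exists>r. \<forall>a\<in>carrier R. \<forall>l\<in>pX. \<forall>S\<in>pM l.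
      (\<forall>S'\<in>pM l. r a l S' S \<in> carrier K) \<and>
      (\<forall>T\<in>pM l. \<exists>y\<in>cell_span_less K R pX pM pC pL \<one>\<^bsub>R\<^esub> l.
        a \<otimes>\<^bsub>R\<^esub> pC l S T = (\<Oplus>\<^bsub>R\<^esub>S'\<in>pM l. r a l S' S \<odot>\<^bsub>R\<^esub> pC l S' T) \<oplus>\<^bsub>R\<^esub> (y \<otimes>\<^bsub>R\<^esub> \<one>\<^bsub>R\<^esub>))"
  proof (intro exI[of _ "\<lambda>a l S' S. rep a (inv_into UNIV p l) (inv_into UNIV q S') (inv_into UNIV q S)"] ballI conjI)
    fix a l S S' assume a: "a \<in> carrier R" and l: "l \<in> pX" "S \<in> pM l" "S' \<in> pM l"
    show "rep a (inv_into UNIV p l) (inv_into UNIV q S') (inv_into UNIV q S) \<in> carrier K"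
      by (rule pX_E[OF l]) (simp add: rep_closed a)
  next
    fix a l S T assume a: "a \<in> carrier R" and l: "l \<in> pX" "S \<in> pM l" "T \<in> pM l"
    obtain k s j where k: "k < n" "l = p k" "S = q s" "T = q j" "s \<in> cells k" "j \<in> cells k"
      by (rule pX_E[OF l])
    have lc: "low a k s j \<in> carrier R"
      using low_mem[OF k(1,5,6) a] unfolding cell_span_less_def by (rule span_closed[rotated]) auto
    have "(\<Oplus>\<^bsub>R\<^esub>S'\<in>pM l. rep a (inv_into UNIV p l) (inv_into UNIV q S') (inv_into UNIV q S) \<odot>\<^bsub>R\<^esub> pC l S' T)
        = (\<Oplus>\<^bsub>R\<^esub>r\<in>cells k. rep a k r s \<odot>\<^bsub>R\<^esub> cb k r j)"
      unfolding k(2-4) inv_p inv_q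
      by (subst finsum_reindex) (use k a rep_closed in \<open>auto simp: inj_on_def\<close>)
    then have "a \<otimes>\<^bsub>R\<^esub> pC l S T = (\<Oplus>\<^bsub>R\<^esub>S'\<in>pM l. rep a (inv_into UNIV p l) (inv_into UNIV q S') (inv_into UNIV q S) \<odot>\<^bsub>R\<^esub> pC l S' T)
        \<oplus>\<^bsub>R\<^esub> (low a k s j \<otimes>\<^bsub>R\<^esub> \<one>\<^bsub>R\<^esub>)"
      using mult_cb[OF k(1,5,6) a] lc k by simp
    moreover have "low a k s j \<in> cell_span_less K R pX pM pC pL \<one>\<^bsub>R\<^esub> l"
      using low_mem[OF k(1,5,6) a] by (simp only: k(2))
    ultimately show "\<exists>y\<in>cell_span_less K R pX pM pC pL \<one>\<^bsub>R\<^esub> l.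
        a \<otimes>\<^bsub>R\<^esub> pC l S T = (\<Oplus>\<^bsub>R\<^esub>S'\<in>pM l. rep a (inv_into UNIV p l) (inv_into UNIV q S') (inv_into UNIV q S) \<odot>\<^bsub>R\<^esub> pC l S' T)
          \<oplus>\<^bsub>R\<^esub> (y \<otimes>\<^bsub>R\<^esub> \<one>\<^bsub>R\<^esub>)" by blast
  qed
qed auto

end

section \<open>Quotient algebras and path algebras\<close>

lemma k_algebraI:
  fixes K :: "('k, 'm) ring_scheme" and R :: "('k, 'a, 'n) module_scheme"
  assumes "field K"
    and "\<And>a b. \<lbrakk>a \<in> carrier R; b \<in> carrier R\<rbrakk> \<Longrightarrow> a \<oplus>\<^bsub>R\<^esub> b \<in> carrier R" "\<zero>\<^bsub>R\<^esub> \<in> carrier R"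
    and "\<And>a b c. \<lbrakk>a \<in> carrier R; b \<in> carrier R; c \<in> carrier R\<rbrakk> \<Longrightarrow> (a \<oplus>\<^bsub>R\<^esub> b) \<oplus>\<^bsub>R\<^esub> c = a \<oplus>\<^bsub>R\<^esub> (b \<oplus>\<^bsub>R\<^esub> c)"
    and "\<And>a b. \<lbrakk>a \<in> carrier R; b \<in> carrier R\<rbrakk> \<Longrightarrow> a \<oplus>\<^bsub>R\<^esub> b = b \<oplus>\<^bsub>R\<^esub> a"
    and "\<And>a. a \<in> carrier R \<Longrightarrow> \<zero>\<^bsub>R\<^esub> \<oplus>\<^bsub>R\<^esub> a = a"
    and "\<And>a. a \<in> carrier R \<Longrightarrow> \<exists>b\<in>carrier R. b \<oplus>\<^bsub>R\<^esub> a = \<zero>\<^bsub>R\<^esub>"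
    and "\<And>a b. \<lbrakk>a \<in> carrier R; b \<in> carrier R\<rbrakk> \<Longrightarrow> a \<otimes>\<^bsub>R\<^esub> b \<in> carrier R" "\<one>\<^bsub>R\<^esub> \<in> carrier R"
    and "\<And>a b c. \<lbrakk>a \<in> carrier R; b \<in> carrier R; c \<in> carrier R\<rbrakk> \<Longrightarrow> (a \<otimes>\<^bsub>R\<^esub> b) \<otimes>\<^bsub>R\<^esub> c = a \<otimes>\<^bsub>R\<^esub> (b \<otimes>\<^bsub>R\<^esub> c)"
    and "\<And>a. a \<in> carrier R \<Longrightarrow> \<one>\<^bsub>R\<^esub> \<otimes>\<^bsub>R\<^esub> a = a" "\<And>a. a \<in> carrier R \<Longrightarrow> a \<otimes>\<^bsub>R\<^esub> \<one>\<^bsub>R\<^esub> = a"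
    and "\<And>a b c. \<lbrakk>a \<in> carrier R; b \<in> carrier R; c \<in> carrier R\<rbrakk> \<Longrightarrow> (a \<oplus>\<^bsub>R\<^esub> b) \<otimes>\<^bsub>R\<^esub> c = a \<otimes>\<^bsub>R\<^esub> c \<oplus>\<^bsub>R\<^esub> b \<otimes>\<^bsub>R\<^esub> c"
    and "\<And>a b c. \<lbrakk>a \<in> carrier R; b \<in> carrier R; c \<in> carrier R\<rbrakk> \<Longrightarrow> c \<otimes>\<^bsub>R\<^esub> (a \<oplus>\<^bsub>R\<^esub> b) = c \<otimes>\<^bsub>R\<^esub> a \<oplus>\<^bsub>R\<^esub> c \<otimes>\<^bsub>R\<^esub> b"
    and "\<And>r a. \<lbrakk>r \<in> carrier K; a \<in> carrier R\<rbrakk> \<Longrightarrow> r \<odot>\<^bsub>R\<^esub> a \<in> carrier R"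
    and "\<And>r s a. \<lbrakk>r \<in> carrier K; s \<in> carrier K; a \<in> carrier R\<rbrakk> \<Longrightarrow> (r \<otimes>\<^bsub>K\<^esub> s) \<odot>\<^bsub>R\<^esub> a = r \<odot>\<^bsub>R\<^esub> (s \<odot>\<^bsub>R\<^esub> a)"
    and "\<And>a. a \<in> carrier R \<Longrightarrow> \<one>\<^bsub>K\<^esub> \<odot>\<^bsub>R\<^esub> a = a"
    and "\<And>r s a. \<lbrakk>r \<in> carrier K; s \<in> carrier K; a \<in> carrier R\<rbrakk> \<Longrightarrow> (r \<oplus>\<^bsub>K\<^esub> s) \<odot>\<^bsub>R\<^esub> a = r \<odot>\<^bsub>R\<^esub> a \<oplus>\<^bsub>R\<^esub> s \<odot>\<^bsub>R\<^esub> a"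
    and "\<And>r a b. \<lbrakk>r \<in> carrier K; a \<in> carrier R; b \<in> carrier R\<rbrakk> \<Longrightarrow> r \<odot>\<^bsub>R\<^esub> (a \<oplus>\<^bsub>R\<^esub> b) = r \<odot>\<^bsub>R\<^esub> a \<oplus>\<^bsub>R\<^esub> r \<odot>\<^bsub>R\<^esub> b"
    and "\<And>r a b. \<lbrakk>r \<in> carrier K; a \<in> carrier R; b \<in> carrier R\<rbrakk> \<Longrightarrow> (r \<odot>\<^bsub>R\<^esub> a) \<otimes>\<^bsub>R\<^esub> b = r \<odot>\<^bsub>R\<^esub> (a \<otimes>\<^bsub>R\<^esub> b)"
    and "\<And>r a b. \<lbrakk>r \<in> carrier K; a \<in> carrier R; b \<in> carrier R\<rbrakk> \<Longrightarrow> a \<otimes>\<^bsub>R\<^esub> (r \<odot>\<^bsub>R\<^esub> b) = r \<odot>\<^bsub>R\<^esub> (a \<otimes>\<^bsub>R\<^esub> b)"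
  shows "k_algebra K R"
proof -
  have ag: "abelian_group R" by (rule abelian_groupI) (fact assms)+
  have mon: "monoid R" by (rule monoidI) (fact assms)+
  have "ring R" by (rule ringI[OF ag mon]) (fact assms)+
  moreover have "cring K" using assms(1) by (simp add: field_def domain_def)
  then have "module K R" by (rule moduleI[OF _ ag]) (fact assms)+
  ultimately show ?thesis
    using assms(1,20,21) by (simp add: k_algebra_def k_algebra_axioms_def vectorspace_def)
qed

text \<open>\<open>R\<close> is just a record here. The algebra laws on it are inherited through f
  in \<open>image_k_algebra\<close>, so the quotients never require computing with cosets.\<close>

locale algebra_surjection = k_algebra K A
  for K :: "('k, 'm) ring_scheme" and A :: "('k, 'a, 'n) module_scheme" +
  fixes R :: "('k, 'b, 'l) module_scheme" and f :: "'a \<Rightarrow> 'b"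
  assumes surj: "f ` carrier A = carrier R"
    and f_zero: "f \<zero>\<^bsub>A\<^esub> = \<zero>\<^bsub>R\<^esub>" and f_one: "f \<one>\<^bsub>A\<^esub> = \<one>\<^bsub>R\<^esub>"
    and f_add: "\<lbrakk>a \<in> carrier A; b \<in> carrier A\<rbrakk> \<Longrightarrow> f (a \<oplus>\<^bsub>A\<^esub> b) = f a \<oplus>\<^bsub>R\<^esub> f b"
    and f_mult: "\<lbrakk>a \<in> carrier A; b \<in> carrier A\<rbrakk> \<Longrightarrow> f (a \<otimes>\<^bsub>A\<^esub> b) = f a \<otimes>\<^bsub>R\<^esub> f b"
    and f_smult: "\<lbrakk>r \<in> carrier K; a \<in> carrier A\<rbrakk> \<Longrightarrow> f (r \<odot>\<^bsub>A\<^esub> a) = r \<odot>\<^bsub>R\<^esub> f a"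
begin

lemma f_closed [simp]: "a \<in> carrier A \<Longrightarrow> f a \<in> carrier R"
  using surj by blast

lemma lift:
  assumes "x \<in> carrier R"
  obtains a where "a \<in> carrier A" "x = f a"
  using assms surj by blast

lemma image_k_algebra: "k_algebra K R"
proof (rule k_algebraI)
  show "field K" by (rule field_axioms)
  show "\<exists>b\<in>carrier R. b \<oplus>\<^bsub>R\<^esub> x = \<zero>\<^bsub>R\<^esub>" if x: "x \<in> carrier R" for x
  proof -
    obtain a where a: "a \<in> carrier A" "x = f a" using lift[OF x] .
    have "f (\<ominus>\<^bsub>A\<^esub> a) \<oplus>\<^bsub>R\<^esub> x = \<zero>\<^bsub>R\<^esub>" using a by (simp add: f_add[symmetric] f_zero M.l_neg)
    then show ?thesis using a(1) by (intro bexI[of _ "f (\<ominus>\<^bsub>A\<^esub> a)"]) auto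
  qed
  note fs = f_add[symmetric] f_mult[symmetric] f_smult[symmetric] f_zero[symmetric] f_one[symmetric]
  fix x assume x: "x \<in> carrier R"
  obtain a where a: "a \<in> carrier A" "x = f a" using lift[OF x] .
  show "\<zero>\<^bsub>R\<^esub> \<oplus>\<^bsub>R\<^esub> x = x" "\<one>\<^bsub>R\<^esub> \<otimes>\<^bsub>R\<^esub> x = x" "x \<otimes>\<^bsub>R\<^esub> \<one>\<^bsub>R\<^esub> = x" "\<one>\<^bsub>K\<^esub> \<odot>\<^bsub>R\<^esub> x = x"
    using a by (simp_all add: fs)
  {
    fix r assume r: "r \<in> carrier K"
    show "r \<odot>\<^bsub>R\<^esub> x \<in> carrier R" using a r by (simp add: fs)
    fix s assume s: "s \<in> carrier K"
    show "(r \<otimes>\<^bsub>K\<^esub> s) \<odot>\<^bsub>R\<^esub> x = r \<odot>\<^bsub>R\<^esub> (s \<odot>\<^bsub>R\<^esub> x)" "(r \<oplus>\<^bsub>K\<^esub> s) \<odot>\<^bsub>R\<^esub> x = r \<odot>\<^bsub>R\<^esub> x \<oplus>\<^bsub>R\<^esub> s \<odot>\<^bsub>R\<^esub> x"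
      using a r s by (simp_all add: fs smult_assoc1 smult_l_distr)
  }
  fix y assume y: "y \<in> carrier R"
  obtain b where b: "b \<in> carrier A" "y = f b" using lift[OF y] .
  show "x \<oplus>\<^bsub>R\<^esub> y \<in> carrier R" "x \<otimes>\<^bsub>R\<^esub> y \<in> carrier R" using a b by (simp_all add: fs)
  show "x \<oplus>\<^bsub>R\<^esub> y = y \<oplus>\<^bsub>R\<^esub> x" using a b by (simp add: fs M.a_comm)
  {
    fix r assume r: "r \<in> carrier K"
    show "r \<odot>\<^bsub>R\<^esub> (x \<oplus>\<^bsub>R\<^esub> y) = r \<odot>\<^bsub>R\<^esub> x \<oplus>\<^bsub>R\<^esub> r \<odot>\<^bsub>R\<^esub> y" "(r \<odot>\<^bsub>R\<^esub> x) \<otimes>\<^bsub>R\<^esub> y = r \<odot>\<^bsub>R\<^esub> (x \<otimes>\<^bsub>R\<^esub> y)"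
      "x \<otimes>\<^bsub>R\<^esub> (r \<odot>\<^bsub>R\<^esub> y) = r \<odot>\<^bsub>R\<^esub> (x \<otimes>\<^bsub>R\<^esub> y)"
      using a b r by (simp_all add: fs smult_r_distr smult_mult_left smult_mult_right)
  }
  fix z assume z: "z \<in> carrier R"
  obtain c where c: "c \<in> carrier A" "z = f c" using lift[OF z] .
  show "(x \<oplus>\<^bsub>R\<^esub> y) \<oplus>\<^bsub>R\<^esub> z = x \<oplus>\<^bsub>R\<^esub> (y \<oplus>\<^bsub>R\<^esub> z)" "(x \<otimes>\<^bsub>R\<^esub> y) \<otimes>\<^bsub>R\<^esub> z = x \<otimes>\<^bsub>R\<^esub> (y \<otimes>\<^bsub>R\<^esub> z)"
    "(x \<oplus>\<^bsub>R\<^esub> y) \<otimes>\<^bsub>R\<^esub> z = x \<otimes>\<^bsub>R\<^esub> z \<oplus>\<^bsub>R\<^esub> y \<otimes>\<^bsub>R\<^esub> z" "z \<otimes>\<^bsub>R\<^esub> (x \<oplus>\<^bsub>R\<^esub> y) = z \<otimes>\<^bsub>R\<^esub> x \<oplus>\<^bsub>R\<^esub> z \<otimes>\<^bsub>R\<^esub> y"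
    using a b c by (simp_all add: fs M.a_assoc m_assoc l_distr r_distr)
next
  show "\<zero>\<^bsub>R\<^esub> \<in> carrier R" "\<one>\<^bsub>R\<^esub> \<in> carrier R" by (simp_all add: f_zero[symmetric] f_one[symmetric])
qed

end

text \<open>The union in the scalar multiplication of \<open>quot_alg\<close> is a single coset,
  because r i = (r 1) i stays in the ideal.\<close>

lemma (in k_algebra) quot_alg_surjection:
  assumes "ideal I R"
  shows "algebra_surjection K R (quot_alg R I) (\<lambda>a. I +>\<^bsub>R\<^esub> a)"
proof -
  interpret I: ideal I R by (rule assms)
  have sm: "(\<Union>b\<in>I +>\<^bsub>R\<^esub> a. I +>\<^bsub>R\<^esub> (r \<odot>\<^bsub>R\<^esub> b)) = I +>\<^bsub>R\<^esub> (r \<odot>\<^bsub>R\<^esub> a)"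
    if r: "r \<in> carrier K" and a: "a \<in> carrier R" for r a
  proof -
    have ra: "I +>\<^bsub>R\<^esub> (r \<odot>\<^bsub>R\<^esub> b) = I +>\<^bsub>R\<^esub> (r \<odot>\<^bsub>R\<^esub> a)" if b: "b \<in> I +>\<^bsub>R\<^esub> a" for b
    proof -
      obtain i where i: "i \<in> I" "b = i \<oplus>\<^bsub>R\<^esub> a" using b by (auto simp: a_r_coset_def')
      have ic: "i \<in> carrier R" by (rule I.Icarr[OF i(1)])
      have bc: "b \<in> carrier R" using i ic a by simp
      have "r \<odot>\<^bsub>R\<^esub> b \<ominus>\<^bsub>R\<^esub> r \<odot>\<^bsub>R\<^esub> a = (r \<odot>\<^bsub>R\<^esub> \<one>\<^bsub>R\<^esub>) \<otimes>\<^bsub>R\<^esub> i"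
        using r a ic by (simp add: i(2) smult_r_distr M.minus_eq M.a_assoc M.r_neg smult_mult_left)
      moreover have "(r \<odot>\<^bsub>R\<^esub> \<one>\<^bsub>R\<^esub>) \<otimes>\<^bsub>R\<^esub> i \<in> I" by (rule I.I_l_closed[OF i(1)]) (use r in simp)
      ultimately show ?thesis
        using quotient_eq_iff_same_a_r_cos[OF assms, of "r \<odot>\<^bsub>R\<^esub> b" "r \<odot>\<^bsub>R\<^esub> a"] r a bc by simp
    qed
    moreover have "a \<in> I +>\<^bsub>R\<^esub> a" by (rule I.a_rcos_self[OF a])
    ultimately show ?thesis by blast
  qed
  show ?thesis
  proof (intro algebra_surjection.intro algebra_surjection_axioms.intro)
    show "k_algebra K R" by (rule k_algebra_axioms)
    show "(\<lambda>a. I +>\<^bsub>R\<^esub> a) ` carrier R = carrier (quot_alg R I)"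
      by (auto simp: quot_alg_def FactRing_def A_RCOSETS_def')
    show "I +>\<^bsub>R\<^esub> \<zero>\<^bsub>R\<^esub> = \<zero>\<^bsub>quot_alg R I\<^esub>"
      by (simp add: quot_alg_def FactRing_def a_coset_add_zero I.a_subset)
    show "I +>\<^bsub>R\<^esub> \<one>\<^bsub>R\<^esub> = \<one>\<^bsub>quot_alg R I\<^esub>" by (simp add: quot_alg_def FactRing_def)
    show "I +>\<^bsub>R\<^esub> (a \<oplus>\<^bsub>R\<^esub> b) = (I +>\<^bsub>R\<^esub> a) \<oplus>\<^bsub>quot_alg R I\<^esub> (I +>\<^bsub>R\<^esub> b)"
      if "a \<in> carrier R" "b \<in> carrier R" for a b
      using that by (simp add: quot_alg_def FactRing_def I.a_rcos_sum)
    show "I +>\<^bsub>R\<^esub> (a \<otimes>\<^bsub>R\<^esub> b) = (I +>\<^bsub>R\<^esub> a) \<otimes>\<^bsub>quot_alg R I\<^esub> (I +>\<^bsub>R\<^esub> b)"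
      if "a \<in> carrier R" "b \<in> carrier R" for a b
      using that by (simp add: quot_alg_def FactRing_def I.rcoset_mult_add)
    show "I +>\<^bsub>R\<^esub> (r \<odot>\<^bsub>R\<^esub> a) = r \<odot>\<^bsub>quot_alg R I\<^esub> (I +>\<^bsub>R\<^esub> a)"
      if "r \<in> carrier K" "a \<in> carrier R" for r a
      using sm[OF that] by (simp add: quot_alg_def)
  qed
qed

lemma vwalk_arcs_zip: "vwalk_arcs p = zip p (tl p)"
  by (induction p rule: vwalk_arcs.induct) auto

lemma vwalk_arcs_conv: "set (vwalk_arcs p) = {(p ! i, p ! Suc i) | i. Suc i < length p}"
  by (auto simp: vwalk_arcs_zip set_zip nth_tl less_diff_conv)

text \<open>The convolution of \<open>path_algebra\<close> is defined on all lists; gluing two walks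
  at a shared vertex is what keeps its support on walks.\<close>

lemma vwalk_split:
  assumes "vwalk (take (Suc k) p) G" "vwalk (drop k p) G" "k < length p"
  shows "vwalk p G"
proof -
  have s1: "set p \<subseteq> verts G"
    using assms(1,2) set_append[of "take (Suc k) p" "drop (Suc k) p"] set_drop_subset_set_drop[of k "Suc k" p]
    by (auto simp: vwalk_def)
  have "(p ! i, p ! Suc i) \<in> arcs_ends G" if i: "Suc i < length p" for i
  proof (cases "i < k")
    case True
    then have "(take (Suc k) p ! i, take (Suc k) p ! Suc i) \<in> set (vwalk_arcs (take (Suc k) p))"
      unfolding vwalk_arcs_conv using i True by (intro CollectI exI[of _ i]) auto
    then show ?thesis using assms(1) True by (auto simp: vwalk_def)
  next
    case False
    then have "(drop k p ! (i - k), drop k p ! Suc (i - k)) \<in> set (vwalk_arcs (drop k p))"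
      unfolding vwalk_arcs_conv using i False by (intro CollectI exI[of _ "i - k"]) auto
    then show ?thesis using assms(2) False i by (auto simp: vwalk_def)
  qed
  then have "set (vwalk_arcs p) \<subseteq> arcs_ends G" unfolding vwalk_arcs_conv by auto
  then show ?thesis using s1 assms(3) by (auto simp: vwalk_def)
qed

lemma (in abelian_monoid) finsum_swap:
  assumes "finite B" "\<And>a b. \<lbrakk>a \<in> A; b \<in> B\<rbrakk> \<Longrightarrow> f a b \<in> carrier G"
  shows "(\<Oplus>a\<in>A. \<Oplus>b\<in>B. f a b) = (\<Oplus>b\<in>B. \<Oplus>a\<in>A. f a b)"
  using assms(2)
proof (induction A rule: infinite_finite_induct)
  case (insert x F)
  have c: "(\<Oplus>b\<in>B. f a b) \<in> carrier G" if "a \<in> insert x F" for a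
    by (rule finsum_closed) (use insert(4) that in auto)
  have d: "(\<Oplus>a\<in>F. f a b) \<in> carrier G" if "b \<in> B" for b
    by (rule finsum_closed) (use insert(4) that in auto)
  have "(\<Oplus>a\<in>insert x F. \<Oplus>b\<in>B. f a b) = (\<Oplus>b\<in>B. f x b) \<oplus> (\<Oplus>a\<in>F. \<Oplus>b\<in>B. f a b)"
    by (rule finsum_insert) (use insert(1,2) c in auto)
  also have "\<dots> = (\<Oplus>b\<in>B. f x b) \<oplus> (\<Oplus>b\<in>B. \<Oplus>a\<in>F. f a b)" using insert by simp
  also have "\<dots> = (\<Oplus>b\<in>B. f x b \<oplus> (\<Oplus>a\<in>F. f a b))"
    by (rule finsum_addf[symmetric]) (use insert(4) d in auto)
  also have "\<dots> = (\<Oplus>b\<in>B. \<Oplus>a\<in>insert x F. f a b)"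
    by (rule finsum_cong', rule refl) (use insert d in \<open>auto intro!: finsum_insert[symmetric] finsum_closed\<close>)
  finally show ?case .
qed auto

section \<open>Path algebras as associative unital algebras\<close>

locale path_alg = field K
  for K :: "('k, 'm) ring_scheme" (structure) and Q :: "'v pair_pre_digraph"
begin

abbreviation "P \<equiv> path_algebra K Q"
abbreviation "walk p \<equiv> vwalk p (with_proj Q)"

lemma P_simps:
  "carrier P = {f. (\<forall>p. f p \<in> carrier K) \<and> (\<forall>p. \<not> walk p \<longrightarrow> f p = \<zero>) \<and> finite {p. f p \<noteq> \<zero>}}"
  "(f \<otimes>\<^bsub>P\<^esub> g) p = (\<Oplus>k\<in>{..<length p}. f (take (Suc k) p) \<otimes> g (drop k p))"
  "\<one>\<^bsub>P\<^esub> = (\<lambda>p. if \<exists>i\<in>pverts Q. p = [i] then \<one> else \<zero>)"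
  "\<zero>\<^bsub>P\<^esub> = (\<lambda>p. \<zero>)" "(f \<oplus>\<^bsub>P\<^esub> g) p = f p \<oplus> g p" "(r \<odot>\<^bsub>P\<^esub> f) p = r \<otimes> f p"
  by (simp_all add: path_algebra_def)

lemma P_D:
  assumes "f \<in> carrier P"
  shows "f p \<in> carrier K" "\<not> walk p \<Longrightarrow> f p = \<zero>" "finite {p. f p \<noteq> \<zero>}"
  using assms by (auto simp: P_simps)

lemma P_I:
  assumes "\<And>p. f p \<in> carrier K" "\<And>p. \<not> walk p \<Longrightarrow> f p = \<zero>" "{p. f p \<noteq> \<zero>} \<subseteq> S" "finite S"
  shows "f \<in> carrier P"
  using assms finite_subset by (auto simp: P_simps)

lemma P_mult_closed:
  assumes f: "f \<in> carrier P" and g: "g \<in> carrier P"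
  shows "f \<otimes>\<^bsub>P\<^esub> g \<in> carrier P"
proof (rule P_I)
  note fc = P_D(1)[OF f] and gc = P_D(1)[OF g]
  show "(f \<otimes>\<^bsub>P\<^esub> g) p \<in> carrier K" for p unfolding P_simps by (rule finsum_closed) (simp add: fc gc)
  have sup: "\<exists>k<length p. f (take (Suc k) p) \<noteq> \<zero> \<and> g (drop k p) \<noteq> \<zero>" if "(f \<otimes>\<^bsub>P\<^esub> g) p \<noteq> \<zero>" for p
  proof (rule ccontr)
    assume no: "\<not> ?thesis"
    have "(f \<otimes>\<^bsub>P\<^esub> g) p = (\<Oplus>k\<in>{..<length p}. \<zero>)"
      unfolding P_simps
    proof (rule finsum_cong', rule refl)
      fix k assume "k \<in> {..<length p}"
      then have "f (take (Suc k) p) = \<zero> \<or> g (drop k p) = \<zero>" using no by auto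
      then show "f (take (Suc k) p) \<otimes> g (drop k p) = \<zero>" using fc gc by auto
    qed auto
    then show False using that by simp
  qed
  show "(f \<otimes>\<^bsub>P\<^esub> g) p = \<zero>" if "\<not> walk p" for p
  proof (rule ccontr)
    assume "(f \<otimes>\<^bsub>P\<^esub> g) p \<noteq> \<zero>"
    then obtain k where "k < length p" "f (take (Suc k) p) \<noteq> \<zero>" "g (drop k p) \<noteq> \<zero>" using sup by blast
    then show False using vwalk_split[of k p] P_D(2)[OF f] P_D(2)[OF g] that by blast
  qed
  \<comment> \<open>Each path in the support is glued from one path of each factor;
    \<open>tl\<close> removes the second copy of the shared vertex.\<close>
  show "{p. (f \<otimes>\<^bsub>P\<^esub> g) p \<noteq> \<zero>} \<subseteq> (\<lambda>(x, y). x @ tl y) ` ({p. f p \<noteq> \<zero>} \<times> {p. g p \<noteq> \<zero>})"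
  proof
    fix p assume "p \<in> {p. (f \<otimes>\<^bsub>P\<^esub> g) p \<noteq> \<zero>}"
    then obtain k where k: "f (take (Suc k) p) \<noteq> \<zero>" "g (drop k p) \<noteq> \<zero>" using sup by blast
    have "p = take (Suc k) p @ tl (drop k p)" by (metis append_take_drop_id drop_Suc tl_drop)
    then show "p \<in> (\<lambda>(x, y). x @ tl y) ` ({p. f p \<noteq> \<zero>} \<times> {p. g p \<noteq> \<zero>})"
      using k by (intro image_eqI[where x = "(take (Suc k) p, drop k p)"]) auto
  qed
  show "finite ((\<lambda>(x, y). x @ tl y) ` ({p. f p \<noteq> \<zero>} \<times> {p. g p \<noteq> \<zero>}))"
    using P_D(3)[OF f] P_D(3)[OF g] by blast
qed

lemma P_mult_assoc:
  assumes f: "f \<in> carrier P" and g: "g \<in> carrier P" and h: "h \<in> carrier P"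
  shows "(f \<otimes>\<^bsub>P\<^esub> g) \<otimes>\<^bsub>P\<^esub> h = f \<otimes>\<^bsub>P\<^esub> (g \<otimes>\<^bsub>P\<^esub> h)"
proof
  fix p :: "'v list"
  note fc [simp] = P_D(1)[OF f] and gc [simp] = P_D(1)[OF g] and hc [simp] = P_D(1)[OF h]
  let ?n = "length p"
  \<comment> \<open>The summand for cutting p at m and at k. Padding with zero for m > k turns both
    bracketings into sums over the same square, taken in the two orders.\<close>
  define T where "T = (\<lambda>m k. if m \<le> k then f (take (Suc m) p) \<otimes> g (drop m (take (Suc k) p)) \<otimes> h (drop k p) else \<zero>)"
  have T [simp]: "T m k \<in> carrier K" for m k by (simp add: T_def)
  have "((f \<otimes>\<^bsub>P\<^esub> g) \<otimes>\<^bsub>P\<^esub> h) p = (\<Oplus>k\<in>{..<?n}. \<Oplus>m\<in>{..<?n}. T m k)"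
    unfolding P_simps(2)[of "f \<otimes>\<^bsub>P\<^esub> g"]
  proof (rule finsum_cong', rule refl)
    fix k assume k: "k \<in> {..<?n}"
    have "(f \<otimes>\<^bsub>P\<^esub> g) (take (Suc k) p) \<otimes> h (drop k p)
        = (\<Oplus>m\<in>{..<Suc k}. f (take (Suc m) (take (Suc k) p)) \<otimes> g (drop m (take (Suc k) p))) \<otimes> h (drop k p)"
      using k by (simp add: P_simps min_absorb2)
    also have "\<dots> = (\<Oplus>m\<in>{..<Suc k}. f (take (Suc m) (take (Suc k) p)) \<otimes> g (drop m (take (Suc k) p)) \<otimes> h (drop k p))"
      by (rule finsum_ldistr) auto
    also have "\<dots> = (\<Oplus>m\<in>{..<?n}. T m k)"
      by (rule add.finprod_mono_neutral_cong_left) (use k in \<open>auto simp: T_def min_absorb1\<close>)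
    finally show "(f \<otimes>\<^bsub>P\<^esub> g) (take (Suc k) p) \<otimes> h (drop k p) = (\<Oplus>m\<in>{..<?n}. T m k)" .
  qed (auto intro!: finsum_closed)
  also have "\<dots> = (\<Oplus>m\<in>{..<?n}. \<Oplus>k\<in>{..<?n}. T m k)" by (rule finsum_swap) auto
  also have "\<dots> = (f \<otimes>\<^bsub>P\<^esub> (g \<otimes>\<^bsub>P\<^esub> h)) p"
    unfolding P_simps(2)[of f]
  proof (rule finsum_cong', rule refl)
    fix m assume m: "m \<in> {..<?n}"
    have "f (take (Suc m) p) \<otimes> (g \<otimes>\<^bsub>P\<^esub> h) (drop m p)
        = f (take (Suc m) p) \<otimes> (\<Oplus>j\<in>{..<?n - m}. g (take (Suc j) (drop m p)) \<otimes> h (drop j (drop m p)))"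
      by (simp add: P_simps)
    also have "\<dots> = (\<Oplus>j\<in>{..<?n - m}. f (take (Suc m) p) \<otimes> (g (take (Suc j) (drop m p)) \<otimes> h (drop j (drop m p))))"
      by (rule finsum_rdistr) auto
    also have "\<dots> = (\<Oplus>j\<in>{..<?n - m}. T m (m + j))"
      by (rule finsum_cong') (auto simp: T_def m_assoc take_drop add.commute)
    also have "\<dots> = (\<Oplus>k\<in>(\<lambda>j. m + j) ` {..<?n - m}. T m k)"
      by (rule finsum_reindex[symmetric]) auto
    also have "\<dots> = (\<Oplus>k\<in>{..<?n}. T m k)"
    proof (rule add.finprod_mono_neutral_cong_left)
      fix k assume k: "k \<in> {..<?n} - (\<lambda>j. m + j) ` {..<?n - m}"
      have "\<not> m \<le> k"
      proof
        assume "m \<le> k"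
        then have "k = m + (k - m)" "k - m \<in> {..<?n - m}" using k by auto
        then show False using k by blast
      qed
      then show "T m k = \<zero>" by (simp add: T_def)
    qed auto
    finally show "(\<Oplus>k\<in>{..<?n}. T m k) = f (take (Suc m) p) \<otimes> (g \<otimes>\<^bsub>P\<^esub> h) (drop m p)" by simp
  next
    show "(\<lambda>m. f (take (Suc m) p) \<otimes> (g \<otimes>\<^bsub>P\<^esub> h) (drop m p)) \<in> {..<?n} \<rightarrow> carrier K"
      using P_D(1)[OF P_mult_closed[OF g h]] by auto
  qed
  finally show "((f \<otimes>\<^bsub>P\<^esub> g) \<otimes>\<^bsub>P\<^esub> h) p = (f \<otimes>\<^bsub>P\<^esub> (g \<otimes>\<^bsub>P\<^esub> h)) p" .
qed

lemma walk_ends: "walk p \<Longrightarrow> p \<noteq> [] \<and> hd p \<in> pverts Q \<and> last p \<in> pverts Q"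
  by (auto simp: vwalk_def)

lemma P_one_mult:
  assumes f: "f \<in> carrier P"
  shows "\<one>\<^bsub>P\<^esub> \<otimes>\<^bsub>P\<^esub> f = f"
proof
  fix p :: "'v list"
  note fc [simp] = P_D(1)[OF f]
  show "(\<one>\<^bsub>P\<^esub> \<otimes>\<^bsub>P\<^esub> f) p = f p"
  proof (cases "p = []")
    case True
    moreover have "f [] = \<zero>" using P_D(2)[OF f, of "[]"] walk_ends[of "[]"] by blast
    ultimately show ?thesis by (simp add: P_simps)
  next
    case False
    have "(\<one>\<^bsub>P\<^esub> \<otimes>\<^bsub>P\<^esub> f) p = (\<Oplus>k\<in>{..<length p}. if 0 = k then (if hd p \<in> pverts Q then f p else \<zero>) else \<zero>)"
      unfolding P_simps(2)
    proof (rule finsum_cong', rule refl)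
      fix k assume k: "k \<in> {..<length p}"
      have "(\<exists>i\<in>pverts Q. take (Suc k) p = [i]) \<longleftrightarrow> k = 0 \<and> hd p \<in> pverts Q"
        using k False by (cases p; cases k) auto
      then show "\<one>\<^bsub>P\<^esub> (take (Suc k) p) \<otimes> f (drop k p)
        = (if 0 = k then (if hd p \<in> pverts Q then f p else \<zero>) else \<zero>)"
        by (auto simp: P_simps)
    qed auto
    also have "\<dots> = (if hd p \<in> pverts Q then f p else \<zero>)"
      by (rule finsum_singleton) (use False in auto)
    finally have *: "(\<one>\<^bsub>P\<^esub> \<otimes>\<^bsub>P\<^esub> f) p = (if hd p \<in> pverts Q then f p else \<zero>)" .
    have "hd p \<notin> pverts Q \<Longrightarrow> f p = \<zero>" using P_D(2)[OF f, of p] walk_ends[of p] by blast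
    then show ?thesis using * by simp
  qed
qed

lemma P_mult_one:
  assumes f: "f \<in> carrier P"
  shows "f \<otimes>\<^bsub>P\<^esub> \<one>\<^bsub>P\<^esub> = f"
proof
  fix p :: "'v list"
  note fc [simp] = P_D(1)[OF f]
  show "(f \<otimes>\<^bsub>P\<^esub> \<one>\<^bsub>P\<^esub>) p = f p"
  proof (cases "p = []")
    case True
    moreover have "f [] = \<zero>" using P_D(2)[OF f, of "[]"] walk_ends[of "[]"] by blast
    ultimately show ?thesis by (simp add: P_simps)
  next
    case False
    have "(f \<otimes>\<^bsub>P\<^esub> \<one>\<^bsub>P\<^esub>) p
        = (\<Oplus>k\<in>{..<length p}. if length p - 1 = k then (if last p \<in> pverts Q then f p else \<zero>) else \<zero>)"
      unfolding P_simps(2)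
    proof (rule finsum_cong', rule refl)
      fix k assume k: "k \<in> {..<length p}"
      have "(\<exists>i\<in>pverts Q. drop k p = [i]) \<longleftrightarrow> length p - 1 = k \<and> last p \<in> pverts Q"
      proof (cases "length p - 1 = k")
        case True
        then have "drop k p = [last p]"
          using False by (cases p rule: rev_cases) auto
        then show ?thesis using True by simp
      next
        case ne: False
        then have "length (drop k p) \<noteq> length [i]" for i :: 'v using k by simp
        then have "drop k p \<noteq> [i]" for i by metis
        then show ?thesis using ne by simp
      qed
      then show "f (take (Suc k) p) \<otimes> \<one>\<^bsub>P\<^esub> (drop k p)
        = (if length p - 1 = k then (if last p \<in> pverts Q then f p else \<zero>) else \<zero>)"
        using False by (auto simp: P_simps)
    qed auto
    also have "\<dots> = (if last p \<in> pverts Q then f p else \<zero>)"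
      by (rule finsum_singleton) (use False in auto)
    finally have *: "(f \<otimes>\<^bsub>P\<^esub> \<one>\<^bsub>P\<^esub>) p = (if last p \<in> pverts Q then f p else \<zero>)" .
    have "last p \<notin> pverts Q \<Longrightarrow> f p = \<zero>" using P_D(2)[OF f, of p] walk_ends[of p] by blast
    then show ?thesis using * by simp
  qed
qed

lemma P_one_closed:
  assumes "finite (pverts Q)"
  shows "\<one>\<^bsub>P\<^esub> \<in> carrier P"
proof (rule P_I)
  show "\<one>\<^bsub>P\<^esub> p = \<zero>" if "\<not> walk p" for p
    using that by (auto simp: P_simps vwalk_def)
  show "{p. \<one>\<^bsub>P\<^esub> p \<noteq> \<zero>} \<subseteq> (\<lambda>i. [i]) ` pverts Q" by (auto simp: P_simps)
qed (use assms in \<open>auto simp: P_simps\<close>)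

lemma P_add_closed: "\<lbrakk>f \<in> carrier P; g \<in> carrier P\<rbrakk> \<Longrightarrow> f \<oplus>\<^bsub>P\<^esub> g \<in> carrier P"
  by (rule P_I[where S = "{p. f p \<noteq> \<zero>} \<union> {p. g p \<noteq> \<zero>}"]) (auto simp: P_simps(5) P_D)

lemma P_smult_closed: "\<lbrakk>r \<in> carrier K; f \<in> carrier P\<rbrakk> \<Longrightarrow> r \<odot>\<^bsub>P\<^esub> f \<in> carrier P"
  by (rule P_I[where S = "{p. f p \<noteq> \<zero>}"]) (auto simp: P_simps(6) P_D)

lemma P_k_algebra:
  assumes fin: "finite (pverts Q)"
  shows "k_algebra K P"
proof (rule k_algebraI[OF field_axioms P_add_closed _ _ _ _ _ P_mult_closed P_one_closed[OF fin]
      P_mult_assoc P_one_mult P_mult_one])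
  show "\<zero>\<^bsub>P\<^esub> \<in> carrier P" by (simp add: P_simps)
  show "f \<oplus>\<^bsub>P\<^esub> g \<oplus>\<^bsub>P\<^esub> h = f \<oplus>\<^bsub>P\<^esub> (g \<oplus>\<^bsub>P\<^esub> h)" if "f \<in> carrier P" "g \<in> carrier P" "h \<in> carrier P" for f g h
    by (rule ext) (simp add: P_simps(5) a_assoc P_D(1)[OF that(1)] P_D(1)[OF that(2)] P_D(1)[OF that(3)])
  show "f \<oplus>\<^bsub>P\<^esub> g = g \<oplus>\<^bsub>P\<^esub> f" if "f \<in> carrier P" "g \<in> carrier P" for f g
    by (rule ext) (simp add: P_simps(5) a_comm P_D(1)[OF that(1)] P_D(1)[OF that(2)])
  show "\<zero>\<^bsub>P\<^esub> \<oplus>\<^bsub>P\<^esub> f = f" if "f \<in> carrier P" for f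
    by (rule ext) (simp add: P_simps(4,5) P_D(1)[OF that])
  show "\<exists>g\<in>carrier P. g \<oplus>\<^bsub>P\<^esub> f = \<zero>\<^bsub>P\<^esub>" if f: "f \<in> carrier P" for f
  proof
    show "(\<ominus> \<one>) \<odot>\<^bsub>P\<^esub> f \<in> carrier P" by (rule P_smult_closed[OF _ f]) simp
    show "(\<ominus> \<one>) \<odot>\<^bsub>P\<^esub> f \<oplus>\<^bsub>P\<^esub> f = \<zero>\<^bsub>P\<^esub>"
      by (rule ext) (simp add: P_simps(4,5,6) P_D(1)[OF f] l_minus l_neg)
  qed
  show "(f \<oplus>\<^bsub>P\<^esub> g) \<otimes>\<^bsub>P\<^esub> h = f \<otimes>\<^bsub>P\<^esub> h \<oplus>\<^bsub>P\<^esub> g \<otimes>\<^bsub>P\<^esub> h"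
    if "f \<in> carrier P" "g \<in> carrier P" "h \<in> carrier P" for f g h
  proof
    fix p
    note c [simp] = P_D(1)[OF that(1)] P_D(1)[OF that(2)] P_D(1)[OF that(3)]
    show "((f \<oplus>\<^bsub>P\<^esub> g) \<otimes>\<^bsub>P\<^esub> h) p = (f \<otimes>\<^bsub>P\<^esub> h \<oplus>\<^bsub>P\<^esub> g \<otimes>\<^bsub>P\<^esub> h) p"
      by (simp add: P_simps(2,5) l_distr)
  qed
  show "h \<otimes>\<^bsub>P\<^esub> (f \<oplus>\<^bsub>P\<^esub> g) = h \<otimes>\<^bsub>P\<^esub> f \<oplus>\<^bsub>P\<^esub> h \<otimes>\<^bsub>P\<^esub> g"
    if "f \<in> carrier P" "g \<in> carrier P" "h \<in> carrier P" for f g h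
  proof
    fix p
    note c [simp] = P_D(1)[OF that(1)] P_D(1)[OF that(2)] P_D(1)[OF that(3)]
    show "(h \<otimes>\<^bsub>P\<^esub> (f \<oplus>\<^bsub>P\<^esub> g)) p = (h \<otimes>\<^bsub>P\<^esub> f \<oplus>\<^bsub>P\<^esub> h \<otimes>\<^bsub>P\<^esub> g) p"
      by (simp add: P_simps(2,5) r_distr)
  qed
  show "r \<odot>\<^bsub>P\<^esub> f \<in> carrier P" if "r \<in> carrier K" "f \<in> carrier P" for r f by (rule P_smult_closed[OF that])
  show "(r \<otimes> s) \<odot>\<^bsub>P\<^esub> f = r \<odot>\<^bsub>P\<^esub> (s \<odot>\<^bsub>P\<^esub> f)" "(r \<oplus> s) \<odot>\<^bsub>P\<^esub> f = r \<odot>\<^bsub>P\<^esub> f \<oplus>\<^bsub>P\<^esub> s \<odot>\<^bsub>P\<^esub> f"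
    if "r \<in> carrier K" "s \<in> carrier K" "f \<in> carrier P" for r s f
    by (rule ext; simp add: P_simps(5,6) m_assoc l_distr that P_D(1)[OF that(3)])+
  show "\<one> \<odot>\<^bsub>P\<^esub> f = f" if "f \<in> carrier P" for f
    by (rule ext) (simp add: P_simps(6) P_D(1)[OF that])
  show "r \<odot>\<^bsub>P\<^esub> (f \<oplus>\<^bsub>P\<^esub> g) = r \<odot>\<^bsub>P\<^esub> f \<oplus>\<^bsub>P\<^esub> r \<odot>\<^bsub>P\<^esub> g"
    if "r \<in> carrier K" "f \<in> carrier P" "g \<in> carrier P" for r f g
    by (rule ext) (simp add: P_simps(5,6) r_distr that(1) P_D(1)[OF that(2)] P_D(1)[OF that(3)])
  show "r \<odot>\<^bsub>P\<^esub> f \<otimes>\<^bsub>P\<^esub> g = r \<odot>\<^bsub>P\<^esub> (f \<otimes>\<^bsub>P\<^esub> g)" "f \<otimes>\<^bsub>P\<^esub> (r \<odot>\<^bsub>P\<^esub> g) = r \<odot>\<^bsub>P\<^esub> (f \<otimes>\<^bsub>P\<^esub> g)"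
    if "r \<in> carrier K" "f \<in> carrier P" "g \<in> carrier P" for r f g
    by (rule ext; simp add: P_simps(2,6) that(1) P_D(1)[OF that(2)] P_D(1)[OF that(3)]
      finsum_rdistr m_assoc m_lcomm)+
qed

lemma path_elem_closed: "walk p \<Longrightarrow> path_elem K p \<in> carrier P"
  by (rule P_I[where S = "{p}"]) (auto simp: path_elem_def)

text \<open>The two pieces determine both the list and the place of the cut, so exactly one term of
  the convolution survives.\<close>

lemma path_elem_split:
  assumes "walk p" "k < length p"
  shows "path_elem K p = path_elem K (take (Suc k) p) \<otimes>\<^bsub>P\<^esub> path_elem K (drop k p)"
proof
  fix r :: "'v list"
  have eq: "take (Suc m) r = take (Suc k) p \<and> drop m r = drop k p \<longleftrightarrow> m = k \<and> r = p" if "m < length r" for m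
  proof
    assume *: "take (Suc m) r = take (Suc k) p \<and> drop m r = drop k p"
    then have "length (take (Suc m) r) = length (take (Suc k) p)" by simp
    then have mk: "m = k" using that assms(2) by simp
    have "take k (take (Suc k) r) = take k (take (Suc k) p)" using * mk by simp
    then have "take k r = take k p" by simp
    then have "take k r @ drop k r = take k p @ drop k p" using * mk by simp
    then show "m = k \<and> r = p" using mk by simp
  qed auto
  have "(path_elem K (take (Suc k) p) \<otimes>\<^bsub>P\<^esub> path_elem K (drop k p)) r
      = (\<Oplus>m\<in>{..<length r}. if k = m then (if r = p then \<one> else \<zero>) else \<zero>)"
    unfolding P_simps(2)
  proof (rule finsum_cong', rule refl)
    fix m assume "m \<in> {..<length r}"
    then have E: "(take (Suc m) r = take (Suc k) p \<and> drop m r = drop k p) = (m = k \<and> r = p)"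
      by (intro eq) simp
    have "path_elem K (take (Suc k) p) (take (Suc m) r) \<otimes> path_elem K (drop k p) (drop m r)
        = (if take (Suc m) r = take (Suc k) p \<and> drop m r = drop k p then \<one> else \<zero>)"
      by (simp add: path_elem_def)
    then show "path_elem K (take (Suc k) p) (take (Suc m) r) \<otimes> path_elem K (drop k p) (drop m r)
        = (if k = m then (if r = p then \<one> else \<zero>) else \<zero>)"
      unfolding E by (simp split: if_splits)
  qed auto
  also have "\<dots> = path_elem K p r"
  proof (cases "r = p")
    case True
    then show ?thesis
      using finsum_singleton[of k "{..<length r}" "\<lambda>_. \<one>"] assms(2) by (simp add: path_elem_def)
  next
    case False
    then show ?thesis by (simp add: path_elem_def cong: if_cong)
  qed
  finally show "path_elem K p r = (path_elem K (take (Suc k) p) \<otimes>\<^bsub>P\<^esub> path_elem K (drop k p)) r" by simp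
qed

text \<open>Induction on a finite set containing the support, splitting off one path at a
  time.\<close>

lemma path_induct:
  assumes f: "f \<in> carrier P"
    and zero: "H (\<lambda>_. \<zero>)"
    and add: "\<And>f g. \<lbrakk>f \<in> carrier P; g \<in> carrier P; H f; H g\<rbrakk> \<Longrightarrow> H (f \<oplus>\<^bsub>P\<^esub> g)"
    and smult: "\<And>r f. \<lbrakk>r \<in> carrier K; f \<in> carrier P; H f\<rbrakk> \<Longrightarrow> H (r \<odot>\<^bsub>P\<^esub> f)"
    and path: "\<And>p. walk p \<Longrightarrow> H (path_elem K p)"
  shows "H f"
proof -
  have "H f" if "finite S" "f \<in> carrier P" "{p. f p \<noteq> \<zero>} \<subseteq> S" for S f
    using that
  proof (induction S arbitrary: f rule: finite_induct)
    case empty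
    then have "f = (\<lambda>_. \<zero>)" by auto
    then show ?case using zero by simp
  next
    case (insert p S)
    note fc [simp] = P_D(1)[OF insert(4)]
    show ?case
    proof (cases "walk p")
      case True
      let ?g = "\<lambda>q. if q = p then \<zero> else f q"
      have g: "?g \<in> carrier P"
        by (rule P_I[where S = S]) (use insert P_D(2)[OF insert(4)] in auto)
      have "H ?g" by (rule insert(3)[OF g]) (use insert(5) in auto)
      moreover have "H (f p \<odot>\<^bsub>P\<^esub> path_elem K p)"
        by (rule smult[OF fc path_elem_closed[OF True] path[OF True]])
      ultimately have "H (?g \<oplus>\<^bsub>P\<^esub> (f p \<odot>\<^bsub>P\<^esub> path_elem K p))"
        using g P_smult_closed[OF fc path_elem_closed[OF True]] by (intro add)
      moreover have "?g \<oplus>\<^bsub>P\<^esub> (f p \<odot>\<^bsub>P\<^esub> path_elem K p) = f"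
        by (rule ext) (auto simp: P_simps(5,6) path_elem_def)
      ultimately show ?thesis by simp
    next
      case False
      then have "f p = \<zero>" using P_D(2)[OF insert(4)] by blast
      then show ?thesis using insert(5) by (intro insert(3)[OF insert(4)]) auto
    qed
  qed
  then show ?thesis using f P_D(3)[OF f] by blast
qed

end

section \<open>Zigzag algebras with vertex condition have coordinates\<close>

lemma (in k_algebra) ideal_if_closed:
  assumes "I \<subseteq> carrier R" "\<zero>\<^bsub>R\<^esub> \<in> I" "\<And>a b. \<lbrakk>a \<in> I; b \<in> I\<rbrakk> \<Longrightarrow> a \<oplus>\<^bsub>R\<^esub> b \<in> I"
    and l: "\<And>a b. \<lbrakk>a \<in> I; b \<in> carrier R\<rbrakk> \<Longrightarrow> b \<otimes>\<^bsub>R\<^esub> a \<in> I"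
    and r: "\<And>a b. \<lbrakk>a \<in> I; b \<in> carrier R\<rbrakk> \<Longrightarrow> a \<otimes>\<^bsub>R\<^esub> b \<in> I"
  shows "ideal I R"
proof (rule idealI[OF ring_axioms _ l r])
  have "inv\<^bsub>add_monoid R\<^esub> a \<in> I" if "a \<in> I" for a
  proof -
    have "(\<ominus>\<^bsub>R\<^esub> \<one>\<^bsub>R\<^esub>) \<otimes>\<^bsub>R\<^esub> a \<in> I" by (rule l[OF that]) simp
    moreover have "(\<ominus>\<^bsub>R\<^esub> \<one>\<^bsub>R\<^esub>) \<otimes>\<^bsub>R\<^esub> a = \<ominus>\<^bsub>R\<^esub> a" using that assms(1) by (auto simp: l_minus)
    ultimately show ?thesis by (simp add: a_inv_def)
  qed
  then show "subgroup I (add_monoid R)"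
    using assms(1-3) by (intro group.subgroupI[OF M.a_group]) auto
qed

lemma (in k_algebra) quot_alg_zero_iff:
  assumes "ideal I R" "a \<in> carrier R"
  shows "I +>\<^bsub>R\<^esub> a = \<zero>\<^bsub>quot_alg R I\<^esub> \<longleftrightarrow> a \<in> I"
proof -
  interpret s: algebra_surjection K R "quot_alg R I" "\<lambda>a. I +>\<^bsub>R\<^esub> a"
    by (rule quot_alg_surjection[OF assms(1)])
  have "I +>\<^bsub>R\<^esub> a = \<zero>\<^bsub>quot_alg R I\<^esub> \<longleftrightarrow> a \<ominus>\<^bsub>R\<^esub> \<zero>\<^bsub>R\<^esub> \<in> I"
    using quotient_eq_iff_same_a_r_cos[OF assms M.zero_closed] by (simp add: s.f_zero)
  then show ?thesis using assms(2) by (simp add: M.minus_eq)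
qed

lemma algebra_surjection_compose:
  assumes "algebra_surjection K A B f" "algebra_surjection K B R g"
  shows "algebra_surjection K A R (\<lambda>a. g (f a))"
proof -
  interpret f: algebra_surjection K A B f by (rule assms(1))
  interpret g: algebra_surjection K B R g by (rule assms(2))
  show ?thesis
  proof (intro algebra_surjection.intro algebra_surjection_axioms.intro)
    show "(\<lambda>a. g (f a)) ` carrier A = carrier R"
      using f.surj g.surj by (metis image_image)
  qed (simp_all add: f.k_algebra_axioms f.f_zero f.f_one f.f_add f.f_mult f.f_smult
      g.f_zero g.f_one g.f_add g.f_mult g.f_smult)
qed

context algebra_surjection
begin

lemma f_minus: "\<lbrakk>a \<in> carrier A; b \<in> carrier A; f a = f b\<rbrakk> \<Longrightarrow> f (a \<ominus>\<^bsub>A\<^esub> b) = \<zero>\<^bsub>R\<^esub>"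
proof -
  assume ab: "a \<in> carrier A" "b \<in> carrier A" "f a = f b"
  have "f (a \<ominus>\<^bsub>A\<^esub> b) = f (b \<ominus>\<^bsub>A\<^esub> b)" using ab by (simp add: M.minus_eq f_add)
  then show ?thesis using ab by (simp add: M.minus_eq M.r_neg f_zero)
qed

lemma image_ideal:
  assumes "ideal D A"
  shows "ideal (f ` D) R"
proof -
  interpret R: k_algebra K R by (rule image_k_algebra)
  interpret D: ideal D A by (rule assms)
  note c = D.Icarr
  show ?thesis
  proof (rule R.ideal_if_closed)
    show "\<zero>\<^bsub>R\<^esub> \<in> f ` D" by (rule image_eqI[of _ _ "\<zero>\<^bsub>A\<^esub>"]) (simp_all add: f_zero)
    show "x \<oplus>\<^bsub>R\<^esub> y \<in> f ` D" if "x \<in> f ` D" "y \<in> f ` D" for x y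
      using that by (auto simp: c f_add[symmetric])
    show "y \<otimes>\<^bsub>R\<^esub> x \<in> f ` D" "x \<otimes>\<^bsub>R\<^esub> y \<in> f ` D" if x: "x \<in> f ` D" and y: "y \<in> carrier R" for x y
    proof -
      obtain a where a: "a \<in> D" "x = f a" using x by auto
      obtain b where b: "b \<in> carrier A" "y = f b" by (rule lift[OF y])
      from a b show "y \<otimes>\<^bsub>R\<^esub> x \<in> f ` D" "x \<otimes>\<^bsub>R\<^esub> y \<in> f ` D"
        using D.I_l_closed D.I_r_closed c by (auto simp: f_mult[symmetric])
    qed
  qed (use c in auto)
qed

text \<open>a differs from a member of D by an element of the kernel, and D contains the
  kernel.\<close>

lemma mem_if_image_mem:
  assumes "ideal D A" and ker: "\<And>a. \<lbrakk>a \<in> carrier A; f a = \<zero>\<^bsub>R\<^esub>\<rbrakk> \<Longrightarrow> a \<in> D"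
    and a: "a \<in> carrier A" "f a \<in> f ` D"
  shows "a \<in> D"
proof -
  interpret D: ideal D A by (rule assms)
  obtain d where d: "d \<in> D" "f a = f d" using a(2) by blast
  have dc: "d \<in> carrier A" by (rule D.Icarr[OF d(1)])
  have "a \<ominus>\<^bsub>A\<^esub> d \<in> D" by (rule ker) (use f_minus a(1) dc d(2) in auto)
  then have "a \<ominus>\<^bsub>A\<^esub> d \<oplus>\<^bsub>A\<^esub> d \<in> D" using d(1) by (rule D.a_closed)
  then show ?thesis using a(1) dc by (simp add: M.minus_eq M.a_assoc M.l_neg)
qed

text \<open>The form induced on the quotient. If \<open>F\<close> vanishes on the kernel, the choice
  of the preimage is immaterial.\<close>

definition push :: "('a \<Rightarrow> 'k) \<Rightarrow> 'b \<Rightarrow> 'k" where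
  "push F x = F (SOME a. a \<in> carrier A \<and> f a = x)"

lemma push:
  assumes F: "linear_form F" and ker: "\<And>a. \<lbrakk>a \<in> carrier A; f a = \<zero>\<^bsub>R\<^esub>\<rbrakk> \<Longrightarrow> F a = \<zero>\<^bsub>K\<^esub>"
    and a: "a \<in> carrier A"
  shows "push F (f a) = F a"
proof -
  let ?b = "SOME b. b \<in> carrier A \<and> f b = f a"
  have b: "?b \<in> carrier A \<and> f ?b = f a" 
    by (rule someI[of "\<lambda>b. b \<in> carrier A \<and> f b = f a" a]) (use a in simp)
  then have "F (?b \<ominus>\<^bsub>A\<^esub> a) = \<zero>\<^bsub>K\<^esub>" using f_minus a by (intro ker) auto
  then have "F ?b = F a"
    using b a linear_form_minus[OF F, of ?b a]
    by (intro R.eq_if_minus_zero[OF linear_formD(1)[OF F] linear_formD(1)[OF F]]) auto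
  then show ?thesis by (simp add: push_def)
qed

lemma push_form:
  assumes F: "linear_form F" and ker: "\<And>a. \<lbrakk>a \<in> carrier A; f a = \<zero>\<^bsub>R\<^esub>\<rbrakk> \<Longrightarrow> F a = \<zero>\<^bsub>K\<^esub>"
  shows "vectorspace.linear_form K R (push F)"
proof -
  interpret R: k_algebra K R by (rule image_k_algebra)
  note p = push[OF F ker]
  show ?thesis
    unfolding R.linear_form_def
  proof (intro conjI ballI)
    show "push F \<in> carrier R \<rightarrow> carrier K"
      using p linear_formD(1)[OF F] by (auto simp: surj[symmetric] Pi_iff)
    fix x assume "x \<in> carrier R"
    then obtain a where a: "a \<in> carrier A" "x = f a" by (rule lift)
    show "push F (r \<odot>\<^bsub>R\<^esub> x) = r \<otimes>\<^bsub>K\<^esub> push F x" if "r \<in> carrier K" for r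
      using a that p by (simp add: f_smult[symmetric] linear_formD(3)[OF F])
    fix y assume "y \<in> carrier R"
    then obtain b where b: "b \<in> carrier A" "y = f b" by (rule lift)
    show "push F (x \<oplus>\<^bsub>R\<^esub> y) = push F x \<oplus>\<^bsub>K\<^esub> push F y"
      using a b p by (simp add: f_add[symmetric] linear_formD(2)[OF F])
  qed
qed

end


section \<open>The two quotient maps from the path algebra\<close>

locale zigzag_setup = field K
  for K :: "('k, 'm) ring_scheme" (structure) +
  fixes G :: "'v pair_pre_digraph" and C :: "'v set"
  assumes pair_graph: "pair_graph G"
    and connected: "Digraph_Component.connected (with_proj G)"
    and C_nonempty: "C \<noteq> {}" and C_verts: "C \<subseteq> pverts G"
begin

abbreviation "V \<equiv> pverts G"
abbreviation "A \<equiv> parcs G"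

sublocale path_alg K "zigzag_quiver G" ..

interpretation G: pair_graph G by (rule pair_graph)

lemma V_finite: "finite V"
  using G.pair_finite_verts .

lemma A_sub: "A \<subseteq> V \<times> V"
  by (rule subrelI) (use G.arc_fst_in_verts G.arc_snd_in_verts in force)

lemma A_V: "(i, j) \<in> A \<Longrightarrow> i \<in> V" "(i, j) \<in> A \<Longrightarrow> j \<in> V"
  using A_sub by auto

lemma A_finite: "finite A"
  by (rule finite_subset[OF A_sub]) (use V_finite in simp)

lemma A_symm: "(i, j) \<in> A \<Longrightarrow> (j, i) \<in> A"
  by (rule G.arcs_symmetric)

lemma A_irr: "(i, j) \<in> A \<Longrightarrow> i \<noteq> j"
  using G.no_loops' by blast

lemma row_finite: "finite {k. (i, k) \<in> A}"
  by (rule finite_subset[OF _ V_finite]) (use A_sub in auto)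

text \<open>The arcs are symmetric already, so reachability in the symmetric closure stays inside
  \<open>A\<close>, and induction along a path spreads S over the graph.\<close>

lemma closed_subset_eq:
  assumes S: "S \<subseteq> V" "S \<noteq> {}" "\<And>i j. \<lbrakk>i \<in> S; (i, j) \<in> A\<rbrakk> \<Longrightarrow> j \<in> S"
  shows "S = V"
proof
  show "V \<subseteq> S"
  proof
    fix v assume v: "v \<in> V"
    obtain s where s: "s \<in> S" using S(2) by blast
    let ?H = "mk_symmetric (with_proj G)"
    have "parcs ?H \<subseteq> A" using A_symm by (auto simp: parcs_mk_symmetric)
    moreover have "s \<rightarrow>\<^sup>*\<^bsub>with_proj ?H\<^esub> v"
      using connected s v S(1) by (auto simp: connected_def strongly_connected_def)
    moreover from this have "(s, v) \<in> (parcs ?H)\<^sup>*"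
      unfolding reachable_def using rtrancl_on_rtranclI by simp
    ultimately have "(s, v) \<in> A\<^sup>*" using rtrancl_mono by blast
    then show "v \<in> S" using s S(3) by (induction rule: rtrancl_induct) blast+
  qed
qed (rule S)

text \<open>The same choice as in \<open>zigzag_x\<close>, so that both represent x_i by the same
  path.\<close>

definition nbr :: "'v \<Rightarrow> 'v" where "nbr i = (SOME j. (i, j) \<in> A)"

lemma nbr:
  assumes "card V \<noteq> 1" "i \<in> V"
  shows "(i, nbr i) \<in> A"
proof -
  have "\<exists>j. (i, j) \<in> A"
  proof (rule ccontr)
    assume "\<not> ?thesis"
    then have "{i} = V" using assms(2) by (intro closed_subset_eq) auto
    then show False using assms(1) by (metis card_1_singleton_iff One_nat_def)
  qed
  then show ?thesis unfolding nbr_def by (rule someI_ex)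
qed

text \<open>Since \<open>C\<close> is non-empty, the one-vertex case always has its x killed, and no
  arrow remains either.\<close>

lemma one_vertex:
  assumes "card V = 1"
  shows "A = {}" "C = V"
proof -
  obtain v where "V = {v}" using assms card_1_singletonE by blast
  then show "A = {}" "C = V" using A_sub A_irr C_nonempty C_verts by auto
qed

lemma nbr_C: "i \<in> V - C \<Longrightarrow> (i, nbr i) \<in> A"
  using nbr one_vertex(2) by blast

text \<open>Otherwise {i, j} would be closed under neighbours and hence be the whole graph. The
  third vertex is what makes paths of length three vanish.\<close>

lemma third_vertex:
  assumes ij: "(i, j) \<in> A" and card: "card V \<noteq> 2"
  obtains m where "(i, m) \<in> A" "m \<noteq> j" | m where "(j, m) \<in> A" "m \<noteq> i"
proof -
  have "\<exists>m. ((i, m) \<in> A \<and> m \<noteq> j) \<or> ((j, m) \<in> A \<and> m \<noteq> i)"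
  proof (rule ccontr)
    assume no: "\<not> ?thesis"
    have "{i, j} = V"
    proof (rule closed_subset_eq)
      show "{i, j} \<subseteq> V" using A_V[OF ij] by simp
      show "l \<in> {i, j}" if "k \<in> {i, j}" "(k, l) \<in> A" for k l using no that by blast
    qed simp
    moreover have "card {i, j} = 2" using A_irr[OF ij] by simp
    ultimately show False using card by simp
  qed
  then show thesis using that by blast
qed

lemma walk_singleton: "i \<in> V \<Longrightarrow> walk [i]"
  by (auto simp: vwalk_def zigzag_quiver_def)

lemma walk_one_vertex: "card V = 1 \<Longrightarrow> walk p \<longleftrightarrow> p \<noteq> [] \<and> set p \<subseteq> V"
proof
  assume c: "card V = 1" and p: "p \<noteq> [] \<and> set p \<subseteq> V"
  obtain v where v: "V = {v}" using c card_1_singletonE by blast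
  have "(p ! i, p ! Suc i) \<in> Id_on V" if "Suc i < length p" for i
  proof -
    have "p ! i \<in> V" "p ! Suc i \<in> V" using that p nth_mem by (meson Suc_lessD subsetD)+
    then show ?thesis using v by (auto intro: Id_onI)
  qed
  then show "walk p"
    using p c by (auto simp: vwalk_def zigzag_quiver_def vwalk_arcs_conv arcs_ends_def arc_to_ends_def)
qed (auto simp: vwalk_def zigzag_quiver_def)

lemma walk_arcs: "card V \<noteq> 1 \<Longrightarrow> walk p \<longleftrightarrow> p \<noteq> [] \<and> set p \<subseteq> V \<and> set (vwalk_arcs p) \<subseteq> A"
  by (auto simp: vwalk_def zigzag_quiver_def)

lemma walk_A: "(i, j) \<in> A \<Longrightarrow> walk [i, j]"
  using walk_arcs one_vertex A_V by fastforce

lemma walk_AA: "\<lbrakk>(i, j) \<in> A; (j, k) \<in> A\<rbrakk> \<Longrightarrow> walk [i, j, k]"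
  using walk_arcs one_vertex A_V by fastforce

lemma P_alg: "k_algebra K P"
  by (rule P_k_algebra) (use V_finite in \<open>simp add: zigzag_quiver_def\<close>)

sublocale PA: k_algebra K P by (rule P_alg)

abbreviation "I \<equiv> zigzag_ideal K G"
abbreviation "Z \<equiv> zigzag_algebra K G"
abbreviation "J \<equiv> genideal Z (zigzag_x K G ` C)"
abbreviation "R \<equiv> zigzag_vertex_algebra K G C"
abbreviation "pe \<equiv> path_elem K"
abbreviation proj1 where "proj1 f \<equiv> I +>\<^bsub>P\<^esub> f"
definition proj where "proj f = J +>\<^bsub>Z\<^esub> proj1 f"

lemma relations_closed: "zigzag_relations K G \<subseteq> carrier P"
proof -
  have "pe p \<in> carrier P" if "card V = 2" "vwalk p (with_proj G)" for p
    using that by (intro path_elem_closed) (simp add: zigzag_quiver_def)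
  moreover have "pe [i, j, k] \<in> carrier P" if "(i, j) \<in> A" "(j, k) \<in> A" for i j k
    using that by (intro path_elem_closed walk_AA)
  moreover have "pe [i, i, i] \<in> carrier P" if "card V = 1" "i \<in> V" for i
    using that by (intro path_elem_closed) (simp add: walk_one_vertex)
  ultimately show ?thesis
    using A_symm by (auto simp: zigzag_relations_def intro!: PA.M.minus_closed)
qed

lemma ideal_I: "ideal I P"
  unfolding zigzag_ideal_def by (rule PA.genideal_ideal[OF relations_closed])

sublocale s1: algebra_surjection K P Z proj1
  unfolding zigzag_algebra_def by (rule PA.quot_alg_surjection[OF ideal_I])

lemma Z_alg: "k_algebra K Z"
  by (rule s1.image_k_algebra)

interpretation ZA: k_algebra K Z by (rule Z_alg)

definition x_path :: "'v \<Rightarrow> 'v list" where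
  "x_path c = (if card V = 1 then [c, c] else [c, nbr c, c])"

lemma walk_x_path: "c \<in> V \<Longrightarrow> walk (x_path c)"
  using walk_one_vertex walk_AA nbr A_symm by (auto simp: x_path_def)

lemma zigzag_x_eq: "zigzag_x K G c = proj1 (pe (x_path c))"
  by (simp add: zigzag_x_def x_path_def nbr_def)

lemma x_closed: "zigzag_x K G ` C \<subseteq> carrier Z"
  using walk_x_path path_elem_closed C_verts by (auto simp: zigzag_x_eq intro!: s1.f_closed)

lemma ideal_J: "ideal J Z"
  by (rule ZA.genideal_ideal[OF x_closed])

sublocale s: algebra_surjection K P R proj
proof -
  have "algebra_surjection K Z R (\<lambda>x. J +>\<^bsub>Z\<^esub> x)"
    unfolding zigzag_vertex_algebra_def by (rule ZA.quot_alg_surjection[OF ideal_J])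
  from algebra_surjection_compose[OF s1.algebra_surjection_axioms this]
  show "algebra_surjection K P R proj" by (simp add: proj_def[abs_def])
qed

lemma proj_zero_iff: "f \<in> carrier P \<Longrightarrow> proj f = \<zero>\<^bsub>R\<^esub> \<longleftrightarrow> proj1 f \<in> J"
  unfolding proj_def zigzag_vertex_algebra_def by (rule ZA.quot_alg_zero_iff[OF ideal_J s1.f_closed])

lemma proj1_zero_iff: "f \<in> carrier P \<Longrightarrow> proj1 f = \<zero>\<^bsub>Z\<^esub> \<longleftrightarrow> f \<in> I"
  unfolding zigzag_algebra_def by (rule PA.quot_alg_zero_iff[OF ideal_I])

lemma proj_relation:
  assumes "f \<in> zigzag_relations K G"
  shows "proj f = \<zero>\<^bsub>R\<^esub>"
proof -
  have fc: "f \<in> carrier P" using assms relations_closed by auto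
  have "f \<in> I" unfolding zigzag_ideal_def using PA.genideal_self[OF relations_closed] assms by blast
  then have "proj1 f = \<zero>\<^bsub>Z\<^esub>" using proj1_zero_iff fc by simp
  moreover have "\<zero>\<^bsub>Z\<^esub> \<in> J"
    using additive_subgroup.zero_closed[OF ideal.axioms(1)[OF ideal_J]] .
  ultimately show ?thesis using proj_zero_iff[OF fc] by simp
qed

lemma proj_x:
  assumes "c \<in> C"
  shows "proj (pe (x_path c)) = \<zero>\<^bsub>R\<^esub>"
proof -
  have "zigzag_x K G c \<in> J" using ZA.genideal_self[OF x_closed] assms by blast
  then show ?thesis using proj_zero_iff path_elem_closed walk_x_path assms C_verts
    by (auto simp: zigzag_x_eq)
qed

lemma proj_split_zero:
  assumes "walk p" "k < length p"
    and "proj (pe (take (Suc k) p)) = \<zero>\<^bsub>R\<^esub> \<or> proj (pe (drop k p)) = \<zero>\<^bsub>R\<^esub>"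
    and "walk (take (Suc k) p)" "walk (drop k p)"
  shows "proj (pe p) = \<zero>\<^bsub>R\<^esub>"
proof -
  interpret RA: k_algebra K R by (rule s.image_k_algebra)
  have "proj (pe p) = proj (pe (take (Suc k) p)) \<otimes>\<^bsub>R\<^esub> proj (pe (drop k p))"
    using path_elem_split[OF assms(1,2)] assms(4,5) by (simp add: s.f_mult path_elem_closed)
  then show ?thesis using assms(3-5) path_elem_closed s.f_closed by auto
qed

text \<open>With two vertices there is only one neighbour; otherwise the difference of the two paths
  is a defining relation.\<close>

lemma proj_loops_eq:
  assumes "(i, j) \<in> A" "(i, k) \<in> A"
  shows "proj (pe [i, j, i]) = proj (pe [i, k, i])"
proof (cases "card V = 2")
  case True
  have "j = k"
  proof (rule ccontr)
    assume "j \<noteq> k"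
    then have "card {i, j, k} = 3" using assms A_irr by (auto simp: card_insert_if)
    moreover have "card {i, j, k} \<le> card V"
      by (rule card_mono[OF V_finite]) (use assms A_V in auto)
    ultimately show False using True by simp
  qed
  then show ?thesis by simp
next
  case False
  have c: "pe [i, j, i] \<in> carrier P" "pe [i, k, i] \<in> carrier P"
    using assms A_symm by (auto intro!: path_elem_closed walk_AA)
  have "card V \<noteq> 1" using one_vertex(1) assms by auto
  then have "pe [i, j, i] \<ominus>\<^bsub>P\<^esub> pe [i, k, i] \<in> zigzag_relations K G"
    using False assms unfolding zigzag_relations_def by auto
  then have "proj (pe [i, j, i] \<ominus>\<^bsub>P\<^esub> pe [i, k, i]) = \<zero>\<^bsub>R\<^esub>" by (rule proj_relation)
  moreover have "pe [i, j, i] = (pe [i, j, i] \<ominus>\<^bsub>P\<^esub> pe [i, k, i]) \<oplus>\<^bsub>P\<^esub> pe [i, k, i]"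
    using c by (simp add: PA.M.minus_eq PA.M.a_assoc PA.M.l_neg)
  ultimately have "proj (pe [i, j, i]) = \<zero>\<^bsub>R\<^esub> \<oplus>\<^bsub>R\<^esub> proj (pe [i, k, i])"
    using c s.f_add[of "pe [i, j, i] \<ominus>\<^bsub>P\<^esub> pe [i, k, i]" "pe [i, k, i]"] by simp
  then show ?thesis
    using k_algebra.axioms(1)[OF s.image_k_algebra] c(2) s.f_closed
    by (simp add: vectorspace_def module_def abelian_group_def abelian_monoid.l_zero)
qed

end

section \<open>Candidate coordinates on the path algebra and their common kernel\<close>

context zigzag_setup
begin

abbreviation "E \<equiv> A \<union> Id_on (V - C)"

definition U :: "'v \<Rightarrow> ('v list \<Rightarrow> 'k) \<Rightarrow> 'k" where
  "U i f = f [i]"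

text \<open>All returns from i through a neighbour represent the same x_i, so its coordinate has to
  add up their coefficients.\<close>

definition T :: "'v \<Rightarrow> 'v \<Rightarrow> ('v list \<Rightarrow> 'k) \<Rightarrow> 'k" where
  "T i j f = (if i = j then (\<Oplus>k\<in>{k. (i, k) \<in> A}. f [i, k, i]) else f [i, j])"

lemma T_arc: "(i, j) \<in> A \<Longrightarrow> T i j f = f [i, j]"
  using A_irr by (auto simp: T_def)

lemma T_loop: "T i i f = (\<Oplus>k\<in>{k. (i, k) \<in> A}. f [i, k, i])"
  by (simp add: T_def)

lemma T_closed: "f \<in> carrier P \<Longrightarrow> T i j f \<in> carrier K"
  by (auto simp: T_def P_D(1) intro!: finsum_closed)

lemma U_form: "PA.linear_form (U i)"
  unfolding PA.linear_form_def by (simp add: U_def P_simps(5,6) P_D(1) Pi_iff)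

lemma T_form: "PA.linear_form (T i j)"
proof (cases "i = j")
  case True
  have "(\<Oplus>k\<in>S. (f \<oplus>\<^bsub>P\<^esub> g) [j, k, j]) = (\<Oplus>k\<in>S. f [j, k, j]) \<oplus> (\<Oplus>k\<in>S. g [j, k, j])"
    if "f \<in> carrier P" "g \<in> carrier P" for f g S
    unfolding P_simps(5) by (rule finsum_addf) (use that in \<open>auto simp: P_D(1)\<close>)
  moreover have "(\<Oplus>k\<in>S. (r \<odot>\<^bsub>P\<^esub> f) [j, k, j]) = r \<otimes> (\<Oplus>k\<in>S. f [j, k, j])"
    if "f \<in> carrier P" "r \<in> carrier K" "finite S" for f r S
    unfolding P_simps(6) by (rule finsum_rdistr[symmetric]) (use that in \<open>auto simp: P_D(1)\<close>)
  moreover have "T j j \<in> carrier P \<rightarrow> carrier K" using T_closed by blast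
  ultimately show ?thesis
    unfolding PA.linear_form_def True T_loop[abs_def]
    by (simp add: T_loop row_finite)
next
  case False
  then show ?thesis
    unfolding PA.linear_form_def by (simp add: T_def P_simps(5,6) P_D(1) Pi_iff)
qed

lemma conv_paths:
  assumes f: "f \<in> carrier P" and g: "g \<in> carrier P"
  shows "(f \<otimes>\<^bsub>P\<^esub> g) [i] = f [i] \<otimes> g [i]"
    and "(f \<otimes>\<^bsub>P\<^esub> g) [i, j] = f [i] \<otimes> g [i, j] \<oplus> f [i, j] \<otimes> g [j]"
    and "(f \<otimes>\<^bsub>P\<^esub> g) [i, j, k] = f [i] \<otimes> g [i, j, k] \<oplus> f [i, j] \<otimes> g [j, k] \<oplus> f [i, j, k] \<otimes> g [k]"
  by (simp_all add: P_simps(2) lessThan_Suc P_D(1)[OF f] P_D(1)[OF g] a_ac)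

lemma U_mult: "\<lbrakk>f \<in> carrier P; g \<in> carrier P\<rbrakk> \<Longrightarrow> U i (f \<otimes>\<^bsub>P\<^esub> g) = U i f \<otimes> U i g"
  by (simp add: U_def conv_paths)

lemma T_mult_arc: "\<lbrakk>(i, j) \<in> A; f \<in> carrier P; g \<in> carrier P\<rbrakk>
    \<Longrightarrow> T i j (f \<otimes>\<^bsub>P\<^esub> g) = U i f \<otimes> T i j g \<oplus> T i j f \<otimes> U j g"
  by (simp add: U_def T_arc conv_paths)

text \<open>The path [i, k, i] can be cut at three places: the outer cuts give the first two terms
  and the middle cut gives the sum.\<close>

lemma T_mult_loop:
  assumes f: "f \<in> carrier P" and g: "g \<in> carrier P"
  shows "T i i (f \<otimes>\<^bsub>P\<^esub> g)
    = U i f \<otimes> T i i g \<oplus> T i i f \<otimes> U i g \<oplus> (\<Oplus>k\<in>{k. (i, k) \<in> A}. T i k f \<otimes> T k i g)"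
proof -
  note fc [simp] = P_D(1)[OF f] and gc [simp] = P_D(1)[OF g]
  let ?S = "{k. (i, k) \<in> A}"
  have "T i i (f \<otimes>\<^bsub>P\<^esub> g)
      = (\<Oplus>k\<in>?S. (f [i] \<otimes> g [i, k, i] \<oplus> f [i, k, i] \<otimes> g [i]) \<oplus> f [i, k] \<otimes> g [k, i])"
    unfolding T_loop by (rule finsum_cong') (auto simp: conv_paths[OF f g] a_ac)
  also have "\<dots> = (\<Oplus>k\<in>?S. f [i] \<otimes> g [i, k, i] \<oplus> f [i, k, i] \<otimes> g [i]) \<oplus> (\<Oplus>k\<in>?S. f [i, k] \<otimes> g [k, i])"
    by (rule finsum_addf) auto
  also have "(\<Oplus>k\<in>?S. f [i] \<otimes> g [i, k, i] \<oplus> f [i, k, i] \<otimes> g [i])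
      = (\<Oplus>k\<in>?S. f [i] \<otimes> g [i, k, i]) \<oplus> (\<Oplus>k\<in>?S. f [i, k, i] \<otimes> g [i])"
    by (rule finsum_addf) auto
  also have "(\<Oplus>k\<in>?S. f [i] \<otimes> g [i, k, i]) = U i f \<otimes> T i i g"
    unfolding T_loop U_def by (rule finsum_rdistr[symmetric]) (auto simp: row_finite)
  also have "(\<Oplus>k\<in>?S. f [i, k, i] \<otimes> g [i]) = T i i f \<otimes> U i g"
    unfolding T_loop U_def by (rule finsum_ldistr[symmetric]) (auto simp: row_finite)
  also have "(\<Oplus>k\<in>?S. f [i, k] \<otimes> g [k, i]) = (\<Oplus>k\<in>?S. T i k f \<otimes> T k i g)"
    by (rule finsum_cong') (use A_symm in \<open>auto simp: T_arc\<close>)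
  finally show ?thesis .
qed

text \<open>This turns out to be the kernel of \<open>proj\<close>; the two inclusions are
  \<open>kernel_null\<close> and \<open>null_kernel\<close>.\<close>

definition null :: "('v list \<Rightarrow> 'k) set" where
  "null = {f \<in> carrier P. (\<forall>i\<in>V. U i f = \<zero>) \<and> (\<forall>(i, j)\<in>E. T i j f = \<zero>)}"

lemma nullI:
  assumes "f \<in> carrier P" "\<And>i. i \<in> V \<Longrightarrow> U i f = \<zero>" "\<And>i j. (i, j) \<in> A \<Longrightarrow> T i j f = \<zero>"
    and "\<And>i. i \<in> V - C \<Longrightarrow> T i i f = \<zero>"
  shows "f \<in> null"
  using assms by (auto simp: null_def)

lemma nullD:
  assumes "f \<in> null"
  shows "f \<in> carrier P" "i \<in> V \<Longrightarrow> U i f = \<zero>" "(i, j) \<in> A \<Longrightarrow> T i j f = \<zero>" "i \<in> V - C \<Longrightarrow> T i i f = \<zero>"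
  using assms by (auto simp: null_def)

text \<open>By the product rules, every term in a coordinate of a product contains a coordinate of
  the factor from \<open>null\<close>.\<close>

lemma ideal_null: "ideal null P"
proof (rule PA.ideal_if_closed)
  show "null \<subseteq> carrier P" by (auto simp: null_def)
  show "\<zero>\<^bsub>P\<^esub> \<in> null"
    by (rule nullI) (simp_all add: PA.linear_form_zero[OF U_form] PA.linear_form_zero[OF T_form])
  show "f \<oplus>\<^bsub>P\<^esub> g \<in> null" if "f \<in> null" "g \<in> null" for f g
    using nullD[OF that(1)] nullD[OF that(2)]
    by (intro nullI) (simp_all add: PA.linear_formD(2)[OF U_form] PA.linear_formD(2)[OF T_form])
  note [simp] = A_V
  show "g \<otimes>\<^bsub>P\<^esub> f \<in> null" if f: "f \<in> null" and g: "g \<in> carrier P" for f g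
  proof (rule nullI)
    note fD = nullD[OF f]
    have Uc: "U i g \<in> carrier K" for i using P_D(1)[OF g] by (simp add: U_def)
    have "(\<Oplus>k\<in>{k. (i, k) \<in> A}. T i k g \<otimes> T k i f) = (\<Oplus>k\<in>{k. (i, k) \<in> A}. \<zero>)" for i
      by (rule finsum_cong') (use A_symm fD T_closed[OF g] in auto)
    then show "T i i (g \<otimes>\<^bsub>P\<^esub> f) = \<zero>" if "i \<in> V - C" for i
      using that fD T_closed[OF g] Uc by (simp add: T_mult_loop[OF g fD(1)])
    show "T i j (g \<otimes>\<^bsub>P\<^esub> f) = \<zero>" if "(i, j) \<in> A" for i j
      using that fD T_closed[OF g] Uc by (simp add: T_mult_arc[OF that g fD(1)])
    show "U i (g \<otimes>\<^bsub>P\<^esub> f) = \<zero>" if "i \<in> V" for i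
      using that fD Uc by (simp add: U_mult[OF g fD(1)])
  qed (use nullD(1)[OF f] g in simp)
  show "f \<otimes>\<^bsub>P\<^esub> g \<in> null" if f: "f \<in> null" and g: "g \<in> carrier P" for f g
  proof (rule nullI)
    note fD = nullD[OF f]
    have Uc: "U i g \<in> carrier K" for i using P_D(1)[OF g] by (simp add: U_def)
    have "(\<Oplus>k\<in>{k. (i, k) \<in> A}. T i k f \<otimes> T k i g) = (\<Oplus>k\<in>{k. (i, k) \<in> A}. \<zero>)" for i
      by (rule finsum_cong') (use fD T_closed[OF g] in auto)
    then show "T i i (f \<otimes>\<^bsub>P\<^esub> g) = \<zero>" if "i \<in> V - C" for i
      using that fD T_closed[OF g] Uc by (simp add: T_mult_loop[OF fD(1) g])
    show "T i j (f \<otimes>\<^bsub>P\<^esub> g) = \<zero>" if "(i, j) \<in> A" for i j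
      using that fD T_closed[OF g] Uc by (simp add: T_mult_arc[OF that fD(1) g])
    show "U i (f \<otimes>\<^bsub>P\<^esub> g) = \<zero>" if "i \<in> V" for i
      using that fD Uc by (simp add: U_mult[OF fD(1) g])
  qed (use nullD(1)[OF f] g in simp)
qed

lemma U_pe: "length p \<noteq> 1 \<Longrightarrow> U i (pe p) = \<zero>"
  by (auto simp: U_def path_elem_def)

lemma T_pe_arc: "\<lbrakk>length p \<noteq> 2; (i, j) \<in> A\<rbrakk> \<Longrightarrow> T i j (pe p) = \<zero>"
  by (auto simp: T_arc path_elem_def)

lemma T_pe_loop:
  assumes "\<And>k. (i, k) \<in> A \<Longrightarrow> p \<noteq> [i, k, i]"
  shows "T i i (pe p) = \<zero>"
proof -
  have "T i i (pe p) = (\<Oplus>k\<in>{k. (i, k) \<in> A}. \<zero>)"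
    unfolding T_loop by (rule finsum_cong') (use assms in \<open>auto simp: path_elem_def\<close>)
  then show ?thesis by simp
qed

lemma T_pe_return:
  assumes "(i, j) \<in> A"
  shows "T i i (pe [i, j, i]) = \<one>"
proof -
  have "T i i (pe [i, j, i]) = (\<Oplus>k\<in>{k. (i, k) \<in> A}. if j = k then \<one> else \<zero>)"
    unfolding T_loop by (rule finsum_cong') (auto simp: path_elem_def)
  also have "\<dots> = \<one>" by (rule finsum_singleton) (use assms row_finite in auto)
  finally show ?thesis .
qed

lemma relations_null: "zigzag_relations K G \<subseteq> null"
proof
  fix f assume f: "f \<in> zigzag_relations K G"
  then have fc: "f \<in> carrier P" using relations_closed by blast
  consider (one) i where "card V = 1" "f = pe [i, i, i]"
    | (two) p where "card V = 2" "f = pe p" "length p = 4"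
    | (arcs) i j k where "f = pe [i, j, k]" "i \<noteq> k"
    | (loops) i j k where "f = pe [i, j, i] \<ominus>\<^bsub>P\<^esub> pe [i, k, i]" "(i, j) \<in> A" "(i, k) \<in> A"
    using f unfolding zigzag_relations_def by (auto split: if_splits)
  then show "f \<in> null"
  proof cases
    case one
    then show ?thesis using fc one_vertex[OF one(1)] by (intro nullI) (auto simp: U_pe)
  next
    case two
    have "p \<noteq> [i, k, i]" for i k using two(3) by auto
    then show ?thesis using fc two by (intro nullI) (auto simp: U_pe T_pe_arc intro!: T_pe_loop)
  next
    case arcs
    then show ?thesis using fc by (intro nullI) (auto simp: U_pe T_pe_arc intro!: T_pe_loop)
  next
    case loops
    have c: "pe [i, j, i] \<in> carrier P" "pe [i, k, i] \<in> carrier P"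
      using loops A_symm by (auto intro!: path_elem_closed walk_AA)
    have "T l l (pe [i, j, i]) = T l l (pe [i, k, i])" for l
    proof (cases "l = i")
      case True
      then show ?thesis using T_pe_return loops by simp
    next
      case False
      then show ?thesis using T_pe_loop[of l "[i, j, i]"] T_pe_loop[of l "[i, k, i]"] by auto
    qed
    then show ?thesis
      using fc unfolding loops(1)
      by (intro nullI) (simp_all add: PA.linear_form_minus[OF U_form c] PA.linear_form_minus[OF T_form c]
          U_pe T_pe_arc minus_eq T_closed[OF c(2)] r_neg)
  qed
qed

lemma x_path_null:
  assumes "c \<in> C"
  shows "pe (x_path c) \<in> null"
proof (cases "card V = 1")
  case True
  then show ?thesis
    using one_vertex[OF True] assms path_elem_closed[OF walk_x_path] C_verts
    by (intro nullI) (auto simp: x_path_def U_pe)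
next
  case False
  then show ?thesis
    using assms path_elem_closed[OF walk_x_path] C_verts
    by (intro nullI) (auto simp: x_path_def U_pe T_pe_arc intro!: T_pe_loop)
qed

text \<open>Generated ideals are minimal, which is applied at both quotients: \<open>null\<close>
  contains the relations, and its image contains the elements x_c. The second inclusion can be
  pulled back because \<open>null\<close> contains the kernel of the first quotient map.\<close>

lemma kernel_null:
  assumes f: "f \<in> carrier P" and 0: "proj f = \<zero>\<^bsub>R\<^esub>"
  shows "f \<in> null"
proof -
  interpret ZA: k_algebra K Z by (rule Z_alg)
  have "I \<subseteq> null"
    unfolding zigzag_ideal_def by (rule PA.genideal_minimal[OF ideal_null relations_null])
  then have ker: "g \<in> null" if "g \<in> carrier P" "proj1 g = \<zero>\<^bsub>Z\<^esub>" for g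
    using that proj1_zero_iff by blast
  have "zigzag_x K G ` C \<subseteq> proj1 ` null" using x_path_null by (auto simp: zigzag_x_eq)
  then have "J \<subseteq> proj1 ` null" by (rule ZA.genideal_minimal[OF s1.image_ideal[OF ideal_null]])
  then have "proj1 f \<in> proj1 ` null" using proj_zero_iff[OF f] 0 by blast
  show ?thesis
  proof (rule s1.mem_if_image_mem[OF ideal_null])
    show "g \<in> null" if "g \<in> carrier P" "proj1 g = \<zero>\<^bsub>Z\<^esub>" for g by (rule ker[OF that])
  qed fact+
qed

end

section \<open>Normal forms modulo the relations\<close>

context zigzag_setup
begin

text \<open>Representatives of the classes, supported on a basis of paths.\<close>

definition normal :: "('v list \<Rightarrow> 'k) \<Rightarrow> bool" where
  "normal g \<longleftrightarrow> (\<forall>p. g p \<noteq> \<zero> \<longrightarrow> (\<exists>i\<in>V. p = [i]) \<or> (\<exists>i j. (i, j) \<in> A \<and> p = [i, j])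
    \<or> (\<exists>i\<in>V - C. p = [i, nbr i, i]))"

lemma normal_pe: "(\<exists>i\<in>V. p = [i]) \<or> (\<exists>i j. (i, j) \<in> A \<and> p = [i, j]) \<or> (\<exists>i\<in>V - C. p = [i, nbr i, i])
    \<Longrightarrow> normal (pe p)"
  by (auto simp: normal_def path_elem_def)

lemma normal_zero: "normal \<zero>\<^bsub>P\<^esub>"
  by (simp add: normal_def P_simps(4))

text \<open>On a normal element each coordinate reads a single coefficient; in the sum for x_i only
  the return through \<open>nbr i\<close> remains.\<close>

lemma normal_null:
  assumes "normal g" "g \<in> null"
  shows "g = \<zero>\<^bsub>P\<^esub>"
proof
  fix p
  note gc = P_D(1)[OF nullD(1)[OF assms(2)]]
  show "g p = \<zero>\<^bsub>P\<^esub> p"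
  proof (rule ccontr)
    assume "g p \<noteq> \<zero>\<^bsub>P\<^esub> p"
    then have ne: "g p \<noteq> \<zero>" by (simp add: P_simps(4))
    then consider i where "i \<in> V" "p = [i]" | i j where "(i, j) \<in> A" "p = [i, j]"
      | i where "i \<in> V - C" "p = [i, nbr i, i]"
      using assms(1) unfolding normal_def by blast
    then show False
    proof cases
      case 1
      then show ?thesis using nullD(2)[OF assms(2)] ne by (simp add: U_def)
    next
      case 2
      then show ?thesis using nullD(3)[OF assms(2)] ne by (simp add: T_arc)
    next
      case 3
      have "g [i, k, i] = \<zero>" if "k \<noteq> nbr i" for k using assms(1) that unfolding normal_def by blast
      then have "(\<Oplus>k\<in>{k. (i, k) \<in> A}. g [i, k, i]) = (\<Oplus>k\<in>{k. (i, k) \<in> A}. if nbr i = k then g [i, k, i] else \<zero>)"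
        using gc by (intro finsum_cong') auto
      also have "\<dots> = g [i, nbr i, i]"
        by (rule finsum_singleton) (use nbr_C[OF 3(1)] row_finite gc in auto)
      finally show ?thesis using nullD(4)[OF assms(2) 3(1)] ne 3(2) by (simp add: T_loop)
    qed
  qed
qed

text \<open>The three vertices are distinct, which puts the graph in the case whose relations kill
  this path.\<close>

lemma proj_three_zero:
  assumes "(i, j) \<in> A" "(j, k) \<in> A" "i \<noteq> k"
  shows "proj (pe [i, j, k]) = \<zero>\<^bsub>R\<^esub>"
proof -
  have "card {i, j, k} = 3" using assms A_irr by (auto simp: card_insert_if)
  moreover have "card {i, j, k} \<le> card V"
    by (rule card_mono[OF V_finite]) (use assms A_V in auto)
  ultimately have "card V \<noteq> 1" "card V \<noteq> 2" by auto
  then have "pe [i, j, k] \<in> zigzag_relations K G"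
    using assms unfolding zigzag_relations_def by auto
  then show ?thesis by (rule proj_relation)
qed

lemma walk_four: "\<lbrakk>(i, j) \<in> A; (j, k) \<in> A; (k, l) \<in> A\<rbrakk> \<Longrightarrow> walk [i, j, k, l]"
  using walk_arcs one_vertex A_V by fastforce

lemma proj_four_split:
  assumes "(i, j) \<in> A" "(j, k) \<in> A" "(k, l) \<in> A"
  shows "proj (pe [i, j, k, l]) = proj (pe [i, j, k]) \<otimes>\<^bsub>R\<^esub> proj (pe [k, l])"
    and "proj (pe [i, j, k, l]) = proj (pe [i, j]) \<otimes>\<^bsub>R\<^esub> proj (pe [j, k, l])"
proof -
  have "pe [i, j, k, l] = pe [i, j, k] \<otimes>\<^bsub>P\<^esub> pe [k, l]"
    using path_elem_split[OF walk_four[OF assms], of 2] by (simp add: numeral_2_eq_2)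
  then show "proj (pe [i, j, k, l]) = proj (pe [i, j, k]) \<otimes>\<^bsub>R\<^esub> proj (pe [k, l])"
    using assms by (simp only: s.f_mult path_elem_closed walk_A walk_AA)
  have "pe [i, j, k, l] = pe [i, j] \<otimes>\<^bsub>P\<^esub> pe [j, k, l]"
    using path_elem_split[OF walk_four[OF assms], of 1] by simp
  then show "proj (pe [i, j, k, l]) = proj (pe [i, j]) \<otimes>\<^bsub>R\<^esub> proj (pe [j, k, l])"
    using assms by (simp only: s.f_mult path_elem_closed walk_A walk_AA)
qed

text \<open>With two vertices this is a defining relation. Otherwise a vanishing path of length two
  splits off unless the path runs back and forth along one edge; in that case a return inside it is
  rerouted through a third vertex, after which such a piece splits off.\<close>

lemma proj_four_zero:
  assumes ijkl: "(i, j) \<in> A" "(j, k) \<in> A" "(k, l) \<in> A"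
  shows "proj (pe [i, j, k, l]) = \<zero>\<^bsub>R\<^esub>"
proof -
  interpret RA: k_algebra K R by (rule s.image_k_algebra)
  have c2: "proj (pe [a, b]) \<in> carrier R" if "(a, b) \<in> A" for a b
    using that by (simp add: path_elem_closed walk_A)
  have c3: "proj (pe [a, b, c]) \<in> carrier R" if "(a, b) \<in> A" "(b, c) \<in> A" for a b c
    using that by (simp add: path_elem_closed walk_AA)
  show ?thesis
  proof (cases "card V = 2")
    case True
    have "vwalk [i, j, k, l] (with_proj G)"
      using walk_four[OF ijkl] True by (simp add: zigzag_quiver_def)
    then have "pe [i, j, k, l] \<in> zigzag_relations K G"
      using True unfolding zigzag_relations_def by (auto intro!: exI[of _ "[i, j, k, l]"])
    then show ?thesis by (rule proj_relation)
  next
    case card: False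
    have 1: "proj (pe [a, b, c, d]) = \<zero>\<^bsub>R\<^esub>" if "(a, b) \<in> A" "(b, c) \<in> A" "(c, d) \<in> A" "a \<noteq> c" for a b c d
      using that c2[OF that(3)] by (simp add: proj_four_split(1) proj_three_zero)
    have 2: "proj (pe [a, b, c, d]) = \<zero>\<^bsub>R\<^esub>" if "(a, b) \<in> A" "(b, c) \<in> A" "(c, d) \<in> A" "b \<noteq> d" for a b c d
      using that c2[OF that(1)] by (simp add: proj_four_split(2) proj_three_zero)
    show ?thesis
    proof (cases "i = k \<and> j = l")
      case True
      note ij = ijkl(1) and ji = A_symm[OF ijkl(1)]
      have "proj (pe [i, j, i, j]) = \<zero>\<^bsub>R\<^esub>"
      proof (rule third_vertex[OF ij card])
        fix m assume m: "(i, m) \<in> A" "m \<noteq> j"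
        note mi = A_symm[OF m(1)]
        have "proj (pe [i, j, i, j]) = proj (pe [i, m, i]) \<otimes>\<^bsub>R\<^esub> proj (pe [i, j])"
          using proj_four_split(1)[OF ij ji ij] proj_loops_eq[OF ij m(1)] by simp
        also have "\<dots> = proj (pe [i, m, i, j])" by (rule proj_four_split(1)[OF m(1) mi ij, symmetric])
        also have "\<dots> = \<zero>\<^bsub>R\<^esub>" by (rule 2[OF m(1) mi ij m(2)])
        finally show ?thesis .
      next
        fix m assume m: "(j, m) \<in> A" "m \<noteq> i"
        note mj = A_symm[OF m(1)]
        have "proj (pe [i, j, i, j]) = proj (pe [i, j]) \<otimes>\<^bsub>R\<^esub> proj (pe [j, m, j])"
          using proj_four_split(2)[OF ij ji ij] proj_loops_eq[OF ji m(1)] by simp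
        also have "\<dots> = proj (pe [i, j, m, j])" by (rule proj_four_split(2)[OF ij m(1) mj, symmetric])
        also have "\<dots> = \<zero>\<^bsub>R\<^esub>" by (rule 1[OF ij m(1) mj]) (use m(2) in simp)
        finally show ?thesis .
      qed
      then show ?thesis using True by simp
    next
      case False
      then show ?thesis using 1[OF ijkl] 2[OF ijkl] by blast
    qed
  qed
qed

text \<open>Paths of length at least three vanish, and one of length two is zero or a return, which
  may be taken through \<open>nbr i\<close> and is zero for i in \<open>C\<close>. With a single
  vertex the loop itself is killed.\<close>

lemma ex_normal_path:
  assumes p: "walk p"
  shows "\<exists>g\<in>carrier P. normal g \<and> proj (pe p) = proj g"
proof -
  have pc: "pe p \<in> carrier P" by (rule path_elem_closed[OF p])
  have zero: ?thesis if "proj (pe p) = \<zero>\<^bsub>R\<^esub>"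
    using that s.f_zero normal_zero PA.M.zero_closed by metis
  have self: ?thesis if "normal (pe p)" using that pc by blast
  have p0: "p \<noteq> []" "set p \<subseteq> V" using p by (auto simp: vwalk_def zigzag_quiver_def split: if_splits)
  show ?thesis
  proof (cases "card V = 1")
    case True
    then obtain v where v: "V = {v}" by (rule card_1_singletonE)
    obtain i r where ir: "p = i # r" using p0(1) by (cases p) auto
    show ?thesis
    proof (cases r)
      case Nil
      then show ?thesis using ir p0 by (intro self normal_pe) simp
    next
      case (Cons j r')
      then have pv: "p = v # v # r'" using ir p0(2) v by simp
      have "v \<in> C" using one_vertex(2)[OF True] v by simp
      then have "proj (pe [v, v]) = \<zero>\<^bsub>R\<^esub>" using proj_x[of v] True by (simp add: x_path_def)
      moreover have "walk [v, v]" "walk (v # r')"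
        using p0(2) pv v by (auto simp: walk_one_vertex[OF True])
      ultimately show ?thesis
        using proj_split_zero[OF p, of 1] pv by (intro zero) simp
    qed
  next
    case card: False
    have arcs: "set (vwalk_arcs p) \<subseteq> A" using p walk_arcs[OF card] by simp
    consider i where "p = [i]" | i j where "p = [i, j]" | i j k where "p = [i, j, k]"
      | i j k l r where "p = i # j # k # l # r"
      using p0(1) by (cases p; cases "tl p"; cases "tl (tl p)"; cases "tl (tl (tl p))") auto
    then show ?thesis
    proof cases
      case 1
      then show ?thesis using p0 by (intro self normal_pe) simp
    next
      case 2
      then show ?thesis using arcs by (intro self normal_pe) simp
    next
      case 3
      have ijk: "(i, j) \<in> A" "(j, k) \<in> A" using arcs 3 by auto
      show ?thesis
      proof (cases "i = k")
        case False
        then show ?thesis using proj_three_zero[OF ijk] 3 by (intro zero) simp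
      next
        case True
        have nb: "(i, nbr i) \<in> A" by (rule nbr[OF card A_V(1)[OF ijk(1)]])
        have eq: "proj (pe p) = proj (pe [i, nbr i, i])" using 3 True proj_loops_eq[OF ijk(1) nb] by simp
        show ?thesis
        proof (cases "i \<in> C")
          case True
          then show ?thesis using proj_x[OF True] card eq by (intro zero) (simp add: x_path_def)
        next
          case False
          then have "normal (pe [i, nbr i, i])" using A_V(1)[OF ijk(1)] by (intro normal_pe) auto
          moreover have "pe [i, nbr i, i] \<in> carrier P"
            by (intro path_elem_closed walk_AA[OF nb A_symm[OF nb]])
          ultimately show ?thesis using eq by blast
        qed
      qed
    next
      case 4
      have ijkl: "(i, j) \<in> A" "(j, k) \<in> A" "(k, l) \<in> A" using arcs 4 by auto
      have "walk (l # r)" using p 4 walk_arcs[OF card] by (cases r) auto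
      then show ?thesis
        using proj_split_zero[OF p, of 3] 4 proj_four_zero[OF ijkl] walk_four[OF ijkl]
        by (intro zero) (simp add: numeral_3_eq_3)
    qed
  qed
qed

lemma ex_normal:
  assumes "f \<in> carrier P"
  shows "\<exists>g\<in>carrier P. normal g \<and> proj f = proj g"
  using assms
proof (rule path_induct)
  show "\<exists>g\<in>carrier P. normal g \<and> proj (\<lambda>_. \<zero>) = proj g"
    using normal_zero PA.M.zero_closed unfolding P_simps(4) by blast
  fix f assume f: "f \<in> carrier P" "\<exists>g\<in>carrier P. normal g \<and> proj f = proj g"
  then obtain g where g: "g \<in> carrier P" "normal g" "proj f = proj g" by blast
  show "\<exists>g\<in>carrier P. normal g \<and> proj (r \<odot>\<^bsub>P\<^esub> f) = proj g" if r: "r \<in> carrier K" for r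
  proof (intro bexI conjI)
    show "normal (r \<odot>\<^bsub>P\<^esub> g)" using g(2) r unfolding normal_def P_simps(6) by (metis r_null)
    show "proj (r \<odot>\<^bsub>P\<^esub> f) = proj (r \<odot>\<^bsub>P\<^esub> g)" using f g r by (simp add: s.f_smult)
  qed (use g r in simp)
  fix f' assume f': "f' \<in> carrier P" "\<exists>g\<in>carrier P. normal g \<and> proj f' = proj g"
  then obtain g' where g': "g' \<in> carrier P" "normal g'" "proj f' = proj g'" by blast
  show "\<exists>g\<in>carrier P. normal g \<and> proj (f \<oplus>\<^bsub>P\<^esub> f') = proj g"
  proof (intro bexI conjI)
    have "g p \<noteq> \<zero> \<or> g' p \<noteq> \<zero>" if "(g \<oplus>\<^bsub>P\<^esub> g') p \<noteq> \<zero>" for p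
      using that unfolding P_simps(5) by (metis l_zero zero_closed)
    then show "normal (g \<oplus>\<^bsub>P\<^esub> g')" using g(2) g'(2) unfolding normal_def by meson
    show "proj (f \<oplus>\<^bsub>P\<^esub> f') = proj (g \<oplus>\<^bsub>P\<^esub> g')" using f g f' g' by (simp add: s.f_add)
  qed (use g g' in simp)
qed (rule ex_normal_path)

text \<open>f and a normal representative g differ by an element of the kernel, hence of
  \<open>null\<close>. So g is normal and lies in \<open>null\<close>, which makes it zero.\<close>

lemma null_kernel:
  assumes f: "f \<in> null"
  shows "proj f = \<zero>\<^bsub>R\<^esub>"
proof -
  have fc: "f \<in> carrier P" by (rule nullD(1)[OF f])
  obtain g where g: "g \<in> carrier P" "normal g" "proj f = proj g" using ex_normal[OF fc] by blast
  have "f \<ominus>\<^bsub>P\<^esub> g \<in> null"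
    by (rule kernel_null) (use fc g(1) s.f_minus[OF fc g(1,3)] in simp_all)
  note d = nullD[OF this] and fd = nullD[OF f]
  have "g \<in> null"
  proof (rule nullI[OF g(1)])
    have Ug: "U i g \<in> carrier K" for i using P_D(1)[OF g(1)] by (simp add: U_def)
    have neg: "x = \<zero>" if "y \<ominus> x = \<zero>" "y = \<zero>" "x \<in> carrier K" for x y
    proof -
      have "y = x" by (rule eq_if_minus_zero[OF _ that(3,1)]) (simp only: that(2) zero_closed)
      then show ?thesis using that(2) by simp
    qed
    note U_minus = PA.linear_form_minus[OF U_form fc g(1)]
    note T_minus = PA.linear_form_minus[OF T_form fc g(1)]
    show "U i g = \<zero>" if "i \<in> V" for i
      by (rule neg[OF d(2)[OF that, unfolded U_minus] fd(2)[OF that] Ug])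
    show "T i j g = \<zero>" if "(i, j) \<in> A" for i j
      by (rule neg[OF d(3)[OF that, unfolded T_minus] fd(3)[OF that] T_closed[OF g(1)]])
    show "T i i g = \<zero>" if "i \<in> V - C" for i
      by (rule neg[OF d(4)[OF that, unfolded T_minus] fd(4)[OF that] T_closed[OF g(1)]])
  qed
  then have "g = \<zero>\<^bsub>P\<^esub>" by (rule normal_null[OF g(2)])
  then show ?thesis using g(3) s.f_zero by simp
qed

end

section \<open>Coordinates on the quotient\<close>

context zigzag_setup
begin

lemma push_eq:
  assumes "PA.linear_form F" "\<And>f. f \<in> null \<Longrightarrow> F f = \<zero>" "f \<in> carrier P"
  shows "s.push F (proj f) = F f"
  by (rule s.push[OF assms(1) _ assms(3)]) (use assms(2) kernel_null in blast)

lemma null_T: "\<lbrakk>f \<in> null; (i, j) \<in> E\<rbrakk> \<Longrightarrow> T i j f = \<zero>"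
  by (auto simp: null_def)

lemma push_U: "\<lbrakk>i \<in> V; f \<in> carrier P\<rbrakk> \<Longrightarrow> s.push (U i) (proj f) = U i f"
  by (rule push_eq[OF U_form]) (use nullD(2) in blast)

lemma push_T: "\<lbrakk>(i, j) \<in> E; f \<in> carrier P\<rbrakk> \<Longrightarrow> s.push (T i j) (proj f) = T i j f"
  by (rule push_eq[OF T_form]) (auto simp: null_def)

lemma ex_representative:
  assumes f: "\<And>i. i \<in> V \<Longrightarrow> f i \<in> carrier K" and g: "\<And>i j. (i, j) \<in> E \<Longrightarrow> g i j \<in> carrier K"
  shows "\<exists>h\<in>carrier P. (\<forall>i\<in>V. U i h = f i) \<and> (\<forall>(i, j)\<in>E. T i j h = g i j)"
proof -
  \<comment> \<open>The value prescribed at x_i is placed entirely on the return through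
    \<open>nbr i\<close>.\<close>
  define h where "h = (\<lambda>p. if \<exists>i\<in>V. p = [i] then f (hd p)
    else if \<exists>i j. (i, j) \<in> A \<and> p = [i, j] then g (p ! 0) (p ! 1)
    else if \<exists>i\<in>V - C. p = [i, nbr i, i] then g (hd p) (hd p) else \<zero>)"
  have loop: "(i, i) \<in> E" if "i \<in> V - C" for i using that by (auto intro: Id_onI)
  have hv: "h p \<in> carrier K" for p
    unfolding h_def using f g loop by auto
  have "h \<in> carrier P"
  proof (rule P_I[OF hv])
    let ?S = "(\<lambda>i. [i]) ` V \<union> (\<lambda>(i, j). [i, j]) ` A \<union> (\<lambda>i. [i, nbr i, i]) ` V"
    show "h p = \<zero>" if "\<not> walk p" for p
    proof -
      have "walk [i, nbr i, i]" if "i \<in> V - C" for i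
        by (rule walk_AA[OF nbr_C[OF that] A_symm[OF nbr_C[OF that]]])
      then show ?thesis using that walk_singleton walk_A unfolding h_def by auto
    qed
    show "{p. h p \<noteq> \<zero>} \<subseteq> ?S" unfolding h_def by (auto split: if_splits)
    show "finite ?S" using V_finite A_finite by auto
  qed
  moreover have "U i h = f i" if "i \<in> V" for i using that by (simp add: U_def h_def)
  moreover have "T i j h = g i j" if "(i, j) \<in> A" for i j
    using that by (simp add: T_arc h_def)
  moreover have "T i i h = g i i" if i: "i \<in> V - C" for i
  proof -
    have "T i i h = (\<Oplus>k\<in>{k. (i, k) \<in> A}. if nbr i = k then g i i else \<zero>)"
      unfolding T_loop by (rule finsum_cong') (use i g loop in \<open>auto simp: h_def\<close>)
    also have "\<dots> = g i i"
      by (rule finsum_singleton) (use nbr_C[OF i] row_finite g loop[OF i] in auto)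
    finally show ?thesis .
  qed
  ultimately show ?thesis by blast
qed

text \<open>The candidate coordinates descend because they vanish on the kernel; the product rules
  and the remaining properties are checked on representatives.\<close>

lemma coordinates: "zigzag_coordinates K R V A C (\<lambda>i. s.push (U i)) (\<lambda>i j. s.push (T i j))"
proof (intro zigzag_coordinates.intro zigzag_coordinates_axioms.intro)
  interpret RA: k_algebra K R by (rule s.image_k_algebra)
  show "k_algebra K R" by (rule s.image_k_algebra)
  show "finite V" by (rule V_finite)
  show "A \<subseteq> V \<times> V" by (rule A_sub)
  show "C \<subseteq> V" by (rule C_verts)
  show "i \<noteq> j" "(j, i) \<in> A" if "(i, j) \<in> A" for i j using A_irr[OF that] A_symm[OF that] .
  show "RA.linear_form (s.push (U i))" if "i \<in> V" for i
    by (rule s.push_form[OF U_form]) (use that kernel_null nullD(2) in blast)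
  show "RA.linear_form (s.push (T i j))" if "(i, j) \<in> E" for i j
    by (rule s.push_form[OF T_form]) (use that kernel_null null_T in blast)
  note one = PA.one_closed
  have "pverts (zigzag_quiver G) = V" by (simp add: zigzag_quiver_def)
  then have one_simp: "\<one>\<^bsub>P\<^esub> p = (if \<exists>i\<in>V. p = [i] then \<one> else \<zero>)" for p
    by (simp add: P_simps(3))
  show "s.push (U i) \<one>\<^bsub>R\<^esub> = \<one>" if "i \<in> V" for i
    using push_U[OF that one] that by (simp add: s.f_one U_def one_simp)
  show "s.push (T i j) \<one>\<^bsub>R\<^esub> = \<zero>" if "(i, j) \<in> E" for i j
    using push_T[OF that one] by (simp add: s.f_one T_def one_simp)
  fix a assume "a \<in> carrier R"
  then obtain f where f: "f \<in> carrier P" "a = proj f" by (rule s.lift)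
  show "a = \<zero>\<^bsub>R\<^esub>" if "\<And>i. i \<in> V \<Longrightarrow> s.push (U i) a = \<zero>" "\<And>i j. (i, j) \<in> E \<Longrightarrow> s.push (T i j) a = \<zero>"
  proof -
    have "f \<in> null"
      unfolding null_def using f(1) that push_U push_T by (auto simp: f(2))
    then show ?thesis using null_kernel f(2) by simp
  qed
  fix b assume "b \<in> carrier R"
  then obtain g where g: "g \<in> carrier P" "b = proj g" by (rule s.lift)
  have ab: "a \<otimes>\<^bsub>R\<^esub> b = proj (f \<otimes>\<^bsub>P\<^esub> g)" using f g by (simp add: s.f_mult)
  have fg: "f \<otimes>\<^bsub>P\<^esub> g \<in> carrier P" using f g by simp
  show "s.push (U i) (a \<otimes>\<^bsub>R\<^esub> b) = s.push (U i) a \<otimes> s.push (U i) b" if "i \<in> V" for i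
    unfolding ab using that f g fg by (simp add: push_U U_mult)
  show "s.push (T i j) (a \<otimes>\<^bsub>R\<^esub> b)
    = s.push (U i) a \<otimes> s.push (T i j) b \<oplus> s.push (T i j) a \<otimes> s.push (U j) b" if "(i, j) \<in> A" for i j
    unfolding ab using that f g fg A_V by (simp add: push_U push_T T_mult_arc)
  show "s.push (T i i) (a \<otimes>\<^bsub>R\<^esub> b) = s.push (U i) a \<otimes> s.push (T i i) b \<oplus> s.push (T i i) a \<otimes> s.push (U i) b
      \<oplus> (\<Oplus>k\<in>{k. (i, k) \<in> A}. s.push (T i k) a \<otimes> s.push (T k i) b)" if i: "i \<in> V - C" for i
  proof -
    have "(i, i) \<in> E" using i by (auto intro: Id_onI)
    moreover have "(\<Oplus>k\<in>{k. (i, k) \<in> A}. s.push (T i k) a \<otimes> s.push (T k i) b)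
        = (\<Oplus>k\<in>{k. (i, k) \<in> A}. T i k f \<otimes> T k i g)"
      by (rule finsum_cong') (use f g A_symm T_closed in \<open>auto simp: push_T\<close>)
    ultimately show ?thesis
      unfolding ab using i f g fg by (simp add: push_U push_T T_mult_loop)
  qed
next
  show "\<exists>a\<in>carrier R. (\<forall>i\<in>V. s.push (U i) a = f i) \<and> (\<forall>(i, j)\<in>E. s.push (T i j) a = g i j)"
    if fg: "\<And>i. i \<in> V \<Longrightarrow> f i \<in> carrier K" "\<And>i j. (i, j) \<in> E \<Longrightarrow> g i j \<in> carrier K" for f g
  proof -
    obtain h where h: "h \<in> carrier P" "\<forall>i\<in>V. U i h = f i" "\<forall>(i, j)\<in>E. T i j h = g i j"
      using ex_representative[of f g] fg by blast
    show ?thesis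
    proof (rule bexI[of _ "proj h"])
      show "(\<forall>i\<in>V. s.push (U i) (proj h) = f i) \<and> (\<forall>(i, j)\<in>E. s.push (T i j) (proj h) = g i j)"
      proof (intro conjI ballI, goal_cases)
        case (1 i)
        then show ?case using h(1,2) push_U by simp
      next
        case (2 x)
        obtain i j where x: "x = (i, j)" by (cases x)
        then have ij: "(i, j) \<in> E" using 2 by simp
        then have "T i j h = g i j" using h(3) by blast
        then show ?case unfolding x using push_T[OF ij h(1)] by simp
      qed
    qed (use h(1) in simp)
  qed
qed

end

section \<open>Type A graphs as lists of vertices, and the equivalence\<close>

lemma line_of_pair_graph_iso:
  assumes iso: "pair_graph_iso \<phi> (type_A n) G" and n: "n \<ge> 1"
  defines "vs \<equiv> map \<phi> [1..<Suc n]"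
  shows "distinct vs" "set vs = pverts G" "vs \<noteq> []" "hd vs = \<phi> 1" "last vs = \<phi> n"
    and "parcs G = {(vs ! k, vs ! l) | k l. k < length vs \<and> l < length vs \<and> (l = Suc k \<or> k = Suc l)}"
proof -
  have bij: "bij_betw \<phi> {1..n} (pverts G)"
    and arcs: "parcs G = map_prod \<phi> \<phi> ` {(i, j). i \<in> {1..n} \<and> j \<in> {1..n} \<and> (j = i + 1 \<or> i = j + 1)}"
    using iso by (simp_all add: pair_graph_iso_def type_A_def)
  have up: "set [1..<Suc n] = {1..n}" by auto
  show "distinct vs" unfolding vs_def distinct_map up using bij by (simp add: bij_betw_def)
  show "set vs = pverts G" unfolding vs_def set_map up using bij by (simp add: bij_betw_def)
  show ne: "vs \<noteq> []" using n by (simp add: vs_def)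
  show "hd vs = \<phi> 1" using ne hd_conv_nth[OF ne] n by (simp add: vs_def del: upt_Suc)
  show "last vs = \<phi> n" unfolding vs_def using n by (simp add: last_map)
  have len: "length vs = n" and nth: "\<And>k. k < n \<Longrightarrow> vs ! k = \<phi> (Suc k)"
    by (simp_all add: vs_def del: upt_Suc)
  show "parcs G = {(vs ! k, vs ! l) | k l. k < length vs \<and> l < length vs \<and> (l = Suc k \<or> k = Suc l)}"
    unfolding arcs len
  proof (rule subset_antisym; rule subrelI)
    fix x y assume "(x, y) \<in> map_prod \<phi> \<phi> ` {(i, j). i \<in> {1..n} \<and> j \<in> {1..n} \<and> (j = i + 1 \<or> i = j + 1)}"
    then obtain i j where ij: "x = \<phi> i" "y = \<phi> j" "i \<in> {1..n}" "j \<in> {1..n}" "j = i + 1 \<or> i = j + 1" by auto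
    then have "x = vs ! (i - 1)" "y = vs ! (j - 1)" "i - 1 < n" "j - 1 < n"
      "j - 1 = Suc (i - 1) \<or> i - 1 = Suc (j - 1)" by (auto simp: nth)
    then show "(x, y) \<in> {(vs ! k, vs ! l) | k l. k < n \<and> l < n \<and> (l = Suc k \<or> k = Suc l)}" by blast
  next
    fix x y assume "(x, y) \<in> {(vs ! k, vs ! l) | k l. k < n \<and> l < n \<and> (l = Suc k \<or> k = Suc l)}"
    then obtain k l where kl: "x = vs ! k" "y = vs ! l" "k < n" "l < n" "l = Suc k \<or> k = Suc l" by blast
    then show "(x, y) \<in> map_prod \<phi> \<phi> ` {(i, j). i \<in> {1..n} \<and> j \<in> {1..n} \<and> (j = i + 1 \<or> i = j + 1)}"
      by (intro image_eqI[of _ _ "(Suc k, Suc l)"]) (auto simp: nth)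
  qed
qed

text \<open>Reversal moves a condition at the last vertex to the first, so that cell data have to be
  built for the latter case only.\<close>

lemma line_rev:
  "{(rev vs ! k, rev vs ! l) | k l. k < length vs \<and> l < length vs \<and> (l = Suc k \<or> k = Suc l)}
    = {(vs ! k, vs ! l) | k l. k < length vs \<and> l < length vs \<and> (l = Suc k \<or> k = Suc l)}" (is "?L = ?R")
proof (rule subset_antisym; rule subrelI)
  let ?r = "\<lambda>k. length vs - Suc k"
  fix x y assume "(x, y) \<in> ?L"
  then obtain k l where kl: "x = rev vs ! k" "y = rev vs ! l" "k < length vs" "l < length vs"
    "l = Suc k \<or> k = Suc l" by blast
  then have "x = vs ! ?r k \<and> y = vs ! ?r l \<and> ?r k < length vs \<and> ?r l < length vs
      \<and> (?r l = Suc (?r k) \<or> ?r k = Suc (?r l))"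
    by (auto simp: rev_nth)
  then show "(x, y) \<in> ?R" by blast
next
  let ?r = "\<lambda>k. length vs - Suc k"
  fix x y assume "(x, y) \<in> ?R"
  then obtain k l where kl: "x = vs ! k" "y = vs ! l" "k < length vs" "l < length vs"
    "l = Suc k \<or> k = Suc l" by blast
  then have "x = rev vs ! ?r k \<and> y = rev vs ! ?r l \<and> ?r k < length vs \<and> ?r l < length vs
      \<and> (?r l = Suc (?r k) \<or> ?r k = Suc (?r l))"
    by (auto simp: rev_nth)
  then show "(x, y) \<in> ?L" by blast
qed

text \<open>The shift by one translates list positions, which start at 0, into the vertices 1, ...,
  n.\<close>

lemma pair_graph_iso_of_line:
  assumes "distinct vs" "set vs = pverts G" "vs \<noteq> []"
    and arcs: "parcs G = {(vs ! k, vs ! l) | k l. k < length vs \<and> l < length vs \<and> (l = Suc k \<or> k = Suc l)}"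
  shows "pair_graph_iso (\<lambda>k. vs ! (k - 1)) (type_A (length vs)) G"
proof -
  have "bij_betw (\<lambda>k. k - 1) {1..length vs} {..<length vs}"
    by (rule bij_betw_byWitness[where f' = Suc]) auto
  from bij_betw_trans[OF this bij_betw_nth[OF assms(1) refl assms(2)[symmetric]]]
  have "bij_betw (\<lambda>k. vs ! (k - 1)) {1..length vs} (pverts G)" by (simp add: o_def)
  moreover have "parcs G = map_prod (\<lambda>k. vs ! (k - 1)) (\<lambda>k. vs ! (k - 1)) `
      {(i, j). i \<in> {1..length vs} \<and> j \<in> {1..length vs} \<and> (j = i + 1 \<or> i = j + 1)}" (is "_ = ?m ` ?S")
    unfolding arcs
  proof (rule subset_antisym; rule subrelI)
    fix x y assume "(x, y) \<in> {(vs ! k, vs ! l) | k l. k < length vs \<and> l < length vs \<and> (l = Suc k \<or> k = Suc l)}"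
    then obtain k l where "x = vs ! k" "y = vs ! l" "k < length vs" "l < length vs" "l = Suc k \<or> k = Suc l"
      by blast
    then show "(x, y) \<in> ?m ` ?S" by (intro image_eqI[of _ _ "(Suc k, Suc l)"]) auto
  next
    fix x y assume "(x, y) \<in> ?m ` ?S"
    then obtain i j where ij: "x = vs ! (i - 1)" "y = vs ! (j - 1)" "i \<in> {1..length vs}" "j \<in> {1..length vs}"
      "j = i + 1 \<or> i = j + 1" by auto
    then have "i - 1 < length vs" "j - 1 < length vs" "j - 1 = Suc (i - 1) \<or> i - 1 = Suc (j - 1)" by auto
    then show "(x, y) \<in> {(vs ! k, vs ! l) | k l. k < length vs \<and> l < length vs \<and> (l = Suc k \<or> k = Suc l)}"
      using ij(1,2) by blast
  qed
  ultimately show ?thesis by (simp add: pair_graph_iso_def type_A_def)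
qed

lemma (in zigzag_setup) type_A_if_relative_cellular:
  assumes "relative_cellular_algebra TYPE('x) TYPE('s) K R"
  shows "\<exists>n\<ge>1. \<exists>\<phi>. pair_graph_iso \<phi> (type_A n) G \<and> (C = {\<phi> 1} \<or> C = {\<phi> n})"
proof -
  obtain X :: "'x set" and M :: "'x \<Rightarrow> 's set" and Cb star Es leq eps
    where datum: "relative_cell_datum K R X M Cb star Es leq eps"
    using assms unfolding relative_cellular_algebra_def by blast
  interpret d: zigzag_cell_datum K R V A C "\<lambda>i. s.push (U i)" "\<lambda>i j. s.push (T i j)" X M Cb star Es leq eps
    by (intro zigzag_cell_datum.intro coordinates datum)
  obtain vs where vs: "distinct vs" "set vs = V" "vs \<noteq> []" "C = {hd vs}"
    "A = {(vs ! k, vs ! l) | k l. k < length vs \<and> l < length vs \<and> (l = Suc k \<or> k = Suc l)}"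
    using d.ex_line_of_cell_datum[OF closed_subset_eq C_nonempty] by blast
  have "pair_graph_iso (\<lambda>k. vs ! (k - 1)) (type_A (length vs)) G"
    by (rule pair_graph_iso_of_line[OF vs(1,2,3,5)])
  moreover have "C = {vs ! (1 - 1)}" using vs(3,4) by (simp add: hd_conv_nth)
  moreover have "length vs \<ge> 1" using vs(3) by (cases vs) auto
  ultimately show ?thesis by blast
qed

text \<open>An infinite index type contains a copy of the natural numbers, so the positions of a
  line of any length fit into it.\<close>

lemma (in zigzag_setup) cellular_if_line:
  fixes vs :: "'v list"
  assumes "distinct vs" "set vs = V" "vs \<noteq> []" "C = {hd vs}"
    "A = {(vs ! k, vs ! l) | k l. k < length vs \<and> l < length vs \<and> (l = Suc k \<or> k = Suc l)}"
  shows "cellular_algebra TYPE('x::infinite) TYPE('s::infinite) K R"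
proof -
  obtain p :: "nat \<Rightarrow> 'x" where p: "inj p" using infinite_countable_subset[OF infinite_UNIV] by blast
  obtain q :: "nat \<Rightarrow> 's" where q: "inj q" using infinite_countable_subset[OF infinite_UNIV] by blast
  interpret l: zigzag_line K R V A C "\<lambda>i. s.push (U i)" "\<lambda>i j. s.push (T i j)" vs p q
    by (intro zigzag_line.intro coordinates zigzag_line_axioms.intro assms p q)
  show ?thesis unfolding cellular_algebra_def using l.line_cell_datum by blast
qed

lemma (in zigzag_setup) cellular_if_type_A:
  assumes "n \<ge> 1" "pair_graph_iso \<phi> (type_A n) G" "C = {\<phi> 1} \<or> C = {\<phi> n}"
  shows "cellular_algebra TYPE('x::infinite) TYPE('s::infinite) K R"
proof -
  let ?vs = "map \<phi> [1..<Suc n]"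
  note vs = line_of_pair_graph_iso[OF assms(2,1)]
  from assms(3) show ?thesis
  proof
    assume "C = {\<phi> 1}"
    then show ?thesis by (intro cellular_if_line[OF vs(1,2,3) _ vs(6)]) (simp only: vs(4))
  next
    assume C: "C = {\<phi> n}"
    show ?thesis
    proof (rule cellular_if_line[of "rev ?vs"])
      show "C = {hd (rev ?vs)}" by (simp only: hd_rev vs(5) C)
      show "A = {(rev ?vs ! k, rev ?vs ! l) | k l.
          k < length (rev ?vs) \<and> l < length (rev ?vs) \<and> (l = Suc k \<or> k = Suc l)}"
        unfolding length_rev line_rev by (rule vs(6))
    qed (simp_all only: distinct_rev set_rev rev_is_Nil_conv vs(1-3) not_False_eq_True)
  qed
qed

theorem theorem1:
  fixes K :: "('k, 'm) ring_scheme" and G :: "'v pair_pre_digraph" and C :: "'v set"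
  assumes "field K"
    and "pair_graph G" and "Digraph_Component.connected (with_proj G)"
    and "C \<noteq> {}" and "C \<subseteq> pverts G"
  shows "(cellular_algebra TYPE('x::infinite) TYPE('s::infinite) K (zigzag_vertex_algebra K G C)
            \<longleftrightarrow> relative_cellular_algebra TYPE('x) TYPE('s) K (zigzag_vertex_algebra K G C))
       \<and> (relative_cellular_algebra TYPE('x) TYPE('s) K (zigzag_vertex_algebra K G C)
            \<longleftrightarrow> (\<exists>n\<ge>1. \<exists>\<phi>. pair_graph_iso \<phi> (type_A n) G \<and> (C = {\<phi> 1} \<or> C = {\<phi> n})))"
proof -
  interpret zigzag_setup K G C
    using assms by (intro zigzag_setup.intro zigzag_setup_axioms.intro)
  \<comment> \<open>A cell datum is a relative cell datum with the unit as only idempotent; two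
    further implications close the cycle.\<close>
  have "relative_cellular_algebra TYPE('x) TYPE('s) K R"
    if "cellular_algebra TYPE('x) TYPE('s) K R"
    using that unfolding cellular_algebra_def relative_cellular_algebra_def by blast
  moreover have "\<exists>n\<ge>1. \<exists>\<phi>. pair_graph_iso \<phi> (type_A n) G \<and> (C = {\<phi> 1} \<or> C = {\<phi> n})"
    if "relative_cellular_algebra TYPE('x) TYPE('s) K R"
    by (rule type_A_if_relative_cellular[OF that])
  moreover have "cellular_algebra TYPE('x) TYPE('s) K R"
    if "\<exists>n\<ge>1. \<exists>\<phi>. pair_graph_iso \<phi> (type_A n) G \<and> (C = {\<phi> 1} \<or> C = {\<phi> n})"
    using that cellular_if_type_A by blast
  ultimately show ?thesis by blast
qed

end
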